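(* Let $L\in\mathbb{R}^{n\times n}$ be symmetric positive semidefinite, let $\alpha\in[0,1]$, and let $\mu$ be the determinantal point process $\mu(S)\propto\left(\det(L_{S,S})\right)^\alpha$ for $S\subseteq[n]$. Then the generating polynomial $g_\mu$ is strongly log-concave; consequently the Glauber dynamics for $\mu$ satisfies the modified log-Sobolev inequality with constant at least $\frac{1}{(1+\max_iL_{i,i}^\alpha)n}$, and its mixing time is $O\left((1+\max_iL_{i,i}^\alpha)n\log n\right)$.
   Context: $L_{S,S}$ is the principal submatrix with rows and columns in $S$, with $\det(L_{\emptyset,\emptyset})=1$; $\mu$ is supported on the downward closed family $\mathcal{X}=\{S:\det(L_{S,S})>0\}$. The generating polynomial is $g_\mu(\mathbf{z})=\sum_{S\in\mathcal{X}}\mu(S)\prod_{i\in S}z_i$; it is strongly log-concave if for every $S\in\mathcal{X}$ the partial derivative $\prod_{i\in S}\partial_{z_i}g_\mu$ is log-concave on $\mathbb{R}^n_{>0}$. Glauber dynamics: pick $i\in[n]$ uniformly, let $S'=S\setminus\{i\}$; if $S'\cup\{i\}\notin\mathcal{X}$ move to $S'$, else move to $S'\cup\{i\}$ with probability $\frac{\mu(S'\cup\{i\})}{\mu(S')+\mu(S'\cup\{i\})}$ and to $S'$ otherwise. Modified log-Sobolev constant $\rho_0$: $\rho_0\mathrm{Ent}_\mu[f]\le\sum_x\mu(x)f(x)((I-P)\log f)(x)$ for all $f>0$, where $\mathrm{Ent}_\mu[f]=\mathbb{E}_\mu[f\log f]-\mathbb{E}_\mu[f]\log\mathbb{E}_\mu[f]$.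 Mixing time: $\max_x\min\{t:d_{\mathrm{TV}}(P^t(x,\cdot),\mu)\le1/4\}$. *)

theory Defs
  imports
    "HOL-Probability.Probability"
    "Jordan_Normal_Form.DL_Submatrix"
    "Jordan_Normal_Form.Determinant"
begin

text \<open>
  The ground set is \<open>{..<n}\<close>, and matrices are those of Jordan_Normal_Form: the dimension is a
  number rather than a type, so that one constant can serve all dimensions.
\<close>

section \<open>Determinantal point processes\<close>

definition pos_semidef_mat :: "nat \<Rightarrow> real mat \<Rightarrow> bool" where
  "pos_semidef_mat n L \<longleftrightarrow>
     L \<in> carrier_mat n n \<and> transpose_mat L = L \<and>
     (\<forall>v \<in> carrier_vec n. 0 \<le> scalar_prod v (L *\<^sub>v v))"

definition principal_minor :: "real mat \<Rightarrow> nat set \<Rightarrow> real" where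
  "principal_minor L S = Determinant.det (submatrix L S S)"

lemma principal_minor_empty: "principal_minor L {} = 1"
  unfolding principal_minor_def by (rule det_dim_zero) (simp add: submatrix_def)

definition dpp_support :: "nat \<Rightarrow> real mat \<Rightarrow> nat set set" where
  "dpp_support n L = {S. S \<subseteq> {..<n} \<and> 0 < principal_minor L S}"

text \<open>The support does not depend on \<open>\<alpha>\<close>; in particular singular minors keep mass 0 when \<open>\<alpha> = 0\<close>.\<close>

definition dpp :: "nat \<Rightarrow> real mat \<Rightarrow> real \<Rightarrow> nat set \<Rightarrow> real" where
  "dpp n L \<alpha> S =
     (if S \<in> dpp_support n L
      then principal_minor L S powr \<alpha> / (\<Sum>T \<in> dpp_support n L. principal_minor L T powr \<alpha>)
      else 0)"

section \<open>Strong log-concavity\<close>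

text \<open>
  Points of n-space are functions on \<open>nat\<close> of which only the values below \<open>n\<close> matter.
\<close>

definition generating_poly :: "nat set set \<Rightarrow> (nat set \<Rightarrow> real) \<Rightarrow> (nat \<Rightarrow> real) \<Rightarrow> real" where
  "generating_poly X \<mu> z = (\<Sum>S \<in> X. \<mu> S * (\<Prod>i \<in> S. z i))"

definition partial_deriv :: "nat \<Rightarrow> ((nat \<Rightarrow> real) \<Rightarrow> real) \<Rightarrow> (nat \<Rightarrow> real) \<Rightarrow> real" where
  "partial_deriv i g z = deriv (\<lambda>t. g (z(i := t))) (z i)"

text \<open>For polynomials the order of differentiation, here fixed by sorting, is irrelevant.\<close>

definition partial_derivs :: "nat set \<Rightarrow> ((nat \<Rightarrow> real) \<Rightarrow> real) \<Rightarrow> (nat \<Rightarrow> real) \<Rightarrow> real" where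
  "partial_derivs S g = foldr partial_deriv (sorted_list_of_set S) g"

definition log_concave_pos_orthant :: "nat \<Rightarrow> ((nat \<Rightarrow> real) \<Rightarrow> real) \<Rightarrow> bool" where
  "log_concave_pos_orthant n g \<longleftrightarrow>
     (\<forall>x. (\<forall>i<n. 0 < x i) \<longrightarrow> 0 < g x) \<and>
     (\<forall>x y t. (\<forall>i<n. 0 < x i) \<and> (\<forall>i<n. 0 < y i) \<and> 0 \<le> t \<and> t \<le> 1 \<longrightarrow>
        (1 - t) * ln (g x) + t * ln (g y) \<le> ln (g (\<lambda>i. (1 - t) * x i + t * y i)))"

definition strongly_log_concave :: "nat \<Rightarrow> nat set set \<Rightarrow> ((nat \<Rightarrow> real) \<Rightarrow> real) \<Rightarrow> bool" where
  "strongly_log_concave n X g \<longleftrightarrow> (\<forall>S \<in> X. log_concave_pos_orthant n (partial_derivs S g))"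

section \<open>Glauber dynamics\<close>

definition glauber :: "nat \<Rightarrow> nat set set \<Rightarrow> (nat set \<Rightarrow> real) \<Rightarrow> nat set \<Rightarrow> nat set pmf" where
  "glauber n X \<mu> S =
     bind_pmf (pmf_of_set {..<n}) (\<lambda>i.
       let S' = S - {i} in
       if insert i S' \<notin> X then return_pmf S'
       else map_pmf (\<lambda>b. if b then insert i S' else S')
              (bernoulli_pmf (\<mu> (insert i S') / (\<mu> S' + \<mu> (insert i S')))))"

definition chain_after :: "('a \<Rightarrow> 'a pmf) \<Rightarrow> nat \<Rightarrow> 'a \<Rightarrow> 'a pmf" where
  "chain_after P t x = ((\<lambda>p. bind_pmf p P) ^^ t) (return_pmf x)"

section \<open>Modified log-Sobolev inequality and mixing time\<close>

definition expect :: "'a set \<Rightarrow> ('a \<Rightarrow> real) \<Rightarrow> ('a \<Rightarrow> real) \<Rightarrow> real" where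
  "expect X \<mu> f = (\<Sum>x \<in> X. \<mu> x * f x)"

definition Ent :: "'a set \<Rightarrow> ('a \<Rightarrow> real) \<Rightarrow> ('a \<Rightarrow> real) \<Rightarrow> real" where
  "Ent X \<mu> f = expect X \<mu> (\<lambda>x. f x * ln (f x)) - expect X \<mu> f * ln (expect X \<mu> f)"

definition MLSI :: "'a set \<Rightarrow> ('a \<Rightarrow> real) \<Rightarrow> ('a \<Rightarrow> 'a pmf) \<Rightarrow> real \<Rightarrow> bool" where
  "MLSI X \<mu> P \<rho>\<^sub>0 \<longleftrightarrow>
     (\<forall>f. (\<forall>x \<in> X. 0 < f x) \<longrightarrow>
        \<rho>\<^sub>0 * Ent X \<mu> f
          \<le> (\<Sum>x \<in> X. \<mu> x * f x * (ln (f x) - (\<Sum>y \<in> X. pmf (P x) y * ln (f y)))))"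

definition tv_dist :: "'a set \<Rightarrow> 'a pmf \<Rightarrow> ('a \<Rightarrow> real) \<Rightarrow> real" where
  "tv_dist X p \<mu> = (\<Sum>y \<in> X. \<bar>pmf p y - \<mu> y\<bar>) / 2"

text \<open>Valued in \<open>enat\<close>, so that it is infinite if some state never comes within distance 1/4.\<close>

definition mixing_time :: "'a set \<Rightarrow> ('a \<Rightarrow> real) \<Rightarrow> ('a \<Rightarrow> 'a pmf) \<Rightarrow> enat" where
  "mixing_time X \<mu> P =
     (SUP x \<in> X. INF t \<in> {t. tv_dist X (chain_after P t x) \<mu> \<le> 1 / 4}. enat t)"

end

theory Submission
  imports Defs
begin

text \<open>
  Let \<open>w i S = \<mu> (insert i S) / \<mu> S\<close>. Everything rests on one local fact: for every \<open>S\<close> in the support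
  the form with coefficients \<open>w i S * w j S - \<mu> (insert i (insert j S)) / \<mu> S\<close> (the second term absent
  for \<open>i = j\<close>) is positive semidefinite. If \<open>K\<close> is the Schur complement of \<open>S\<close> and
  \<open>r i j = K i j / sqrt (K i i * K j j)\<close>, the coefficients are \<open>1 - (1 - (r i j)\<^sup>2)\<^sup>\<alpha>\<close> up to diagonal
  scaling, so this is Schur's product theorem.

  For the process in which elements die at rate 1 and are born at rate \<open>w i S\<close>, the local fact is
  Bochner's inequality and gives spectral gap 1. This holds for all links and all external fields,
  where for linear functions it says that the derivatives of the generating polynomial are
  log-concave. Log-concavity in turn makes the entropy convex along the process that reveals the
  elements at independent uniform times, which is the modified log-Sobolev inequality for the
  birth-death process; the conductances of the Glauber dynamics are at least
  \<open>1 / ((1 + M) * n)\<close> times those of the birth-death process.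

  The mixing bound must not depend on the smallest mass. From a state of mass \<open>exp (- poly n)\<close> the
  resolvent \<open>(I + (1 + M) n (I - P))\<^sup>-\<^sup>1\<close> halves the entropy, and a maximal inequality for
  positive semidefinite reversible chains passes from random to deterministic times. If \<open>1 + M \<le> 4\<^sup>n\<close>,
  such a state is reached once all elements have been updated. If \<open>1 + M \<ge> 4\<^sup>n\<close>, the exchange
  property of principal minors connects any other state to one of larger mass by edges of very large
  conductance, so the expected exit time is small.
\<close>

section \<open>The birth-death process of a weighted set family\<close>

text \<open>The birth-death process is reversible because
  \<open>m S * w i S = m (insert i S)\<close>, so its Dirichlet form has conductance
  \<open>m (insert i S)\<close> on each edge. Its gap has to be exactly 1: any loss would leave a
  diagonal term in the covariance form of the links, and convexity of the entropy uses the form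
  without that term.

  The smallest mass is not controlled by \<open>n\<close> and \<open>M\<close>, as minors may be
  arbitrarily close to 0, and entropy decay alone costs \<open>ln (ln (1 / \<mu> x))\<close>.
  Besides, the modified log-Sobolev inequality speaks of the generator and not of one discrete step.
  The resolvent is an implicit Euler step, for which it does give a contraction, at the price of a
  random time.

  The threshold for small masses is \<open>1 / 2 ^ (4 * n^2)\<close>: its double logarithm is of
  order \<open>ln n\<close>, and it lies below the masses that both cases compare it with. The value
  \<open>4 ^ n\<close> is set against the at most \<open>2 ^ n\<close> states below the threshold:
  as an upper bound for \<open>1 + M\<close> it keeps the empty set heavy enough to outweigh them
  together, as a lower bound it is the factor by which the resistance from each of them
  drops.\<close>

lemma sum_Pow_insert:
  fixes h :: "'a set \<Rightarrow> 'a \<Rightarrow> 'b::comm_monoid_add"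
  assumes "finite V"
  shows "(\<Sum>S\<in>Pow V. \<Sum>i\<in>S. h S i) = (\<Sum>S\<in>Pow V. \<Sum>i\<in>V-S. h (insert i S) i)"
proof -
  have "(\<Sum>S\<in>Pow V. \<Sum>i\<in>S. h S i) = (\<Sum>(S,i)\<in>Sigma (Pow V) (\<lambda>S. S). h S i)"
    using assms by (subst sum.Sigma) (auto intro: finite_subset)
  also have "\<dots> = (\<Sum>(S,i)\<in>Sigma (Pow V) (\<lambda>S. V - S). h (insert i S) i)"
    by (rule sum.reindex_bij_witness[where i="\<lambda>(S,i). (insert i S, i)" and j="\<lambda>(S,i). (S-{i}, i)"])
       (auto simp: insert_absorb)
  also have "\<dots> = (\<Sum>S\<in>Pow V. \<Sum>i\<in>V-S. h (insert i S) i)"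
    using assms by (subst sum.Sigma) auto
  finally show ?thesis .
qed

text \<open>\<open>m\<close> is not normalised, since links and external fields are not either.
  \<open>local\<close> is the form of the overview multiplied by \<open>(m S)^2\<close>, which
  removes the divisions.\<close>

locale weighted_family =
  fixes V :: "'a set" and m :: "'a set \<Rightarrow> real"
  assumes fin: "finite V"
    and nonneg: "\<And>S. 0 \<le> m S"
    and outside: "\<And>S. \<not> S \<subseteq> V \<Longrightarrow> m S = 0"
    and empty_pos: "0 < m {}"
    and down: "\<And>S T. 0 < m S \<Longrightarrow> T \<subseteq> S \<Longrightarrow> 0 < m T"
    and local: "\<And>S u. S \<subseteq> V \<Longrightarrow> 0 < m S \<Longrightarrow>
      0 \<le> (\<Sum>i\<in>V-S. \<Sum>j\<in>V-S. (m (insert i S) * m (insert j S)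
             - (if i = j then 0 else m S * m (insert i (insert j S)))) * u i * u j)"
begin

text \<open>Each edge is counted once, from its smaller end. Its conductance is the death flow
  \<open>m (insert i S)\<close>, which equals the birth flow \<open>m S * w i S\<close>.\<close>

definition dirichlet :: "('a set \<Rightarrow> real) \<Rightarrow> ('a set \<Rightarrow> real) \<Rightarrow> real" where
  "dirichlet F G = (\<Sum>S\<in>Pow V. \<Sum>i\<in>V-S. m (insert i S) * (F (insert i S) - F S) * (G (insert i S) - G S))"

definition birth :: "('a set \<Rightarrow> real) \<Rightarrow> 'a set \<Rightarrow> real" where
  "birth F S = (\<Sum>i\<in>V-S. m (insert i S) / m S * (F (insert i S) - F S))"

definition death :: "('a set \<Rightarrow> real) \<Rightarrow> 'a set \<Rightarrow> real" where
  "death F S = (\<Sum>i\<in>S. F S - F (S - {i}))"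

lemma down0: "T \<subseteq> S \<Longrightarrow> m T = 0 \<Longrightarrow> m S = 0"
  using down[of S T] nonneg[of S] by (cases "m S = 0") auto

lemma m_birth: "m S * birth F S = (\<Sum>i\<in>V-S. m (insert i S) * (F (insert i S) - F S))"
  unfolding birth_def sum_distrib_left
  by (rule sum.cong[OF refl]) (use down0[of S "insert _ S"] in auto)

text \<open>Discrete summation by parts: reindexing the deaths by the smaller set turns them into
  births seen from the other end of the edge.\<close>

lemma generator_adjoint:
  "(\<Sum>S\<in>Pow V. m S * G S * (birth F S - death F S)) = - dirichlet F G"
proof -
  have a: "(\<Sum>S\<in>Pow V. m S * G S * birth F S)
     = (\<Sum>S\<in>Pow V. \<Sum>i\<in>V-S. m (insert i S) * (F (insert i S) - F S) * G S)"
  proof (rule sum.cong[OF refl])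
    fix S
    have "m S * G S * birth F S = G S * (m S * birth F S)" by simp
    then show "m S * G S * birth F S = (\<Sum>i\<in>V-S. m (insert i S) * (F (insert i S) - F S) * G S)"
      unfolding m_birth by (simp add: sum_distrib_left mult_ac)
  qed
  have "(\<Sum>S\<in>Pow V. m S * G S * death F S) = (\<Sum>S\<in>Pow V. \<Sum>i\<in>S. m S * G S * (F S - F (S - {i})))"
    unfolding death_def by (simp add: sum_distrib_left)
  also have "\<dots> = (\<Sum>S\<in>Pow V. \<Sum>i\<in>V-S. m (insert i S) * G (insert i S) * (F (insert i S) - F S))"
    by (subst sum_Pow_insert[OF fin]) (auto intro!: sum.cong)
  finally have d: "(\<Sum>S\<in>Pow V. m S * G S * death F S)
     = (\<Sum>S\<in>Pow V. \<Sum>i\<in>V-S. m (insert i S) * G (insert i S) * (F (insert i S) - F S))" .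
  have "(\<Sum>S\<in>Pow V. m S * G S * (birth F S - death F S))
     = (\<Sum>S\<in>Pow V. m S * G S * birth F S) - (\<Sum>S\<in>Pow V. m S * G S * death F S)"
    by (simp add: right_diff_distrib sum_subtractf)
  also have "\<dots> = - dirichlet F G"
    unfolding a d dirichlet_def sum_subtractf[symmetric] sum_negf[symmetric]
    by (intro sum.cong refl) (simp add: algebra_simps)
  finally show ?thesis .
qed

text \<open>Bochner's inequality. The square of the generator splits into births times births, births
  times deaths and deaths times deaths; after reindexing the last two by the smaller set, only
  the local form and a sum of squares of second differences remain besides the Dirichlet form.\<close>

lemma bochner: "dirichlet F F \<le> (\<Sum>S\<in>Pow V. m S * (birth F S - death F S)\<^sup>2)"
proof -
  define D where "D i S = F (insert i S) - F S" for i S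
  define q where "q S i j = (if i = j then 0 else m (insert i (insert j S)))" for S i j
  have bb: "(\<Sum>S\<in>Pow V. m S * birth F S * birth F S)
    = (\<Sum>S\<in>Pow V. \<Sum>i\<in>V-S. \<Sum>j\<in>V-S. m (insert i S) * m (insert j S) / m S * D i S * D j S)"
  proof (rule sum.cong[OF refl])
    fix S
    have "m S * birth F S * birth F S = (\<Sum>i\<in>V-S. m (insert i S) * D i S) * (\<Sum>j\<in>V-S. m (insert j S) / m S * D j S)"
      unfolding m_birth D_def by (simp add: birth_def)
    also have "\<dots> = (\<Sum>i\<in>V-S. \<Sum>j\<in>V-S. m (insert i S) * m (insert j S) / m S * D i S * D j S)"
      unfolding sum_product by (intro sum.cong refl) (simp add: field_simps)
    finally show "m S * birth F S * birth F S = \<dots>" .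
  qed
  have bd: "(\<Sum>S\<in>Pow V. m S * birth F S * death F S)
    = (\<Sum>S\<in>Pow V. \<Sum>i\<in>V-S. \<Sum>j\<in>V-S. q S i j * D j (insert i S) * D i S)"
  proof -
    have "(\<Sum>S\<in>Pow V. m S * birth F S * death F S)
       = (\<Sum>S\<in>Pow V. \<Sum>i\<in>S. m S * birth F S * (F S - F (S - {i})))"
      unfolding death_def by (simp add: sum_distrib_left)
    also have "\<dots> = (\<Sum>S\<in>Pow V. \<Sum>i\<in>V-S. m (insert i S) * birth F (insert i S) * D i S)"
      by (subst sum_Pow_insert[OF fin]) (auto intro!: sum.cong simp: D_def)
    also have "\<dots> = (\<Sum>S\<in>Pow V. \<Sum>i\<in>V-S. \<Sum>j\<in>V-S. q S i j * D j (insert i S) * D i S)"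
    proof (intro sum.cong refl)
      fix S i assume S: "S \<in> Pow V" and i: "i \<in> V - S"
      have "m (insert i S) * birth F (insert i S) * D i S
        = (\<Sum>j\<in>V - insert i S. m (insert j (insert i S)) * D j (insert i S)) * D i S"
        unfolding m_birth D_def ..
      also have "\<dots> = (\<Sum>j\<in>V - insert i S. q S i j * D j (insert i S) * D i S)"
        unfolding sum_distrib_right by (intro sum.cong refl) (auto simp: q_def insert_commute)
      also have "\<dots> = (\<Sum>j\<in>V - S. q S i j * D j (insert i S) * D i S)"
        by (rule sum.mono_neutral_left) (use fin in \<open>auto simp: q_def\<close>)
      finally show "m (insert i S) * birth F (insert i S) * D i S = \<dots>" .
    qed
    finally show ?thesis .
  qed
  \<comment> \<open>Removing the same element twice yields the Dirichlet form itself. As elements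
    die at rate 1, this is where the constant of the inequality comes from.\<close>
  have dd: "(\<Sum>S\<in>Pow V. m S * death F S * death F S)
    = dirichlet F F + (\<Sum>S\<in>Pow V. \<Sum>i\<in>V-S. \<Sum>j\<in>V-S. q S i j * D j (insert i S) * D i (insert j S))"
  proof -
    define h where "h S i = m S * (F S - F (S - {i})) * death F S" for S i
    have "(\<Sum>S\<in>Pow V. m S * death F S * death F S) = (\<Sum>S\<in>Pow V. \<Sum>i\<in>S. h S i)"
      unfolding h_def by (subst (1) death_def) (simp add: sum_distrib_left sum_distrib_right)
    also have "\<dots> = (\<Sum>S\<in>Pow V. \<Sum>i\<in>V-S. h (insert i S) i)"
      by (rule sum_Pow_insert[OF fin])
    also have "\<dots> = (\<Sum>S\<in>Pow V. \<Sum>i\<in>V-S. m (insert i S) * D i S * D i S)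
       + (\<Sum>S\<in>Pow V. \<Sum>i\<in>V-S. \<Sum>j\<in>S. m (insert i S) * D i S * (F (insert i S) - F (insert i S - {j})))"
      unfolding sum.distrib[symmetric]
    proof (intro sum.cong refl)
      fix S i assume S: "S \<in> Pow V" and i: "i \<in> V - S"
      have "finite S" using S fin by (auto intro: finite_subset)
      then have "death F (insert i S) = D i S + (\<Sum>j\<in>S. F (insert i S) - F (insert i S - {j}))"
        unfolding death_def D_def using i by simp
      moreover have "h (insert i S) i = m (insert i S) * D i S * death F (insert i S)"
        using i unfolding h_def D_def by simp
      ultimately show "h (insert i S) i = m (insert i S) * D i S * D i S
          + (\<Sum>j\<in>S. m (insert i S) * D i S * (F (insert i S) - F (insert i S - {j})))"
        by (simp add: distrib_left sum_distrib_left[symmetric])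
    qed
    also have "(\<Sum>S\<in>Pow V. \<Sum>i\<in>V-S. \<Sum>j\<in>S. m (insert i S) * D i S * (F (insert i S) - F (insert i S - {j})))
      = (\<Sum>S\<in>Pow V. \<Sum>j\<in>S. \<Sum>i\<in>V-S. m (insert i S) * D i S * (F (insert i S) - F (insert i S - {j})))"
      by (intro sum.cong refl sum.swap)
    also have "\<dots> = (\<Sum>S\<in>Pow V. \<Sum>j\<in>V-S. \<Sum>i\<in>V-insert j S. m (insert i (insert j S)) * D i (insert j S)
          * (F (insert i (insert j S)) - F (insert i (insert j S) - {j})))"
      by (rule sum_Pow_insert[OF fin])
    also have "\<dots> = (\<Sum>S\<in>Pow V. \<Sum>j\<in>V-S. \<Sum>i\<in>V-S. q S i j * D j (insert i S) * D i (insert j S))"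
    proof (rule sum.cong[OF refl], rule sum.cong[OF refl])
      fix S j assume S: "S \<in> Pow V" and j: "j \<in> V - S"
      have "(\<Sum>i\<in>V-insert j S. m (insert i (insert j S)) * D i (insert j S)
          * (F (insert i (insert j S)) - F (insert i (insert j S) - {j})))
        = (\<Sum>i\<in>V-insert j S. q S i j * D j (insert i S) * D i (insert j S))"
      proof (intro sum.cong refl)
        fix i assume "i \<in> V - insert j S"
        then have "insert i (insert j S) - {j} = insert i S" "i \<noteq> j" using j by auto
        then show "m (insert i (insert j S)) * D i (insert j S)
          * (F (insert i (insert j S)) - F (insert i (insert j S) - {j})) = q S i j * D j (insert i S) * D i (insert j S)"
          by (simp add: q_def D_def insert_commute)
      qed
      also have "\<dots> = (\<Sum>i\<in>V-S. q S i j * D j (insert i S) * D i (insert j S))"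
        by (rule sum.mono_neutral_left) (use fin in \<open>auto simp: q_def\<close>)
      finally show "(\<Sum>i\<in>V-insert j S. m (insert i (insert j S)) * D i (insert j S)
          * (F (insert i (insert j S)) - F (insert i (insert j S) - {j}))) = \<dots>" .
    qed
    also have "\<dots> = (\<Sum>S\<in>Pow V. \<Sum>i\<in>V-S. \<Sum>j\<in>V-S. q S i j * D j (insert i S) * D i (insert j S))"
      by (intro sum.cong refl sum.swap)
    finally show ?thesis unfolding dirichlet_def D_def by simp
  qed
  have key: "(\<Sum>S\<in>Pow V. m S * (birth F S - death F S)\<^sup>2) = dirichlet F F
     + (\<Sum>S\<in>Pow V. \<Sum>i\<in>V-S. \<Sum>j\<in>V-S. m (insert i S) * m (insert j S) / m S * D i S * D j S
          + q S i j * (D j (insert i S) * D i (insert j S) - 2 * (D j (insert i S) * D i S)))"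
  proof -
    have "(\<Sum>S\<in>Pow V. m S * (birth F S - death F S)\<^sup>2) = (\<Sum>S\<in>Pow V. m S * birth F S * birth F S)
       - 2 * (\<Sum>S\<in>Pow V. m S * birth F S * death F S) + (\<Sum>S\<in>Pow V. m S * death F S * death F S)"
      unfolding sum_distrib_left sum_subtractf[symmetric] sum.distrib[symmetric]
      by (intro sum.cong refl) (simp add: power2_eq_square algebra_simps)
    then show ?thesis unfolding bb bd dd
      by (simp add: sum.distrib sum_subtractf sum_distrib_left algebra_simps)
  qed
  have "0 \<le> (\<Sum>i\<in>V-S. \<Sum>j\<in>V-S. m (insert i S) * m (insert j S) / m S * D i S * D j S
          + q S i j * (D j (insert i S) * D i (insert j S) - 2 * (D j (insert i S) * D i S)))"
    (is "0 \<le> ?R") if S: "S \<in> Pow V" for S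
  proof (cases "m S = 0")
    case True
    have "q S i j = 0" for i j
      unfolding q_def using True down0[of S "insert i (insert j S)"] by auto
    then show ?thesis using True by simp
  next
    case False
    then have pos: "0 < m S" using nonneg[of S] by simp
    \<comment> \<open>The cross term is written once in each order of \<open>i\<close> and
      \<open>j\<close>. With the identity \<open>e\<close> below, the factor of
      \<open>q S i j\<close> becomes the squared second difference minus
      \<open>D i S * D j S\<close>, and this last product completes the local form.\<close>
    define A where "A = (\<Sum>i\<in>V-S. \<Sum>j\<in>V-S. q S i j * (D j (insert i S) * D i S))"
    have A': "A = (\<Sum>i\<in>V-S. \<Sum>j\<in>V-S. q S i j * (D i (insert j S) * D j S))"
      unfolding A_def by (subst sum.swap) (auto intro!: sum.cong simp: q_def insert_commute)
    have "?R = (\<Sum>i\<in>V-S. \<Sum>j\<in>V-S. m (insert i S) * m (insert j S) / m S * D i S * D j S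
          + q S i j * (D j (insert i S) * D i (insert j S))) - (A + A)"
      unfolding A_def by (simp add: sum.distrib sum_subtractf algebra_simps sum_distrib_left)
    also have "\<dots> = (\<Sum>i\<in>V-S. \<Sum>j\<in>V-S. m (insert i S) * m (insert j S) / m S * D i S * D j S
          + q S i j * (D j (insert i S) * D i (insert j S)
              - D j (insert i S) * D i S - D i (insert j S) * D j S))"
      by (subst (2) A', subst A_def) (simp add: sum.distrib sum_subtractf algebra_simps)
    also have "\<dots> = (\<Sum>i\<in>V-S. \<Sum>j\<in>V-S. (m (insert i S) * m (insert j S)
             - (if i = j then 0 else m S * m (insert i (insert j S)))) * D i S * D j S) / m S
        + (\<Sum>i\<in>V-S. \<Sum>j\<in>V-S. q S i j * (D j (insert i S) - D j S)\<^sup>2)"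
      unfolding sum_divide_distrib sum.distrib[symmetric]
    proof (intro sum.cong refl)
      fix i j
      have e: "D i (insert j S) = D j (insert i S) - D j S + D i S"
        unfolding D_def by (simp add: insert_commute)
      show "m (insert i S) * m (insert j S) / m S * D i S * D j S
          + q S i j * (D j (insert i S) * D i (insert j S)
              - D j (insert i S) * D i S - D i (insert j S) * D j S)
        = (m (insert i S) * m (insert j S)
             - (if i = j then 0 else m S * m (insert i (insert j S)))) * D i S * D j S / m S
        + q S i j * (D j (insert i S) - D j S)\<^sup>2"
        unfolding e using pos by (simp add: q_def field_simps power2_eq_square)
    qed
    also have "\<dots> \<ge> 0"
    proof (rule add_nonneg_nonneg)
      show "0 \<le> (\<Sum>i\<in>V-S. \<Sum>j\<in>V-S. (m (insert i S) * m (insert j S)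
             - (if i = j then 0 else m S * m (insert i (insert j S)))) * D i S * D j S) / m S"
        using local[OF PowD[OF S] pos, of "\<lambda>i. D i S"] pos by (intro divide_nonneg_nonneg) auto
      show "0 \<le> (\<Sum>i\<in>V-S. \<Sum>j\<in>V-S. q S i j * (D j (insert i S) - D j S)\<^sup>2)"
        using nonneg by (intro sum_nonneg mult_nonneg_nonneg) (auto simp: q_def)
    qed
    finally show ?thesis .
  qed
  then have "0 \<le> (\<Sum>S\<in>Pow V. \<Sum>i\<in>V-S. \<Sum>j\<in>V-S. m (insert i S) * m (insert j S) / m S * D i S * D j S
          + q S i j * (D j (insert i S) * D i (insert j S) - 2 * (D j (insert i S) * D i S)))"
    by (rule sum_nonneg)
  then show ?thesis unfolding key by simp
qed

section \<open>Spectral gap of the birth-death process\<close>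

lemma dirichlet_nonneg: "0 \<le> dirichlet F F"
  unfolding dirichlet_def by (intro sum_nonneg) (simp add: nonneg mult.assoc)

definition total :: real where "total = (\<Sum>S\<in>Pow V. m S)"

text \<open>This is \<open>total\<close> times the variance under the normalised measure.\<close>

definition variance :: "('a set \<Rightarrow> real) \<Rightarrow> real" where
  "variance F = (\<Sum>S\<in>Pow V. m S * (F S)\<^sup>2) - (\<Sum>S\<in>Pow V. m S * F S)\<^sup>2 / total"

lemma total_pos: "0 < total"
proof -
  have "m {} \<le> total" unfolding total_def
    using fin nonneg by (intro member_le_sum) auto
  then show ?thesis using empty_pos by simp
qed

lemma variance_le: "variance F \<le> (\<Sum>S\<in>Pow V. m S * (F S - c)\<^sup>2)"
proof -
  define a where "a = (\<Sum>S\<in>Pow V. m S * F S)"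
  have "(\<Sum>S\<in>Pow V. m S * (F S - c)\<^sup>2) = (\<Sum>S\<in>Pow V. m S * (F S)\<^sup>2) - 2 * c * a + c\<^sup>2 * total"
    unfolding total_def a_def sum_distrib_left sum_subtractf[symmetric] sum.distrib[symmetric]
    by (intro sum.cong refl) (simp add: power2_eq_square algebra_simps)
  moreover have "0 \<le> (a - c * total)\<^sup>2 / total" using total_pos by simp
  moreover have "(a - c * total)\<^sup>2 / total = a\<^sup>2 / total - 2 * c * a + c\<^sup>2 * total"
    using total_pos by (simp add: field_simps power2_eq_square)
  ultimately show ?thesis unfolding variance_def a_def by simp
qed

lemma dirichlet_ge_edge:
  assumes "S \<subseteq> V" "i \<in> V - S"
  shows "m (insert i S) * (F (insert i S) - F S)\<^sup>2 \<le> dirichlet F F"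
proof -
  have "m (insert i S) * (F (insert i S) - F S)\<^sup>2
      \<le> (\<Sum>i\<in>V-S. m (insert i S) * (F (insert i S) - F S) * (F (insert i S) - F S))"
    using assms fin nonneg by (intro order_trans[OF _ member_le_sum[of i]])
      (auto simp: power2_eq_square mult.assoc)
  also have "\<dots> \<le> dirichlet F F" unfolding dirichlet_def
    using assms fin nonneg by (intro member_le_sum) (auto intro!: sum_nonneg simp: mult.assoc)
  finally show ?thesis .
qed

text \<open>Some constant must exist for the infimum in \<open>poincare\<close> to be taken over a
  nonempty set; its size does not matter. Downward closedness provides a path from every state to
  \<open>{}\<close>.\<close>

lemma crude_poincare: "\<exists>C. \<forall>F. variance F \<le> C * dirichlet F F"
proof -
  have ex: "\<exists>C. \<forall>F. m S * (F S - F {})\<^sup>2 \<le> C * dirichlet F F" if "S \<subseteq> V" for S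
  proof -
    have "finite S" using that fin finite_subset by blast
    then have "0 < m S \<longrightarrow> (\<exists>C. \<forall>F. (F S - F {})\<^sup>2 \<le> C * dirichlet F F)" using that
    proof (induction S rule: finite_induct)
      case empty
      then show ?case by (auto intro!: exI[of _ 0])
    next
      case (insert i S)
      show ?case
      proof
        assume pos: "0 < m (insert i S)"
        then have "0 < m S" using down by blast
        then obtain C where C: "\<And>F. (F S - F {})\<^sup>2 \<le> C * dirichlet F F"
          using insert by auto
        have "(F (insert i S) - F {})\<^sup>2 \<le> (2 / m (insert i S) + 2 * C) * dirichlet F F" for F
        proof -
          have "(F (insert i S) - F {})\<^sup>2 \<le> 2 * (F (insert i S) - F S)\<^sup>2 + 2 * (F S - F {})\<^sup>2"
            using zero_le_power2[of "(F (insert i S) - F S) - (F S - F {})"]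
            by (simp add: power2_eq_square algebra_simps)
          moreover have "(F (insert i S) - F S)\<^sup>2 \<le> dirichlet F F / m (insert i S)"
            using dirichlet_ge_edge[of S i F] insert pos by (simp add: field_simps)
          ultimately show ?thesis using C[of F] by (simp add: algebra_simps)
        qed
        then show "\<exists>C. \<forall>F. (F (insert i S) - F {})\<^sup>2 \<le> C * dirichlet F F" by blast
      qed
    qed
    then consider "m S = 0" | C where "\<And>F. (F S - F {})\<^sup>2 \<le> C * dirichlet F F"
      using nonneg[of S] by (cases "m S = 0") auto
    then show ?thesis
    proof cases
      case 1
      then show ?thesis by (auto intro!: exI[of _ 0])
    next
      case 2
      then show ?thesis using mult_left_mono[OF 2 nonneg[of S]]
        by (auto intro!: exI[of _ "m S * C"] simp: mult.assoc)
    qed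
  qed
  then obtain C where C: "\<And>S F. S \<subseteq> V \<Longrightarrow> m S * (F S - F {})\<^sup>2 \<le> C S * dirichlet F F"
    by metis
  have "variance F \<le> (\<Sum>S\<in>Pow V. C S) * dirichlet F F" for F
    using variance_le[of F "F {}"] unfolding sum_distrib_right
    by (rule order_trans) (auto intro!: sum_mono C)
  then show ?thesis by blast
qed

text \<open>The generator is bounded on a finite space; this controls the second-order term when
  \<open>F\<close> is perturbed along the generator.\<close>

lemma dirichlet_bounded: "\<exists>B\<ge>0. \<forall>F. dirichlet F F \<le> B * (\<Sum>S\<in>Pow V. m S * (F S)\<^sup>2)"
proof -
  define W where "W = (\<Sum>S\<in>Pow V. \<Sum>i\<in>V-S. m (insert i S) / m S)"
  have W: "m (insert i S) \<le> W * m S" if "S \<in> Pow V" "i \<in> V - S" for S i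
  proof (cases "m S = 0")
    case True
    then show ?thesis using down0[of S "insert i S", OF subset_insertI] by auto
  next
    case False
    then have pos: "0 < m S" using nonneg[of S] by simp
    have "m (insert i S) / m S \<le> (\<Sum>i\<in>V-S. m (insert i S) / m S)"
      using that fin nonneg by (intro member_le_sum) auto
    also have "\<dots> \<le> W" unfolding W_def
      using that fin nonneg by (intro member_le_sum) (auto intro!: sum_nonneg)
    finally show ?thesis using pos by (simp add: field_simps)
  qed
  have W0: "0 \<le> W" unfolding W_def by (intro sum_nonneg) (simp add: nonneg)
  have "dirichlet F F \<le> (\<Sum>S\<in>Pow V. \<Sum>i\<in>V-S. 2 * W * (m S * (F S)\<^sup>2) + 2 * (m (insert i S) * (F (insert i S))\<^sup>2))" for F
    unfolding dirichlet_def
  proof (intro sum_mono)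
    fix S i assume "S \<in> Pow V" "i \<in> V - S"
    have "(F (insert i S) - F S) * (F (insert i S) - F S) \<le> 2 * (F S)\<^sup>2 + 2 * (F (insert i S))\<^sup>2"
      using zero_le_power2[of "F (insert i S) + F S"] by (simp add: power2_eq_square algebra_simps)
    then have "m (insert i S) * ((F (insert i S) - F S) * (F (insert i S) - F S))
       \<le> m (insert i S) * (2 * (F S)\<^sup>2 + 2 * (F (insert i S))\<^sup>2)"
      by (rule mult_left_mono) (rule nonneg)
    also have "\<dots> \<le> (W * m S) * (2 * (F S)\<^sup>2) + m (insert i S) * (2 * (F (insert i S))\<^sup>2)"
      using mult_right_mono[OF W[OF \<open>S \<in> Pow V\<close> \<open>i \<in> V - S\<close>], of "2 * (F S)\<^sup>2"] by (simp add: distrib_left)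
    finally show "m (insert i S) * (F (insert i S) - F S) * (F (insert i S) - F S)
       \<le> 2 * W * (m S * (F S)\<^sup>2) + 2 * (m (insert i S) * (F (insert i S))\<^sup>2)"
      by (simp add: mult_ac)
  qed
  also have "(\<Sum>S\<in>Pow V. \<Sum>i\<in>V-S. 2 * W * (m S * (F S)\<^sup>2) + 2 * (m (insert i S) * (F (insert i S))\<^sup>2))
     \<le> (2 * W * card V + 2 * card V) * (\<Sum>S\<in>Pow V. m S * (F S)\<^sup>2)" for F
  proof -
    have "(\<Sum>S\<in>Pow V. \<Sum>i\<in>V-S. 2 * (m (insert i S) * (F (insert i S))\<^sup>2))
       = (\<Sum>S\<in>Pow V. \<Sum>i\<in>S. 2 * (m S * (F S)\<^sup>2))"
      by (rule sum_Pow_insert[OF fin, symmetric])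
    also have "\<dots> \<le> (\<Sum>S\<in>Pow V. card V * (2 * (m S * (F S)\<^sup>2)))"
    proof (intro sum_mono)
      fix S assume "S \<in> Pow V"
      then have "card S \<le> card V" using fin by (auto intro: card_mono)
      then show "(\<Sum>i\<in>S. 2 * (m S * (F S)\<^sup>2)) \<le> card V * (2 * (m S * (F S)\<^sup>2))"
        using nonneg by (simp add: mult_right_mono)
    qed
    moreover have "(\<Sum>S\<in>Pow V. \<Sum>i\<in>V-S. 2 * W * (m S * (F S)\<^sup>2)) \<le> (\<Sum>S\<in>Pow V. card V * (2 * W * (m S * (F S)\<^sup>2)))"
    proof (intro sum_mono)
      fix S assume "S \<in> Pow V"
      then have "card (V - S) \<le> card V" using fin by (auto intro: card_mono)
      then show "(\<Sum>i\<in>V-S. 2 * W * (m S * (F S)\<^sup>2)) \<le> card V * (2 * W * (m S * (F S)\<^sup>2))"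
        using nonneg W0 by (simp add: mult_right_mono)
    qed
    ultimately show ?thesis unfolding sum.distrib by (simp add: sum_distrib_left algebra_simps sum.distrib)
  qed
  finally have "dirichlet F F \<le> (2 * W * card V + 2 * card V) * (\<Sum>S\<in>Pow V. m S * (F S)\<^sup>2)" for F .
  then show ?thesis using W0 by (intro exI[of _ "2 * W * card V + 2 * card V"]) auto
qed

text \<open>A valid constant \<open>C > 1\<close> can be lowered: apply the inequality to \<open>F + h L F\<close> with \<open>L\<close> the
  generator and use Bochner's inequality; so the best constant is at most 1.\<close>

lemma poincare: "variance F \<le> dirichlet F F"
proof -
  define good where "good C \<longleftrightarrow> (\<forall>F. variance F \<le> C * dirichlet F F)" for C
  obtain B where B: "0 \<le> B" "\<And>F. dirichlet F F \<le> B * (\<Sum>S\<in>Pow V. m S * (F S)\<^sup>2)"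
    using dirichlet_bounded by blast
  \<comment> \<open>With \<open>E = dirichlet F F\<close>, the inequality for \<open>G\<close> reads
    \<open>variance F \<le> (2 * h + C) * E - (h^2 + 2 * h * C) * D + C * h^2 * T\<close>. After
    \<open>T \<le> B * D\<close> the coefficient of \<open>D\<close> is still non-positive, so that
    \<open>D\<close> may be replaced by the smaller \<open>E\<close>.\<close>
  have improve: "good (C - 2*h*(C-1) + h\<^sup>2*(C*B))"
    if C: "good C" "1 \<le> C" and h: "0 < h" "h * (C * B) \<le> 1" for C h
  unfolding good_def
  proof
    fix F
    define L where "L S = birth F S - death F S" for S
    define G where "G S = F S + h * L S" for S
    define D where "D = (\<Sum>S\<in>Pow V. m S * (L S)\<^sup>2)"
    define T where "T = dirichlet L L"
    have TD: "T \<le> B * D" unfolding T_def D_def by (rule B)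
    have ED: "dirichlet F F \<le> D" unfolding D_def L_def by (rule bochner)
    have FL: "(\<Sum>S\<in>Pow V. m S * F S * L S) = - dirichlet F F"
      unfolding L_def by (rule generator_adjoint)
    have LL: "D = - dirichlet F L" unfolding D_def using generator_adjoint[of L F]
      by (simp add: L_def power2_eq_square mult.assoc)
    have L1: "(\<Sum>S\<in>Pow V. m S * L S) = 0" using generator_adjoint[of "\<lambda>_. 1" F]
      by (simp add: L_def dirichlet_def)
    have EG: "dirichlet G G = dirichlet F F + 2 * h * dirichlet F L + h\<^sup>2 * T"
      unfolding dirichlet_def G_def T_def sum_distrib_left sum.distrib[symmetric]
      by (intro sum.cong refl) (simp add: power2_eq_square algebra_simps)
    have "(\<Sum>S\<in>Pow V. m S * G S) = (\<Sum>S\<in>Pow V. m S * F S) + h * (\<Sum>S\<in>Pow V. m S * L S)"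
      unfolding G_def sum_distrib_left sum.distrib[symmetric] by (intro sum.cong refl) (simp add: algebra_simps)
    moreover have "(\<Sum>S\<in>Pow V. m S * (G S)\<^sup>2) = (\<Sum>S\<in>Pow V. m S * (F S)\<^sup>2)
        + 2 * h * (\<Sum>S\<in>Pow V. m S * F S * L S) + h\<^sup>2 * D"
      unfolding G_def D_def sum_distrib_left sum.distrib[symmetric]
      by (intro sum.cong refl) (simp add: power2_eq_square algebra_simps)
    ultimately have VG: "variance G = variance F - 2 * h * dirichlet F F + h\<^sup>2 * D"
      unfolding variance_def FL L1 by simp
    have "variance G \<le> C * dirichlet G G" using C unfolding good_def by blast
    then have "variance F \<le> 2 * h * dirichlet F F - h\<^sup>2 * D + C * (dirichlet F F - 2 * h * D + h\<^sup>2 * T)"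
      unfolding VG EG using LL by simp
    also have "\<dots> \<le> 2 * h * dirichlet F F - h\<^sup>2 * D + C * (dirichlet F F - 2 * h * D + h\<^sup>2 * (B * D))"
      using TD C by (intro add_left_mono mult_left_mono) auto
    also have "\<dots> = (2 * h + C) * dirichlet F F - (h\<^sup>2 + h * (2 * C - h * (C * B))) * D"
      by (simp add: power2_eq_square algebra_simps)
    also have "\<dots> \<le> (2 * h + C) * dirichlet F F - (h\<^sup>2 + h * (2 * C - h * (C * B))) * dirichlet F F"
    proof (intro diff_left_mono mult_left_mono ED add_nonneg_nonneg mult_nonneg_nonneg)
      show "0 \<le> 2 * C - h * (C * B)" using h C by linarith
    qed (use h in auto)
    also have "\<dots> \<le> (C - 2*h*(C-1) + h\<^sup>2*(C*B)) * dirichlet F F"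
      using mult_nonneg_nonneg[OF zero_le_power2[of h] dirichlet_nonneg[of F]]
      by (simp add: power2_eq_square algebra_simps)
    finally show "variance F \<le> (C - 2*h*(C-1) + h\<^sup>2*(C*B)) * dirichlet F F" .
  qed
  define K where "K = Inf {C. 1 \<le> C \<and> good C}"
  obtain C0 where "good C0" using crude_poincare unfolding good_def by blast
  then have "good (max 1 C0)" unfolding good_def using dirichlet_nonneg
    by (meson order_trans mult_right_mono max.cobounded2)
  then have ne: "{C. 1 \<le> C \<and> good C} \<noteq> {}" by (auto intro!: exI[of _ "max 1 C0"])
  have bdd: "bdd_below {C. 1 \<le> C \<and> good C}" by (auto intro!: bdd_belowI[of _ 1])
  have K1: "1 \<le> K" unfolding K_def using ne by (intro cInf_greatest) auto
  have goodK: "good K" unfolding good_def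
  proof
    fix F
    have "variance F \<le> C * dirichlet F F" if KC: "K < C" for C
    proof -
      obtain C' where "good C'" "C' < C" using cInf_lessD[OF ne, of C] KC unfolding K_def by auto
      then show ?thesis unfolding good_def using dirichlet_nonneg
        by (meson order_trans mult_right_mono less_imp_le)
    qed
    then have *: "variance F \<le> (K + e) * dirichlet F F" if "0 < e" for e using that by simp
    have "((\<lambda>e. (K + e) * dirichlet F F) \<longlongrightarrow> (K + 0) * dirichlet F F) (at_right 0)"
      by (intro tendsto_intros)
    then have "variance F \<le> (K + 0) * dirichlet F F"
      by (rule tendsto_lowerbound) (auto simp: eventually_at_right_less * intro: eventually_mono[OF eventually_at_right_less])
    then show "variance F \<le> K * dirichlet F F" by simp
  qed
  have "K = 1"
  proof (rule ccontr)
    assume "K \<noteq> 1"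
    then have K: "1 < K" using K1 by simp
    \<comment> \<open>The loss \<open>h^2 * K * B\<close> is at most half of the gain
      \<open>2 * h * (K - 1)\<close>, and \<open>h \<le> 1 / 2\<close> keeps the new constant at
      least 1, so that it belongs to the set whose infimum is \<open>K\<close>.\<close>
    define h where "h = min (1/2) (min 1 (K - 1) / (K * B + 1))"
    have pos: "0 < K * B + 1" using K B by (simp add: add_nonneg_pos)
    have h: "0 < h" "h \<le> 1/2"
    proof -
      show "0 < h" unfolding h_def min_less_iff_conj using K pos by (intro conjI divide_pos_pos) auto
      show "h \<le> 1/2" unfolding h_def by (rule min.cobounded1)
    qed
    have "h * (K * B + 1) \<le> min 1 (K - 1)"
      unfolding pos_le_divide_eq[OF pos, symmetric] h_def by (rule min.cobounded2)
    then have hK: "h * (K * B) \<le> 1" "h * (K * B) \<le> K - 1" using h by (auto simp: algebra_simps)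
    have "good (K - 2*h*(K-1) + h\<^sup>2*(K*B))" using improve[OF goodK K1 h(1) hK(1)] .
    moreover have "h\<^sup>2*(K*B) \<le> h * (K - 1)"
      using mult_left_mono[OF hK(2), of h] h by (simp add: power2_eq_square mult_ac)
    then have "K - 2*h*(K-1) + h\<^sup>2*(K*B) < K"
      using mult_pos_pos[of h "K-1"] h K unfolding mult.assoc by linarith
    moreover have "1 \<le> K - 2*h*(K-1) + h\<^sup>2*(K*B)"
    proof -
      have "2 * h * (K - 1) \<le> 1 * (K - 1)" using h K by (intro mult_right_mono) auto
      moreover have "0 \<le> h\<^sup>2*(K*B)" using K B by simp
      ultimately show ?thesis by simp
    qed
    ultimately show False using cInf_lower[OF _ bdd] unfolding K_def by force
  qed
  then show ?thesis using goodK unfolding good_def by simp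
qed

end

section \<open>Covariances of links and the modified log-Sobolev inequality\<close>

text \<open>The generating polynomial is affine in each variable, so its derivative with respect to
  all variables in \<open>T\<close> has this form. The weight is a parameter because
  \<open>m S * f S\<close> is also inserted for it.\<close>

definition link_poly :: "'a set \<Rightarrow> ('a set \<Rightarrow> real) \<Rightarrow> 'a set \<Rightarrow> ('a \<Rightarrow> real) \<Rightarrow> real" where
  "link_poly V w T z = (\<Sum>S\<in>Pow (V - T). w (S \<union> T) * (\<Prod>i\<in>S. z i))"

lemma sum_Pow_Diff_swap:
  fixes h :: "'a set \<Rightarrow> 'a \<Rightarrow> 'b::comm_monoid_add"
  assumes "finite U"
  shows "(\<Sum>S\<in>Pow U. \<Sum>i\<in>U-S. h S i) = (\<Sum>i\<in>U. \<Sum>S\<in>Pow (U-{i}). h S i)"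
proof -
  have "(\<Sum>S\<in>Pow U. \<Sum>i\<in>U-S. h S i) = (\<Sum>(S,i)\<in>Sigma (Pow U) (\<lambda>S. U - S). h S i)"
    using assms by (subst sum.Sigma) (auto intro: finite_subset)
  also have "\<dots> = (\<Sum>(i,S)\<in>Sigma U (\<lambda>i. Pow (U-{i})). h S i)"
    by (rule sum.reindex_bij_witness[where i="\<lambda>(i,S). (S,i)" and j="\<lambda>(S,i). (i,S)"]) auto
  also have "\<dots> = (\<Sum>i\<in>U. \<Sum>S\<in>Pow (U-{i}). h S i)"
    using assms by (subst sum.Sigma) auto
  finally show ?thesis .
qed

lemma sum_link_poly:
  assumes "finite V"
  shows "(\<Sum>S\<in>Pow (V-T). \<Sum>i\<in>(V-T)-S. w (insert i S \<union> T) * (\<Prod>j\<in>S. z j) * c i)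
     = (\<Sum>i\<in>V-T. c i * link_poly V w (insert i T) z)"
proof -
  have fin: "finite (V - T)" using assms by simp
  show ?thesis
    unfolding sum_Pow_Diff_swap[OF fin] link_poly_def sum_distrib_left
  proof (rule sum.cong[OF refl])
    fix i assume "i \<in> V - T"
    have "V - T - {i} = V - insert i T" by auto
    then show "(\<Sum>S\<in>Pow (V - T - {i}). w (insert i S \<union> T) * (\<Prod>j\<in>S. z j) * c i)
      = (\<Sum>S\<in>Pow (V - insert i T). c i * (w (S \<union> insert i T) * (\<Prod>i\<in>S. z i)))"
      by (simp add: mult_ac)
  qed
qed

lemma has_real_derivative_link_poly:
  fixes z :: "real \<Rightarrow> 'a \<Rightarrow> real"
  assumes fin: "finite V" and z: "\<And>i. i \<in> V - T \<Longrightarrow> ((\<lambda>t. z t i) has_real_derivative z' i) (at t)"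
  shows "((\<lambda>t. link_poly V w T (z t)) has_real_derivative
           (\<Sum>i\<in>V-T. z' i * link_poly V w (insert i T) (z t))) (at t)"
proof -
  have fin': "finite (V - T)" using fin by simp
  have "((\<lambda>t. link_poly V w T (z t)) has_real_derivative
       (\<Sum>S\<in>Pow (V-T). w (S \<union> T) * (\<Sum>i\<in>S. z' i * (\<Prod>j\<in>S-{i}. z t j)))) (at t)"
    unfolding link_poly_def
    by (intro DERIV_sum DERIV_cmult has_field_derivative_prod[where f="\<lambda>i t. z t i"])
       (use fin' z in \<open>auto intro: finite_subset\<close>)
  also have "(\<Sum>S\<in>Pow (V-T). w (S \<union> T) * (\<Sum>i\<in>S. z' i * (\<Prod>j\<in>S-{i}. z t j)))
     = (\<Sum>S\<in>Pow (V-T). \<Sum>i\<in>S. w (S \<union> T) * z' i * (\<Prod>j\<in>S-{i}. z t j))"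
    by (simp add: sum_distrib_left mult_ac)
  also have "\<dots> = (\<Sum>S\<in>Pow (V-T). \<Sum>i\<in>(V-T)-S. w (insert i S \<union> T) * z' i * (\<Prod>j\<in>insert i S-{i}. z t j))"
    by (rule sum_Pow_insert[OF fin'])
  also have "\<dots> = (\<Sum>S\<in>Pow (V-T). \<Sum>i\<in>(V-T)-S. w (insert i S \<union> T) * (\<Prod>j\<in>S. z t j) * z' i)"
    by (intro sum.cong refl) (simp add: mult_ac)
  also have "\<dots> = (\<Sum>i\<in>V-T. z' i * link_poly V w (insert i T) (z t))"
    by (rule sum_link_poly[OF fin])
  finally show ?thesis .
qed

context weighted_family
begin

lemma link_poly_eq_0:
  assumes "m T = 0" shows "link_poly V (\<lambda>S. m S * f S) T z = 0"
  unfolding link_poly_def using assms down0[of T "_ \<union> T"] by (intro sum.neutral) auto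

lemma link_poly_ge:
  assumes "\<And>i. i \<in> V - T \<Longrightarrow> 0 \<le> z i" and "\<And>S. 0 < m S \<Longrightarrow> 0 < f S"
  shows "m T * f T \<le> link_poly V (\<lambda>S. m S * f S) T z"
proof -
  have nn: "0 \<le> m S * f S" for S using assms(2)[of S] nonneg[of S] by (cases "m S = 0") auto
  have "m ({} \<union> T) * f ({} \<union> T) * (\<Prod>i\<in>{}. z i) \<le> link_poly V (\<lambda>S. m S * f S) T z"
    unfolding link_poly_def
    by (rule member_le_sum) (use fin assms(1) in \<open>auto intro!: mult_nonneg_nonneg[OF nn prod_nonneg]\<close>)
  then show ?thesis by simp
qed

text \<open>Links and external fields only rescale the coefficients: the form at \<open>S\<close> is
  that of \<open>m\<close> at \<open>S \<union> T\<close> in the variables \<open>z i * u i\<close>,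
  times the square of the field on \<open>S\<close>.\<close>

lemma link_weighted_family:
  assumes T: "T \<subseteq> V" "0 < m T" and z: "\<And>i. i \<in> V - T \<Longrightarrow> 0 < z i"
  shows "weighted_family (V - T) (\<lambda>S. if S \<subseteq> V - T then m (S \<union> T) * (\<Prod>i\<in>S. z i) else 0)"
    (is "weighted_family ?U ?w")
proof
  have pp: "0 < (\<Prod>i\<in>S. z i)" if "S \<subseteq> ?U" for S using that z by (intro prod_pos) auto
  show "finite ?U" using fin by simp
  show "0 \<le> ?w S" for S using pp[of S] nonneg by (simp add: less_imp_le)
  show "?w S = 0" if "\<not> S \<subseteq> ?U" for S using that by simp
  show "0 < ?w {}" using T by simp
  show "0 < ?w S'" if "0 < ?w S" "S' \<subseteq> S" for S S'
  proof -
    have S: "S \<subseteq> ?U" "0 < m (S \<union> T)"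
      using that(1) pp[of S] by (auto split: if_splits simp: zero_less_mult_iff)
    have "0 < m (S' \<union> T)" using down[OF S(2), of "S' \<union> T"] that(2) by auto
    moreover have "S' \<subseteq> ?U" using S(1) that(2) by (rule order_trans[rotated])
    ultimately show ?thesis using pp[of S'] by simp
  qed
  show "0 \<le> (\<Sum>i\<in>?U-S. \<Sum>j\<in>?U-S. (?w (insert i S) * ?w (insert j S)
             - (if i = j then 0 else ?w S * ?w (insert i (insert j S)))) * u i * u j)"
    if S: "S \<subseteq> ?U" and pos: "0 < ?w S" for S u
  proof -
    have finS: "finite S" using S fin finite_subset by blast
    define p where "p = (\<Prod>i\<in>S. z i)"
    have posU: "0 < m (S \<union> T)" using pos pp[OF S] S by (auto simp: zero_less_mult_iff)
    have sub: "S \<union> T \<subseteq> V" and eqU: "V - (S \<union> T) = ?U - S" using S T by auto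
    have "(\<Sum>i\<in>?U-S. \<Sum>j\<in>?U-S. (?w (insert i S) * ?w (insert j S)
             - (if i = j then 0 else ?w S * ?w (insert i (insert j S)))) * u i * u j)
      = (\<Sum>i\<in>?U-S. \<Sum>j\<in>?U-S. p\<^sup>2 * ((m (insert i (S \<union> T)) * m (insert j (S \<union> T))
             - (if i = j then 0 else m (S \<union> T) * m (insert i (insert j (S \<union> T))))) * (z i * u i) * (z j * u j)))"
    proof (intro sum.cong refl)
      fix i j assume i: "i \<in> ?U - S" and j: "j \<in> ?U - S"
      have wi: "?w (insert k S) = m (insert k (S \<union> T)) * (z k * p)" if "k \<in> ?U - S" for k
        using that S finS by (simp add: p_def)
      have wij: "?w (insert i (insert j S)) = m (insert i (insert j (S \<union> T))) * (z i * (z j * p))" if "i \<noteq> j"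
        using that i j S finS by (simp add: p_def)
      have w0: "?w S = m (S \<union> T) * p" using S by (simp add: p_def)
      show "(?w (insert i S) * ?w (insert j S)
             - (if i = j then 0 else ?w S * ?w (insert i (insert j S)))) * u i * u j
        = p\<^sup>2 * ((m (insert i (S \<union> T)) * m (insert j (S \<union> T))
             - (if i = j then 0 else m (S \<union> T) * m (insert i (insert j (S \<union> T))))) * (z i * u i) * (z j * u j))"
      proof (cases "i = j")
        case True
        then show ?thesis unfolding wi[OF i] wi[OF j] by (simp add: power2_eq_square algebra_simps)
      next
        case False
        then show ?thesis unfolding wi[OF i] wi[OF j] wij[OF False] w0
          by (simp add: power2_eq_square algebra_simps)
      qed
    qed
    also have "\<dots> = p\<^sup>2 * (\<Sum>i\<in>V-(S \<union> T). \<Sum>j\<in>V-(S \<union> T). (m (insert i (S \<union> T)) * m (insert j (S \<union> T))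
             - (if i = j then 0 else m (S \<union> T) * m (insert i (insert j (S \<union> T))))) * (z i * u i) * (z j * u j))"
      unfolding eqU sum_distrib_left ..
    also have "\<dots> \<ge> 0" using local[OF sub posU] by (rule mult_nonneg_nonneg[OF zero_le_power2])
    finally show ?thesis .
  qed
qed

text \<open>This is the spectral gap of the link for the function \<open>S \<mapsto> \<Sum>i\<in>S. v i / z i\<close>.\<close>

lemma link_covariance:
  assumes T: "T \<subseteq> V" "0 < m T" and z: "\<And>i. i \<in> V - T \<Longrightarrow> 0 < z i"
  shows "0 \<le> (\<Sum>i\<in>V-T. \<Sum>j\<in>V-T.
      (link_poly V m (insert i T) z * link_poly V m (insert j T) z
        - (if i = j then 0 else link_poly V m T z * link_poly V m (insert i (insert j T)) z)) * v i * v j)"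
proof -
  define U where "U = V - T"
  define w where "w S = (if S \<subseteq> U then m (S \<union> T) * (\<Prod>i\<in>S. z i) else 0)" for S
  interpret L: weighted_family U w
    unfolding U_def w_def by (rule link_weighted_family[OF T z])
  define u where "u i = v i / z i" for i
  have uz: "u i * z i = v i" if "i \<in> U" for i using z[of i] that by (simp add: u_def U_def)
  define y where "y T = link_poly V m T z" for T
  define F where "F S = (\<Sum>i\<in>S. u i)" for S
  have finU: "finite U" and finS: "\<And>S. S \<in> Pow U \<Longrightarrow> finite S"
    using fin by (auto simp: U_def intro: finite_subset)
  have w_ins: "w (insert i S) = m (insert i S \<union> T) * (\<Prod>j\<in>S. z j) * z i"
    if "S \<in> Pow U" "i \<in> U - S" for S i
    using that finS[of S] by (simp add: w_def)
  have single: "(\<Sum>S\<in>Pow U. \<Sum>i\<in>U-S. w (insert i S) * c i) = (\<Sum>i\<in>U. c i * z i * y (insert i T))" for c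
  proof -
    have "(\<Sum>S\<in>Pow U. \<Sum>i\<in>U-S. w (insert i S) * c i)
      = (\<Sum>S\<in>Pow U. \<Sum>i\<in>U-S. m (insert i S \<union> T) * (\<Prod>j\<in>S. z j) * (c i * z i))"
      by (intro sum.cong refl) (simp add: w_ins mult_ac)
    also have "\<dots> = (\<Sum>i\<in>U. c i * z i * y (insert i T))"
      unfolding U_def y_def by (rule sum_link_poly[OF fin])
    finally show ?thesis .
  qed
  have total: "L.total = y T"
    unfolding L.total_def y_def link_poly_def U_def[symmetric] by (intro sum.cong refl) (simp add: w_def)
  have m1: "(\<Sum>S\<in>Pow U. w S * F S) = (\<Sum>i\<in>U. v i * y (insert i T))"
  proof -
    have "(\<Sum>S\<in>Pow U. w S * F S) = (\<Sum>S\<in>Pow U. \<Sum>i\<in>S. w S * u i)"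
      unfolding F_def by (simp add: sum_distrib_left)
    also have "\<dots> = (\<Sum>S\<in>Pow U. \<Sum>i\<in>U-S. w (insert i S) * u i)" by (rule sum_Pow_insert[OF finU])
    also have "\<dots> = (\<Sum>i\<in>U. u i * z i * y (insert i T))" by (rule single)
    finally show ?thesis using uz by simp
  qed
  have E: "L.dirichlet F F = (\<Sum>i\<in>U. u i * v i * y (insert i T))"
  proof -
    have "L.dirichlet F F = (\<Sum>S\<in>Pow U. \<Sum>i\<in>U-S. w (insert i S) * (u i * u i))"
      unfolding L.dirichlet_def by (intro sum.cong refl) (use finS in \<open>auto simp: F_def\<close>)
    also have "\<dots> = (\<Sum>i\<in>U. u i * u i * z i * y (insert i T))" by (rule single)
    finally show ?thesis using uz by (simp add: mult.assoc)
  qed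
  have m2: "(\<Sum>S\<in>Pow U. w S * (F S)\<^sup>2) = (\<Sum>i\<in>U. u i * v i * y (insert i T))
     + (\<Sum>i\<in>U. \<Sum>j\<in>U. (if i = j then 0 else y (insert i (insert j T))) * v i * v j)"
  proof -
    have "(\<Sum>S\<in>Pow U. w S * (F S)\<^sup>2) = (\<Sum>S\<in>Pow U. \<Sum>i\<in>S. w S * (u i * F S))"
      by (simp add: power2_eq_square sum_distrib_left[symmetric] sum_distrib_right[symmetric])
         (simp add: F_def)
    also have "\<dots> = (\<Sum>S\<in>Pow U. \<Sum>i\<in>U-S. w (insert i S) * (u i * F (insert i S)))"
      by (rule sum_Pow_insert[OF finU])
    also have "\<dots> = (\<Sum>S\<in>Pow U. \<Sum>i\<in>U-S. w (insert i S) * (u i * u i))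
        + (\<Sum>S\<in>Pow U. \<Sum>i\<in>U-S. \<Sum>j\<in>S. w (insert i S) * (u i * u j))"
      unfolding sum.distrib[symmetric]
      by (intro sum.cong refl) (use finS in \<open>auto simp: F_def distrib_left sum_distrib_left\<close>)
    also have "(\<Sum>S\<in>Pow U. \<Sum>i\<in>U-S. w (insert i S) * (u i * u i)) = (\<Sum>i\<in>U. u i * u i * z i * y (insert i T))"
      by (rule single)
    also have "(\<Sum>S\<in>Pow U. \<Sum>i\<in>U-S. \<Sum>j\<in>S. w (insert i S) * (u i * u j))
       = (\<Sum>S\<in>Pow U. \<Sum>j\<in>S. \<Sum>i\<in>U-S. w (insert i S) * (u i * u j))"
      by (intro sum.cong refl sum.swap)
    also have "\<dots> = (\<Sum>S\<in>Pow U. \<Sum>j\<in>U-S. \<Sum>i\<in>U-insert j S. w (insert i (insert j S)) * (u i * u j))"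
      by (rule sum_Pow_insert[OF finU])
    also have "\<dots> = (\<Sum>j\<in>U. \<Sum>S\<in>Pow (U-{j}). \<Sum>i\<in>U-insert j S. w (insert i (insert j S)) * (u i * u j))"
      by (rule sum_Pow_Diff_swap[OF finU])
    also have "\<dots> = (\<Sum>j\<in>U. \<Sum>i\<in>U. (if i = j then 0 else y (insert i (insert j T))) * v i * v j)"
    proof (rule sum.cong[OF refl])
      fix j assume j: "j \<in> U"
      have Uj: "U - {j} = V - insert j T" by (auto simp: U_def)
      have "(\<Sum>S\<in>Pow (U-{j}). \<Sum>i\<in>U-insert j S. w (insert i (insert j S)) * (u i * u j))
        = (\<Sum>S\<in>Pow (V - insert j T). \<Sum>i\<in>(V - insert j T)-S. m (insert i S \<union> insert j T)
               * (\<Prod>k\<in>S. z k) * (v i * v j))"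
      proof (rule sum.cong)
        show "Pow (U-{j}) = Pow (V - insert j T)" unfolding Uj ..
        fix S assume S: "S \<in> Pow (V - insert j T)"
        show "(\<Sum>i\<in>U-insert j S. w (insert i (insert j S)) * (u i * u j))
          = (\<Sum>i\<in>(V - insert j T)-S. m (insert i S \<union> insert j T) * (\<Prod>k\<in>S. z k) * (v i * v j))"
        proof (rule sum.cong)
          show "U-insert j S = (V - insert j T)-S" using Uj by auto
          fix i assume i: "i \<in> (V - insert j T)-S"
          have "finite S" using S fin by (auto intro: finite_subset)
          moreover have "i \<notin> S" "j \<notin> S" "i \<noteq> j" "i \<in> U" "S \<subseteq> U" using i S j by (auto simp: U_def)
          ultimately have "w (insert i (insert j S)) = m (insert i S \<union> insert j T) * (\<Prod>k\<in>S. z k) * (z i * z j)"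
            using j by (simp add: w_def mult_ac insert_commute)
          then show "w (insert i (insert j S)) * (u i * u j)
             = m (insert i S \<union> insert j T) * (\<Prod>k\<in>S. z k) * (v i * v j)"
            using uz[OF j, symmetric] uz[OF \<open>i \<in> U\<close>, symmetric] by (simp add: mult_ac)
        qed
      qed
      also have "\<dots> = (\<Sum>i\<in>V - insert j T. (v i * v j) * y (insert i (insert j T)))"
        unfolding y_def by (rule sum_link_poly[OF fin])
      also have "\<dots> = (\<Sum>i\<in>U. (if i = j then 0 else y (insert i (insert j T))) * v i * v j)"
        unfolding Uj[symmetric]
        by (rule sum.mono_neutral_cong_left) (use finU in auto)
      finally show "(\<Sum>S\<in>Pow (U-{j}). \<Sum>i\<in>U-insert j S. w (insert i (insert j S)) * (u i * u j)) = \<dots>" .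
    qed
    also have "\<dots> = (\<Sum>i\<in>U. \<Sum>j\<in>U. (if i = j then 0 else y (insert i (insert j T))) * v i * v j)"
      by (rule sum.swap)
    finally show ?thesis using uz by (simp add: mult.assoc)
  qed
  have y0: "0 < y T" using L.total_pos unfolding total .
  \<comment> \<open>The diagonal part of the second moment coincides with the Dirichlet form. With
    gap 1 the two cancel, and only pairs of distinct elements remain.\<close>
  have "L.variance F \<le> L.dirichlet F F" by (rule L.poincare)
  then have "(\<Sum>i\<in>U. \<Sum>j\<in>U. (if i = j then 0 else y (insert i (insert j T))) * v i * v j)
     \<le> (\<Sum>i\<in>U. v i * y (insert i T))\<^sup>2 / y T"
    unfolding L.variance_def m1 m2 E total by simp
  then have "y T * (\<Sum>i\<in>U. \<Sum>j\<in>U. (if i = j then 0 else y (insert i (insert j T))) * v i * v j)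
     \<le> (\<Sum>i\<in>U. v i * y (insert i T)) * (\<Sum>i\<in>U. v i * y (insert i T))"
    using y0 by (simp add: field_simps power2_eq_square)
  then have "0 \<le> (\<Sum>i\<in>U. v i * y (insert i T)) * (\<Sum>i\<in>U. v i * y (insert i T))
     - y T * (\<Sum>i\<in>U. \<Sum>j\<in>U. (if i = j then 0 else y (insert i (insert j T))) * v i * v j)" by simp
  also have "\<dots> = (\<Sum>i\<in>U. \<Sum>j\<in>U.
      (y (insert i T) * y (insert j T) - (if i = j then 0 else y T * y (insert i (insert j T)))) * v i * v j)"
  proof -
    have "(\<Sum>i\<in>U. \<Sum>j\<in>U.
        (y (insert i T) * y (insert j T) - (if i = j then 0 else y T * y (insert i (insert j T)))) * v i * v j)
      = (\<Sum>i\<in>U. \<Sum>j\<in>U. (v i * y (insert i T)) * (v j * y (insert j T)))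
        - (\<Sum>i\<in>U. \<Sum>j\<in>U. y T * ((if i = j then 0 else y (insert i (insert j T))) * v i * v j))"
      unfolding sum_subtractf[symmetric] by (intro sum.cong refl) (simp add: algebra_simps)
    then show ?thesis by (simp only: sum_product, simp only: sum_distrib_left)
  qed
  finally show ?thesis unfolding y_def U_def .
qed

text \<open>The factor \<open>card T\<close> from differentiating \<open>s ^ card T\<close> is a sum
  over the elements of \<open>T\<close>; reindexed by the set without that element, it becomes a sum
  over the next element to be revealed.\<close>

lemma derivative_level_sum:
  assumes "\<And>T. T \<in> Pow V \<Longrightarrow> (F T has_real_derivative F' T) (at s)"
  shows "((\<lambda>s. \<Sum>T\<in>Pow V. s ^ card T * F T s) has_real_derivative
      (\<Sum>T\<in>Pow V. s ^ card T * (F' T + (\<Sum>i\<in>V-T. F (insert i T) s)))) (at s)"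
proof -
  have "((\<lambda>s. \<Sum>T\<in>Pow V. s ^ card T * F T s) has_real_derivative
      (\<Sum>T\<in>Pow V. s ^ card T * F' T + card T * s ^ (card T - 1) * F T s)) (at s)"
    by (rule DERIV_sum) (rule derivative_eq_intros assms refl | assumption | simp)+
  also have "(\<Sum>T\<in>Pow V. s ^ card T * F' T + card T * s ^ (card T - 1) * F T s)
     = (\<Sum>T\<in>Pow V. s ^ card T * F' T) + (\<Sum>T\<in>Pow V. \<Sum>i\<in>T. s ^ (card T - 1) * F T s)"
    by (simp add: sum.distrib mult.assoc)
  also have "(\<Sum>T\<in>Pow V. \<Sum>i\<in>T. s ^ (card T - 1) * F T s)
     = (\<Sum>T\<in>Pow V. \<Sum>i\<in>V-T. s ^ (card (insert i T) - 1) * F (insert i T) s)"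
    by (rule sum_Pow_insert[OF fin])
  also have "\<dots> = (\<Sum>T\<in>Pow V. \<Sum>i\<in>V-T. s ^ card T * F (insert i T) s)"
    by (intro sum.cong refl) (use fin in \<open>auto simp: finite_subset card_insert_if\<close>)
  also have "(\<Sum>T\<in>Pow V. s ^ card T * F' T) + \<dots>
     = (\<Sum>T\<in>Pow V. s ^ card T * (F' T + (\<Sum>i\<in>V-T. F (insert i T) s)))"
    by (simp add: sum.distrib[symmetric] distrib_left sum_distrib_left)
  finally show ?thesis .
qed

end

lemma relative_entropy_term_ge:
  fixes p q :: real
  assumes "0 < p" "0 < q"
  shows "p - q \<le> p * (ln p - ln q)"
proof -
  have "ln (q / p) \<le> q / p - 1" using assms by (intro ln_le_minus_one) simp
  then have "p * (ln q - ln p) \<le> p * (q / p - 1)"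
    using assms by (simp add: ln_div)
  then show ?thesis using assms by (simp add: algebra_simps)
qed

context weighted_family
begin

text \<open>Reveal the elements of a random set at independent uniform times in \<open>[0, 1]\<close>. The entropy of
  the density averaged over what is not yet revealed at time \<open>s\<close> is a convex function of \<open>s\<close>: in its
  second derivative the relative entropies are non-negative, and the rest is the covariance form of
  the links. The modified log-Sobolev inequality compares the total increase with the slope at 1.\<close>

lemma entropy_le_birth:
  assumes f: "\<And>S. 0 < m S \<Longrightarrow> 0 < f S"
  shows "(\<Sum>S\<in>Pow V. m S * f S * ln (f S))
      - (\<Sum>S\<in>Pow V. m S * f S) * (ln (\<Sum>S\<in>Pow V. m S * f S) - ln total)
     \<le> (\<Sum>S\<in>Pow V. \<Sum>i\<in>V-S. m (insert i S) *
           (f (insert i S) * (ln (f (insert i S)) - ln (f S)) - f (insert i S) + f S))"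
proof -
  \<comment> \<open>For \<open>s\<close> between 0 and 1, \<open>s ^ card T * x T s\<close> and
    \<open>s ^ card T * y T s\<close> are the masses under \<open>m * f\<close> and \<open>m\<close>
    of the event that exactly \<open>T\<close> is revealed at time \<open>s\<close>. Hence
    \<open>l\<close> is the logarithm of the averaged density and \<open>En\<close> its entropy up
    to normalisation.\<close>
  define x where "x T s = link_poly V (\<lambda>S. m S * f S) T (\<lambda>_. 1 - s)" for T and s :: real
  define y where "y T s = link_poly V m T (\<lambda>_. 1 - s)" for T and s :: real
  have y_alt: "y T s = link_poly V (\<lambda>S. m S * 1) T (\<lambda>_. 1 - s)" for T s by (simp add: y_def)
  define x' where "x' T s = - (\<Sum>i\<in>V-T. x (insert i T) s)" for T s
  define y' where "y' T s = - (\<Sum>i\<in>V-T. y (insert i T) s)" for T s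
  have dx: "(x T has_real_derivative x' T s) (at s)" for T s
  proof -
    have "((\<lambda>s. link_poly V (\<lambda>S. m S * f S) T (\<lambda>_. 1 - s)) has_real_derivative
        (\<Sum>i\<in>V-T. (-1) * link_poly V (\<lambda>S. m S * f S) (insert i T) (\<lambda>_. 1 - s))) (at s)"
      by (rule has_real_derivative_link_poly[OF fin]) (auto intro!: derivative_eq_intros)
    then show ?thesis unfolding x_def[abs_def] x'_def by (simp add: sum_negf)
  qed
  have dy: "(y T has_real_derivative y' T s) (at s)" for T s
  proof -
    have "((\<lambda>s. link_poly V m T (\<lambda>_. 1 - s)) has_real_derivative
        (\<Sum>i\<in>V-T. (-1) * link_poly V m (insert i T) (\<lambda>_. 1 - s))) (at s)"
      by (rule has_real_derivative_link_poly[OF fin]) (auto intro!: derivative_eq_intros)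
    then show ?thesis unfolding y_def[abs_def] y'_def by (simp add: sum_negf)
  qed
  have x0: "x T s = 0" and y0: "y T s = 0" if "m T = 0" for T s
    unfolding x_def y_alt by (rule link_poly_eq_0[OF that])+
  have xpos: "0 < x T s" and ypos: "0 < y T s" if "0 < m T" "s \<le> 1" for T s
  proof -
    show "0 < x T s" unfolding x_def
      by (rule less_le_trans[OF mult_pos_pos[OF that(1) f[OF that(1)]] link_poly_ge[where T=T and f=f]]) (use f that in auto)
    show "0 < y T s" using link_poly_ge[of T "\<lambda>_. 1 - s" "\<lambda>_. 1"] that unfolding y_alt by simp
  qed
  define l where "l T s = ln (x T s) - ln (y T s)" for T s
  have dl: "(l T has_real_derivative x' T s / x T s - y' T s / y T s) (at s)" if "0 < m T" "s \<le> 1" for T s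
    unfolding l_def[abs_def] using xpos[OF that] ypos[OF that]
    by (auto intro!: derivative_eq_intros dx dy simp: field_simps)
  define h where "h T i s = x (insert i T) s * (l (insert i T) s - l T s) - x (insert i T) s
      + x T s * y (insert i T) s / y T s" for T i s
  define H where "H T s = (\<Sum>i\<in>V-T. h T i s)" for T s
  define En where "En s = (\<Sum>T\<in>Pow V. s ^ card T * (x T s * l T s))" for s
  define D where "D s = (\<Sum>T\<in>Pow V. s ^ card T * H T s)" for s
  have dEn: "(En has_real_derivative D s) (at s)" if s: "s \<le> 1" for s
  proof -
    have d: "((\<lambda>s. x T s * l T s) has_real_derivative
        (\<Sum>i\<in>V-T. - x (insert i T) s * l T s - x (insert i T) s + x T s * y (insert i T) s / y T s)) (at s)" for T
    proof (cases "m T = 0")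
      case True
      have "m (insert i T) = 0" for i using down0[OF subset_insertI True] .
      then show ?thesis using x0[OF True] x0[of "insert _ T"] y0[of "insert _ T"] by simp
    next
      case False
      then have T: "0 < m T" using nonneg[of T] by simp
      have "((\<lambda>s. x T s * l T s) has_real_derivative
         x' T s * l T s + (x' T s / x T s - y' T s / y T s) * x T s) (at s)"
        by (rule DERIV_mult[OF dx dl[OF T s]])
      also have "x' T s * l T s + (x' T s / x T s - y' T s / y T s) * x T s
        = x' T s * l T s + x' T s - x T s * y' T s / y T s"
        using xpos[OF T s] by (simp add: field_simps)
      also have "\<dots> = (\<Sum>i\<in>V-T. - x (insert i T) s * l T s - x (insert i T) s + x T s * y (insert i T) s / y T s)"
        unfolding x'_def y'_def
        by (simp add: sum.distrib sum_subtractf sum_negf sum_distrib_left sum_distrib_right sum_divide_distrib)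
      finally show ?thesis .
    qed
    have "((\<lambda>s. \<Sum>T\<in>Pow V. s ^ card T * (x T s * l T s)) has_real_derivative
        (\<Sum>T\<in>Pow V. s ^ card T * ((\<Sum>i\<in>V-T. - x (insert i T) s * l T s - x (insert i T) s
             + x T s * y (insert i T) s / y T s)
           + (\<Sum>i\<in>V-T. x (insert i T) s * l (insert i T) s)))) (at s)"
      by (rule derivative_level_sum) (rule d)
    also have "(\<Sum>T\<in>Pow V. s ^ card T * ((\<Sum>i\<in>V-T. - x (insert i T) s * l T s - x (insert i T) s
             + x T s * y (insert i T) s / y T s)
           + (\<Sum>i\<in>V-T. x (insert i T) s * l (insert i T) s))) = D s"
      unfolding D_def H_def h_def sum.distrib[symmetric]
      by (intro sum.cong refl arg_cong2[where f="(*)"]) (simp add: algebra_simps)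
    finally show ?thesis unfolding En_def[abs_def] .
  qed
  define h' where "h' T i s =
      x' (insert i T) s * (l (insert i T) s - l T s)
      - x (insert i T) s * y' (insert i T) s / y (insert i T) s
      - x (insert i T) s * x' T s / x T s + x (insert i T) s * y' T s / y T s
      + x' T s * y (insert i T) s / y T s + x T s * y' (insert i T) s / y T s
      - x T s * y (insert i T) s * y' T s / (y T s)\<^sup>2" for T i s
  have dh: "(h T i has_real_derivative h' T i s) (at s)" if s: "s \<le> 1" for T i s
  proof (cases "m (insert i T) = 0")
    case True
    have *: "m (insert j (insert i T)) = 0" for j using down0[OF subset_insertI True] .
    have "x' (insert i T) s = 0" "y' (insert i T) s = 0"
      unfolding x'_def y'_def using x0[OF *] y0[OF *] by auto
    then have "h' T i s = 0" unfolding h'_def using x0[OF True] y0[OF True] by simp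
    moreover have "h T i = (\<lambda>_. 0)" unfolding h_def using x0[OF True] y0[OF True] by auto
    ultimately show ?thesis by simp
  next
    case False
    then have Ti: "0 < m (insert i T)" using nonneg[of "insert i T"] by simp
    then have T: "0 < m T" using down by blast
    note p = xpos[OF T s] ypos[OF T s] xpos[OF Ti s] ypos[OF Ti s]
    have d: "(h T i has_real_derivative
        x' (insert i T) s * (l (insert i T) s - l T s)
        + (x' (insert i T) s / x (insert i T) s - y' (insert i T) s / y (insert i T) s
             - (x' T s / x T s - y' T s / y T s)) * x (insert i T) s
        - x' (insert i T) s
        + ((x' T s * y (insert i T) s + y' (insert i T) s * x T s) * y T s
            - x T s * y (insert i T) s * y' T s) / (y T s * y T s)) (at s)"
      unfolding h_def[abs_def]
      by (intro DERIV_add DERIV_diff DERIV_mult DERIV_divide dx dy dl[OF T s] dl[OF Ti s]) (use p in simp)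
    have e1: "(u / v - u' / v' - (w / X - w' / Y)) * v = u - v * u' / v' - v * w / X + v * w' / Y"
      if "0 < v" for u v u' v' w X w' Y :: real
      using that by (simp add: algebra_simps)
    have e2: "((u * v + u' * w) * Y - w * v * v') / (Y * Y) = u * v / Y + w * u' / Y - w * v * v' / Y\<^sup>2"
      if "0 < Y" for u v u' v' w Y :: real
      using that by (simp add: power2_eq_square add_divide_distrib diff_divide_distrib algebra_simps)
    show ?thesis
      by (rule DERIV_cong[OF d]) (simp add: h'_def e1[OF p(3)] e2[OF p(2)])
  qed
  have dD: "(D has_real_derivative
      (\<Sum>T\<in>Pow V. s ^ card T * ((\<Sum>i\<in>V-T. h' T i s) + (\<Sum>j\<in>V-T. H (insert j T) s)))) (at s)"
    if s: "s \<le> 1" for s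
    unfolding D_def[abs_def]
    by (rule derivative_level_sum) (unfold H_def[abs_def], rule DERIV_sum, rule dh[OF s])
  have convex: "0 \<le> (\<Sum>i\<in>V-T. h' T i s) + (\<Sum>j\<in>V-T. H (insert j T) s)"
    if s: "s < 1" and TV: "T \<in> Pow V" for T s
  proof (cases "m T = 0")
    case True
    have *: "m (insert i T) = 0" for i using down0[OF subset_insertI True] .
    have **: "m (insert j (insert i T)) = 0" for i j using down0[OF subset_insertI *] .
    have "h' T i s = 0" for i
      unfolding h'_def x'_def y'_def using x0[OF **] y0[OF **] x0[OF *] x0[OF True] by simp
    moreover have "H (insert j T) s = 0" for j
      unfolding H_def h_def using x0[OF **] x0[OF *] by simp
    ultimately show ?thesis by simp
  next
    case False
    then have T: "0 < m T" using nonneg[of T] by simp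
    have s1: "s \<le> 1" using s by simp
    define I where "I = V - T"
    define X where "X = x T s"
    define Y where "Y = y T s"
    define a where "a i = x (insert i T) s" for i
    define b where "b i = y (insert i T) s" for i
    define p where "p i j = (if i = j then 0 else x (insert i (insert j T)) s)" for i j
    define q where "q i j = (if i = j then 0 else y (insert i (insert j T)) s)" for i j
    \<comment> \<open>The increment of the averaged density when \<open>i\<close> is revealed; at
      this vector the covariance form of the link is evaluated.\<close>
    define c where "c i = a i / b i - X / Y" for i
    have XY: "0 < X" "0 < Y" using xpos[OF T s1] ypos[OF T s1] by (auto simp: X_def Y_def)
    have sym: "p i j = p j i" "q i j = q j i" for i j by (auto simp: p_def q_def insert_commute)
    have finI: "finite I" using fin by (simp add: I_def)
    have restrict: "(\<Sum>j\<in>V - insert i T. g j) = (\<Sum>j\<in>I. g j)" if "i \<in> I" "g i = 0" for i and g :: "'a \<Rightarrow> real"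
    proof -
      have "V - insert i T = I - {i}" by (auto simp: I_def)
      then show ?thesis using that finI by (simp add: sum.remove)
    qed
    have X': "x' T s = - (\<Sum>j\<in>I. a j)" "y' T s = - (\<Sum>j\<in>I. b j)"
      by (simp_all add: x'_def y'_def a_def b_def I_def)
    have A': "x' (insert i T) s = - (\<Sum>j\<in>I. p i j)" "y' (insert i T) s = - (\<Sum>j\<in>I. q i j)" if "i \<in> I" for i
    proof -
      have "(\<Sum>j\<in>V - insert i T. x (insert j (insert i T)) s) = (\<Sum>j\<in>V - insert i T. p i j)"
           "(\<Sum>j\<in>V - insert i T. y (insert j (insert i T)) s) = (\<Sum>j\<in>V - insert i T. q i j)"
        by (intro sum.cong refl; simp add: p_def q_def insert_commute[of _ i T] split: if_splits; blast)+
      then show "x' (insert i T) s = - (\<Sum>j\<in>I. p i j)" "y' (insert i T) s = - (\<Sum>j\<in>I. q i j)"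
        unfolding x'_def y'_def using restrict[OF that, of "p i"] restrict[OF that, of "q i"]
        by (simp_all add: p_def q_def)
    qed
    have "(\<Sum>i\<in>I. h' T i s) = (\<Sum>i\<in>I. \<Sum>j\<in>I. - p i j * (l (insert i T) s - l T s)
         + a i * q i j / b i + a i * a j / X - a i * b j / Y - a j * b i / Y - X * q i j / Y + X * b i * b j / Y\<^sup>2)"
    proof (rule sum.cong[OF refl])
      fix i assume i: "i \<in> I"
      show "h' T i s = (\<Sum>j\<in>I. - p i j * (l (insert i T) s - l T s)
         + a i * q i j / b i + a i * a j / X - a i * b j / Y - a j * b i / Y - X * q i j / Y + X * b i * b j / Y\<^sup>2)"
        unfolding h'_def A'[OF i] X' a_def[symmetric] b_def[symmetric] X_def[symmetric] Y_def[symmetric]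
        by (simp add: sum.distrib sum_subtractf sum_negf sum_distrib_left sum_distrib_right sum_divide_distrib)
    qed
    moreover have "(\<Sum>j\<in>I. H (insert j T) s) = (\<Sum>j\<in>I. \<Sum>i\<in>I.
        p i j * (l (insert i (insert j T)) s - l (insert j T) s) - p i j + a j * q i j / b j)"
    proof (rule sum.cong[OF refl])
      fix j assume j: "j \<in> I"
      have "H (insert j T) s = (\<Sum>i\<in>V - insert j T.
          p i j * (l (insert i (insert j T)) s - l (insert j T) s) - p i j + a j * q i j / b j)"
        unfolding H_def h_def by (intro sum.cong refl) (auto simp: p_def q_def a_def b_def)
      also have "\<dots> = (\<Sum>i\<in>I. p i j * (l (insert i (insert j T)) s - l (insert j T) s) - p i j + a j * q i j / b j)"
        by (rule restrict[OF j]) (simp add: p_def q_def)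
      finally show "H (insert j T) s = \<dots>" .
    qed
    moreover have "\<dots> = (\<Sum>i\<in>I. \<Sum>j\<in>I.
        p i j * (l (insert i (insert j T)) s - l (insert j T) s) - p i j + a j * q i j / b j)"
      by (rule sum.swap)
    ultimately have eq: "(\<Sum>i\<in>V-T. h' T i s) + (\<Sum>j\<in>V-T. H (insert j T) s)
      = (\<Sum>i\<in>I. \<Sum>j\<in>I. (- p i j * (l (insert i T) s - l T s)
         + a i * q i j / b i + a i * a j / X - a i * b j / Y - a j * b i / Y - X * q i j / Y + X * b i * b j / Y\<^sup>2)
         + (p i j * (l (insert i (insert j T)) s - l (insert j T) s) - p i j + a j * q i j / b j))"
      unfolding I_def[symmetric] by (simp only: sum.distrib)
    have "0 \<le> (\<Sum>i\<in>I. \<Sum>j\<in>I. (b i * b j - (if i = j then 0 else Y * y (insert i (insert j T)) s)) * c i * c j) / X"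
      using link_covariance[of T "\<lambda>_. 1 - s" c] T TV s XY unfolding I_def b_def Y_def y_def
      by (intro divide_nonneg_pos) auto
    also have "\<dots> = (\<Sum>i\<in>I. \<Sum>j\<in>I. (b i * b j - Y * q i j) * c i * c j / X)"
      unfolding sum_divide_distrib by (intro sum.cong refl) (auto simp: q_def)
    also have "\<dots> \<le> (\<Sum>i\<in>V-T. h' T i s) + (\<Sum>j\<in>V-T. H (insert j T) s)"
      unfolding eq
    proof (intro sum_mono)
      fix i j assume i: "i \<in> I" and j: "j \<in> I"
      have ab0: "a i = b i * (a i / b i)" "a j = b j * (a j / b j)"
      proof -
        have "a k = b k * (a k / b k)" for k
        proof (cases "m (insert k T) = 0")
          case True
          then show ?thesis by (simp add: a_def b_def x0 y0)
        next
          case False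
          then have "0 < m (insert k T)" using nonneg[of "insert k T"] by simp
          from ypos[OF this s1] show ?thesis by (simp add: a_def b_def)
        qed
        then show "a i = b i * (a i / b i)" "a j = b j * (a j / b j)" by blast+
      qed
      have first: "a i * a j / X - a i * b j / Y - a j * b i / Y + X * b i * b j / Y\<^sup>2 = b i * b j * c i * c j / X"
      proof -
        have "b i * c i = a i - b i * X / Y" "b j * c j = a j - b j * X / Y"
          unfolding c_def right_diff_distrib using ab0 by simp_all
        then have "b i * b j * c i * c j / X = (a i - b i * X / Y) * (a j - b j * X / Y) / X"
          by (metis mult.assoc mult.left_commute)
        also have "\<dots> = a i * a j / X - a i * b j / Y - a j * b i / Y + X * b i * b j / Y\<^sup>2"
          using XY by (simp add: field_simps power2_eq_square)
        finally show ?thesis ..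
      qed
      have second: "- (Y * q i j * c i * c j / X) \<le> p i j * (l (insert i (insert j T)) s - l (insert i T) s - l (insert j T) s + l T s)
         - p i j + q i j * (a i / b i + a j / b j - X / Y)"
      proof (cases "i = j \<or> m (insert i (insert j T)) = 0")
        case True
        then have "p i j = 0" "q i j = 0" by (auto simp: p_def q_def x0 y0)
        then show ?thesis by simp
      next
        case False
        then have ij: "i \<noteq> j" and mij: "0 < m (insert i (insert j T))" using nonneg[of "insert i (insert j T)"] by auto
        have mi: "0 < m (insert i T)" and mj: "0 < m (insert j T)" by (rule down[OF mij], blast)+
        note pos = xpos[OF mij s1] ypos[OF mij s1] xpos[OF mi s1] ypos[OF mi s1] xpos[OF mj s1] ypos[OF mj s1]
        have pos': "0 < p i j" "0 < q i j" "0 < a i" "0 < b i" "0 < a j" "0 < b j"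
          using pos ij by (auto simp: p_def q_def a_def b_def)
        \<comment> \<open>The value that \<open>p i j\<close> would have if the density were
          multiplicative on the square spanned by \<open>i\<close> and \<open>j\<close>. The
          relative entropy of \<open>p i j\<close> with respect to \<open>r\<close> is non-negative,
          and expanding \<open>r\<close> in the increments produces the product
          \<open>c i * c j\<close>.\<close>
        define r where "r = q i j * (a i / b i) * (a j / b j) / (X / Y)"
        have r: "0 < r" unfolding r_def using pos' XY by simp
        have "ln r = ln (q i j) + (ln (a i) - ln (b i)) + (ln (a j) - ln (b j)) - (ln X - ln Y)"
          unfolding r_def using pos' XY by (simp add: ln_mult ln_div)
        then have "ln (p i j) - ln r = l (insert i (insert j T)) s - l (insert i T) s - l (insert j T) s + l T s"
          using ij by (simp add: l_def p_def q_def a_def b_def X_def Y_def)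
        then have "p i j - r \<le> p i j * (l (insert i (insert j T)) s - l (insert i T) s - l (insert j T) s + l T s)"
          using relative_entropy_term_ge[OF pos'(1) r] by simp
        moreover have "- (Y * q i j * c i * c j / X) = - r + q i j * (a i / b i + a j / b j - X / Y)"
          unfolding r_def c_def using XY pos' by (simp add: field_simps)
        ultimately show ?thesis by simp
      qed
      have "(b i * b j - Y * q i j) * c i * c j / X = b i * b j * c i * c j / X - (Y * q i j * c i * c j / X)"
        by (simp add: left_diff_distrib diff_divide_distrib)
      also have "\<dots> \<le> (a i * a j / X - a i * b j / Y - a j * b i / Y + X * b i * b j / Y\<^sup>2)
          + (p i j * (l (insert i (insert j T)) s - l (insert i T) s - l (insert j T) s + l T s)
             - p i j + q i j * (a i / b i + a j / b j - X / Y))"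
        using first second by linarith
      also have "\<dots> = (- p i j * (l (insert i T) s - l T s)
         + a i * q i j / b i + a i * a j / X - a i * b j / Y - a j * b i / Y - X * q i j / Y + X * b i * b j / Y\<^sup>2)
         + (p i j * (l (insert i (insert j T)) s - l (insert j T) s) - p i j + a j * q i j / b j)"
        by (simp add: algebra_simps)
      finally show "(b i * b j - Y * q i j) * c i * c j / X \<le> \<dots>" .
    qed
    finally show ?thesis .
  qed
  have mono: "D r \<le> D 1" if r: "0 \<le> r" "r \<le> 1" for r
  proof (rule DERIV_nonneg_imp_increasing_open[OF r(2)])
    fix s :: real assume s: "r < s" "s < 1"
    show "\<exists>y. (D has_real_derivative y) (at s) \<and> 0 \<le> y"
    proof (intro exI conjI)
      show "(D has_real_derivative
          (\<Sum>T\<in>Pow V. s ^ card T * ((\<Sum>i\<in>V-T. h' T i s) + (\<Sum>j\<in>V-T. H (insert j T) s)))) (at s)"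
        by (rule dD) (use s in simp)
      show "0 \<le> (\<Sum>T\<in>Pow V. s ^ card T * ((\<Sum>i\<in>V-T. h' T i s) + (\<Sum>j\<in>V-T. H (insert j T) s)))"
        using s r by (intro sum_nonneg mult_nonneg_nonneg convex) auto
    qed
  next
    show "continuous_on {r..1} D"
      by (intro continuous_at_imp_continuous_on ballI DERIV_isCont[OF dD]) auto
  qed
  \<comment> \<open>The mean value theorem takes the place of integrating the slope
    \<open>D\<close>.\<close>
  obtain r where r: "0 < r" "r < 1" "En 1 - En 0 = (1 - 0) * D r"
    using MVT2[of 0 1 En D] dEn by auto
  have "En 1 - En 0 \<le> D 1" using r mono[of r] by simp
  have x1: "x T 1 = m T * f T" and y1: "y T 1 = m T" if "T \<in> Pow V" for T
  proof -
    have "(\<Sum>S\<in>Pow (V - T). w (S \<union> T) * (\<Prod>i\<in>S. 0)) = (\<Sum>S\<in>{{}}. w (S \<union> T) * (\<Prod>i\<in>S. (0::real)))" for w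
      by (rule sum.mono_neutral_right) (use fin in \<open>auto simp: card_gt_0_iff finite_subset power_0_left\<close>)
    then show "x T 1 = m T * f T" "y T 1 = m T" unfolding x_def y_def link_poly_def by simp_all
  qed
  have l1: "m T * l T 1 = m T * ln (f T)" if "T \<in> Pow V" for T
    using x1[OF that] y1[OF that] nonneg[of T] f[of T]
    by (cases "m T = 0") (simp_all add: l_def ln_mult)
  have En1: "En 1 = (\<Sum>T\<in>Pow V. m T * f T * ln (f T))"
    unfolding En_def by (intro sum.cong refl) (use x1 l1 in \<open>simp add: mult.commute mult.left_commute\<close>)
  have En0: "En 0 = (\<Sum>S\<in>Pow V. m S * f S) * (ln (\<Sum>S\<in>Pow V. m S * f S) - ln total)"
  proof -
    have "En 0 = (\<Sum>T\<in>{{}}. 0 ^ card T * (x T 0 * l T 0))" unfolding En_def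
      by (rule sum.mono_neutral_right) (use fin in \<open>auto simp: finite_subset power_0_left\<close>)
    then show ?thesis by (simp add: l_def x_def y_def link_poly_def total_def)
  qed
  have D1: "D 1 = (\<Sum>S\<in>Pow V. \<Sum>i\<in>V-S. m (insert i S) *
           (f (insert i S) * (ln (f (insert i S)) - ln (f S)) - f (insert i S) + f S))"
    unfolding D_def H_def power_one mult_1
  proof (intro sum.cong refl)
    fix T i assume T: "T \<in> Pow V" and i: "i \<in> V - T"
    then have Ti: "insert i T \<in> Pow V" by auto
    show "h T i 1 = m (insert i T) * (f (insert i T) * (ln (f (insert i T)) - ln (f T)) - f (insert i T) + f T)"
    proof (cases "m (insert i T) = 0")
      case True
      then show ?thesis by (simp add: h_def x0 y0)
    next
      case False
      then have mi: "0 < m (insert i T)" using nonneg[of "insert i T"] by simp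
      then have mT: "0 < m T" using down by blast
      have "l (insert i T) 1 = ln (f (insert i T))" "l T 1 = ln (f T)" using l1[OF T] l1[OF Ti] mi mT by auto
      then show ?thesis using mT x1[OF T] x1[OF Ti] y1[OF T] y1[OF Ti] by (simp add: h_def algebra_simps)
    qed
  qed
  show ?thesis using \<open>En 1 - En 0 \<le> D 1\<close> unfolding En1 En0 D1 by simp
qed

end

section \<open>Log-concavity of the derivatives\<close>

context weighted_family
begin

lemma link_poly_pos:
  assumes "0 < m T" "\<And>i. i \<in> V - T \<Longrightarrow> 0 < z i"
  shows "0 < link_poly V m T z"
  using link_poly_ge[of T z "\<lambda>_. 1"] assms by (force simp: less_imp_le)

text \<open>Along the segment from \<open>x\<close> to \<open>y\<close>, the numerator of the second
  derivative of \<open>ln p\<close> is minus the covariance form of the link at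
  \<open>v = y - x\<close>.\<close>

lemma link_poly_log_concave:
  assumes T: "T \<subseteq> V" "0 < m T"
    and x: "\<And>i. i \<in> V \<Longrightarrow> 0 < x i" and y: "\<And>i. i \<in> V \<Longrightarrow> 0 < y i"
    and t: "0 \<le> t" "t \<le> 1"
  shows "(1 - t) * ln (link_poly V m T x) + t * ln (link_poly V m T y)
       \<le> ln (link_poly V m T (\<lambda>i. (1 - t) * x i + t * y i))"
proof -
  define z where "z t i = (1 - t) * x i + t * y i" for t i
  define d where "d i = y i - x i" for i
  define p where "p t = link_poly V m T (z t)" for t
  define p1 where "p1 t = (\<Sum>i\<in>V-T. d i * link_poly V m (insert i T) (z t))" for t
  define p2 where "p2 t = (\<Sum>i\<in>V-T. d i * (\<Sum>j\<in>V-insert i T. d j * link_poly V m (insert j (insert i T)) (z t)))" for t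
  have zpos: "0 < z t i" if "0 \<le> t" "t \<le> 1" "i \<in> V" for t i
  proof (cases "t = 1")
    case False
    then show ?thesis unfolding z_def using x[OF that(3)] y[OF that(3)] that by (intro add_pos_nonneg) auto
  qed (use y[OF that(3)] in \<open>simp add: z_def\<close>)
  have dz: "((\<lambda>t. z t i) has_real_derivative d i) (at t)" for i t
    unfolding z_def d_def by (auto intro!: derivative_eq_intros)
  have dp: "(p has_real_derivative p1 t) (at t)" for t
    unfolding p_def[abs_def] p1_def by (rule has_real_derivative_link_poly[OF fin dz])
  have dp1: "(p1 has_real_derivative p2 t) (at t)" for t
    unfolding p1_def[abs_def] p2_def
    by (intro DERIV_sum DERIV_cmult has_real_derivative_link_poly[OF fin dz])
  have ppos: "0 < p t" if "0 \<le> t" "t \<le> 1" for t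
    unfolding p_def using T zpos[OF that] by (intro link_poly_pos) auto
  have le: "p2 t * p t \<le> p1 t * p1 t" if t: "0 \<le> t" "t \<le> 1" for t
  proof -
    have fin': "finite (V - T)" using fin by simp
    have p2: "p2 t = (\<Sum>i\<in>V-T. \<Sum>j\<in>V-T. d i * d j * (if i = j then 0 else link_poly V m (insert i (insert j T)) (z t)))"
      unfolding p2_def sum_distrib_left
    proof (rule sum.cong[OF refl])
      fix i assume "i \<in> V - T"
      show "(\<Sum>j\<in>V-insert i T. d i * (d j * link_poly V m (insert j (insert i T)) (z t)))
        = (\<Sum>j\<in>V-T. d i * d j * (if i = j then 0 else link_poly V m (insert i (insert j T)) (z t)))"
        by (rule sum.mono_neutral_cong_left) (use fin' in \<open>auto simp: insert_commute[of _ i T]\<close>)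
    qed
    have "0 \<le> (\<Sum>i\<in>V-T. \<Sum>j\<in>V-T.
      (link_poly V m (insert i T) (z t) * link_poly V m (insert j T) (z t)
        - (if i = j then 0 else link_poly V m T (z t) * link_poly V m (insert i (insert j T)) (z t))) * d i * d j)"
      by (rule link_covariance[OF T]) (use zpos[OF t] in auto)
    also have "\<dots> = p1 t * p1 t - p t * p2 t"
      unfolding p1_def p2 p_def sum_product sum_distrib_left[of "link_poly V m T (z t)"]
        sum_subtractf[symmetric]
      by (intro sum.cong refl) (simp add: algebra_simps)
    finally show ?thesis by (simp add: mult.commute)
  qed
  have "concave_on {0..1} (\<lambda>t. ln (p t))"
  proof (rule f''_le0_imp_concave)
    fix s :: real assume "s \<in> {0..1}"
    then have s: "0 \<le> s" "s \<le> 1" by auto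
    note P = ppos[OF s]
    show "((\<lambda>t. ln (p t)) has_real_derivative p1 s / p s) (at s)"
      by (rule derivative_eq_intros dp P refl)+ (simp add: field_simps)
    show "((\<lambda>s. p1 s / p s) has_real_derivative (p2 s * p s - p1 s * p1 s) / (p s * p s)) (at s)"
      by (rule DERIV_divide[OF dp1 dp]) (use P in simp)
    show "(p2 s * p s - p1 s * p1 s) / (p s * p s) \<le> 0"
      using le[OF s] P by (intro divide_nonpos_pos) auto
  qed simp
  from concave_onD[OF this t, of 0 1] show ?thesis
    by (simp add: p_def z_def[abs_def])
qed

end

lemma partial_deriv_link_poly:
  assumes "finite V" "i \<in> V - T"
  shows "partial_deriv i (link_poly V w T) = link_poly V w (insert i T)"
proof
  fix z :: "nat \<Rightarrow> real"
  have "((\<lambda>t. link_poly V w T (z(i := t))) has_real_derivative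
      (\<Sum>j\<in>V-T. (if j = i then 1 else 0) * link_poly V w (insert j T) (z(i := z i)))) (at (z i))"
    by (rule has_real_derivative_link_poly[OF assms(1)]) auto
  moreover have "(\<Sum>j\<in>V-T. (if j = i then 1 else 0) * link_poly V w (insert j T) (z(i := z i)))
     = (\<Sum>j\<in>V-T. if j = i then link_poly V w (insert i T) z else 0)"
    by (intro sum.cong refl) auto
  moreover have "\<dots> = link_poly V w (insert i T) z"
    using assms by simp
  ultimately show "partial_deriv i (link_poly V w T) z = link_poly V w (insert i T) z"
    unfolding partial_deriv_def by (metis DERIV_imp_deriv)
qed

lemma partial_derivs_link_poly:
  assumes "finite V" "S \<subseteq> V"
  shows "partial_derivs S (link_poly V w {}) = link_poly V w S"
proof -
  have "foldr partial_deriv xs (link_poly V w {}) = link_poly V w (set xs)"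
    if "distinct xs" "set xs \<subseteq> V" for xs
    using that by (induction xs) (auto simp: partial_deriv_link_poly[OF assms(1)])
  moreover have "finite S" using assms finite_subset by blast
  ultimately show ?thesis unfolding partial_derivs_def using assms by simp
qed

lemma strongly_log_concave_weighted_family:
  assumes "weighted_family {..<n} m"
  shows "strongly_log_concave n {S. S \<subseteq> {..<n} \<and> 0 < m S} (generating_poly {S. S \<subseteq> {..<n} \<and> 0 < m S} m)"
proof -
  interpret weighted_family "{..<n}" m by fact
  have "generating_poly {S. S \<subseteq> {..<n} \<and> 0 < m S} m = link_poly {..<n} m {}"
  proof
    fix z
    show "generating_poly {S. S \<subseteq> {..<n} \<and> 0 < m S} m z = link_poly {..<n} m {} z"
      unfolding generating_poly_def link_poly_def
      by (rule sum.mono_neutral_cong_left) (use nonneg in \<open>auto simp: order.order_iff_strict\<close>)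
  qed
  moreover have "log_concave_pos_orthant n (link_poly {..<n} m S)" if "S \<subseteq> {..<n}" "0 < m S" for S
    unfolding log_concave_pos_orthant_def
    using that by (auto intro!: link_poly_pos link_poly_log_concave)
  ultimately show ?thesis
    unfolding strongly_log_concave_def by (auto simp: partial_derivs_link_poly)
qed

section \<open>Principal minors and pivoting\<close>

text \<open>Principal minors are taken of \<open>n \<times> n\<close> matrices with the identity outside \<open>S\<close>, so that no index
  needs renumbering.\<close>

definition masked :: "nat \<Rightarrow> (nat \<Rightarrow> nat \<Rightarrow> real) \<Rightarrow> nat set \<Rightarrow> real mat" where
  "masked n A S = mat n n (\<lambda>(i,j). if i \<in> S \<and> j \<in> S then A i j else if i = j then 1 else 0)"

definition minor :: "nat \<Rightarrow> (nat \<Rightarrow> nat \<Rightarrow> real) \<Rightarrow> nat set \<Rightarrow> real" where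
  "minor n A S = Determinant.det (masked n A S)"

definition schur :: "(nat \<Rightarrow> nat \<Rightarrow> real) \<Rightarrow> nat \<Rightarrow> nat \<Rightarrow> nat \<Rightarrow> real" where
  "schur A j = (\<lambda>a b. A a b - A a j * A j b / A j j)"

lemma masked_carrier [simp]: "masked n A S \<in> carrier_mat n n"
  by (simp add: masked_def)

lemma minor_cong:
  assumes "\<And>a b. a \<in> S \<Longrightarrow> b \<in> S \<Longrightarrow> A a b = B a b"
  shows "minor n A S = minor n B S"
proof -
  have "masked n A S = masked n B S" unfolding masked_def
    by (rule cong_mat) (use assms in auto)
  then show ?thesis by (simp add: minor_def)
qed

lemma minor_empty [simp]: "minor n A {} = 1"
proof -
  have "masked n A {} = 1\<^sub>m n" unfolding masked_def one_mat_def by (rule cong_mat) auto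
  then show ?thesis by (simp add: minor_def)
qed

lemma det_expand_row:
  fixes M :: "real mat"
  assumes M: "M \<in> carrier_mat n n" and j: "j < n"
    and zero: "\<And>b. b < n \<Longrightarrow> b \<noteq> j \<Longrightarrow> M $$ (j, b) = 0"
  shows "Determinant.det M = M $$ (j, j) * Determinant.det (mat_delete M j j)"
proof -
  have "Determinant.det M = (\<Sum>b<n. M $$ (j,b) * cofactor M j b)"
    by (rule laplace_expansion_row[OF M j])
  also have "\<dots> = (\<Sum>b\<in>{j}. M $$ (j,b) * cofactor M j b)"
    by (rule sum.mono_neutral_right) (use j zero in auto)
  finally show ?thesis by (simp add: cofactor_def)
qed

lemma det_expand_column:
  fixes M :: "real mat"
  assumes M: "M \<in> carrier_mat n n" and j: "j < n"
    and zero: "\<And>a. a < n \<Longrightarrow> a \<noteq> j \<Longrightarrow> M $$ (a, j) = 0"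
  shows "Determinant.det M = M $$ (j, j) * Determinant.det (mat_delete M j j)"
proof -
  have "Determinant.det M = (\<Sum>a<n. M $$ (a,j) * cofactor M a j)"
    by (rule laplace_expansion_column[OF M j])
  also have "\<dots> = (\<Sum>a\<in>{j}. M $$ (a,j) * cofactor M a j)"
    by (rule sum.mono_neutral_right) (use j zero in auto)
  finally show ?thesis by (simp add: cofactor_def)
qed

lemma minor_zero_row:
  assumes "j \<in> S" "S \<subseteq> {..<n}" "\<And>b. b \<in> S \<Longrightarrow> A j b = 0"
  shows "minor n A S = 0"
proof -
  have j: "j < n" using assms by auto
  have "minor n A S = masked n A S $$ (j, j) * Determinant.det (mat_delete (masked n A S) j j)"
    unfolding minor_def by (rule det_expand_row[OF masked_carrier j]) (use assms j in \<open>auto simp: masked_def\<close>)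
  then show ?thesis using assms j by (simp add: masked_def)
qed

text \<open>One step of Gaussian elimination inside the masked matrix: \<open>Lo\<close> is the
  elementary factor of determinant 1, and column \<open>j\<close> of \<open>N\<close> contains only
  the pivot.\<close>

lemma minor_pivot:
  assumes j: "j \<in> S" and S: "S \<subseteq> {..<n}" and nz: "A j j \<noteq> 0"
  shows "minor n A S = A j j * minor n (schur A j) (S - {j})"
proof -
  have jn: "j < n" using j S by auto
  define Lo where "Lo = mat n n (\<lambda>(a,b). if a = b then 1 else if b = j \<and> a \<in> S then A a j / A j j else 0)"
  define N where "N = mat n n (\<lambda>(a,b). if a = j then (if b \<in> S then A j b else 0)
     else if a \<in> S \<and> b \<in> S \<and> b \<noteq> j then schur A j a b else if a = b then 1 else 0)"
  have car: "Lo \<in> carrier_mat n n" "N \<in> carrier_mat n n" by (simp_all add: Lo_def N_def)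
  have "masked n A S = Lo * N"
  proof (rule eq_matI)
    fix a b assume "a < dim_row (Lo * N)" "b < dim_col (Lo * N)"
    then have a: "a < n" and b: "b < n" using car by auto
    have "(Lo * N) $$ (a, b) = (\<Sum>k = 0..<n. Lo $$ (a, k) * N $$ (k, b))"
      using car a b by (simp add: scalar_prod_def)
    also have "\<dots> = (\<Sum>k\<in>{a, j}. Lo $$ (a, k) * N $$ (k, b))"
      by (rule sum.mono_neutral_right) (use a jn in \<open>auto simp: Lo_def\<close>)
    also have "\<dots> = masked n A S $$ (a, b)"
      using a b jn j nz by (cases "a = j") (auto simp: Lo_def N_def masked_def schur_def)
    finally show "masked n A S $$ (a, b) = (Lo * N) $$ (a, b)" ..
  qed (use car in \<open>auto simp: masked_def\<close>)
  then have 1: "minor n A S = Determinant.det Lo * Determinant.det N"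
    unfolding minor_def using det_mult[OF car] by simp
  have "Determinant.det Lo = Lo $$ (j, j) * Determinant.det (mat_delete Lo j j)"
    by (rule det_expand_row[OF car(1) jn]) (use jn in \<open>auto simp: Lo_def\<close>)
  also have "mat_delete Lo j j = 1\<^sub>m (n - 1)"
    unfolding mat_delete_def one_mat_def using car(1) by (intro cong_mat) (auto simp: Lo_def)
  finally have 2: "Determinant.det Lo = 1" using jn by (simp add: Lo_def)
  let ?M = "masked n (schur A j) (S - {j})"
  have "Determinant.det N = N $$ (j, j) * Determinant.det (mat_delete N j j)"
    by (rule det_expand_column[OF car(2) jn]) (use jn in \<open>auto simp: N_def\<close>)
  moreover have "Determinant.det ?M = ?M $$ (j, j) * Determinant.det (mat_delete ?M j j)"
    by (rule det_expand_column[OF masked_carrier jn]) (use jn in \<open>auto simp: masked_def\<close>)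
  moreover have "mat_delete N j j = mat_delete ?M j j"
    unfolding mat_delete_def using car(2) by (intro cong_mat) (auto simp: N_def masked_def)
  ultimately have "Determinant.det N = A j j * Determinant.det ?M"
    using jn j by (simp add: N_def masked_def)
  then show ?thesis using 1 2 by (simp add: minor_def)
qed

lemma minor_singleton:
  assumes "j < n" shows "minor n A {j} = A j j"
proof (cases "A j j = 0")
  case True
  then show ?thesis using minor_zero_row[of j "{j}" n A] assms by simp
next
  case False
  then show ?thesis using minor_pivot[of j "{j}" n A] assms by simp
qed

lemma minor_pair:
  assumes "i < n" "j < n" "i \<noteq> j" "A j j \<noteq> 0"
  shows "minor n A {i, j} = A i i * A j j - A i j * A j i"
proof -
  have "{i, j} - {j} = {i}" using assms by auto
  then have "minor n A {i, j} = A j j * schur A j i i"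
    using minor_pivot[of j "{i,j}" n A] minor_singleton[of i n] assms by simp
  then show ?thesis using assms by (simp add: schur_def right_diff_distrib mult.commute)
qed

text \<open>The principal pivot transform on \<open>{j}\<close>: if \<open>y = A x\<close>, this
  matrix expresses \<open>x j\<close> and the other \<open>y a\<close> in terms of
  \<open>y j\<close> and the other \<open>x b\<close>. The sign in row \<open>j\<close> is what
  makes the entries between pivoted and remaining indices skew-symmetric.\<close>

definition pivot_transform :: "(nat \<Rightarrow> nat \<Rightarrow> real) \<Rightarrow> nat \<Rightarrow> nat \<Rightarrow> nat \<Rightarrow> real" where
  "pivot_transform A j = (\<lambda>a b. if a = j then (if b = j then 1 / A j j else - A j b / A j j)
                  else if b = j then A a j / A j j else schur A j a b)"

text \<open>For \<open>j\<close> in \<open>T\<close> this is the elimination of \<open>j\<close>;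
  for \<open>j\<close> outside \<open>T\<close>, eliminating \<open>j\<close> from the transform
  restores \<open>A\<close> on the other indices.\<close>

lemma minor_pivot_transform:
  assumes j: "j < n" and T: "T \<subseteq> {..<n}" and nz: "A j j \<noteq> 0"
  shows "minor n A T = A j j * minor n (pivot_transform A j) (sym_diff T {j})"
proof (cases "j \<in> T")
  case True
  have "minor n (schur A j) (T - {j}) = minor n (pivot_transform A j) (T - {j})"
    by (rule minor_cong) (auto simp: pivot_transform_def)
  moreover have "sym_diff T {j} = T - {j}" using True by auto
  ultimately show ?thesis using minor_pivot[OF True T, of A] nz by simp
next
  case False
  have "minor n (pivot_transform A j) (insert j T) = pivot_transform A j j j * minor n (schur (pivot_transform A j) j) (insert j T - {j})"
    by (rule minor_pivot) (use T j nz in \<open>auto simp: pivot_transform_def\<close>)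
  also have "insert j T - {j} = T" using False by auto
  also have "minor n (schur (pivot_transform A j) j) T = minor n A T"
    by (rule minor_cong) (use False nz in \<open>auto simp: pivot_transform_def schur_def\<close>)
  finally have "minor n (pivot_transform A j) (insert j T) = minor n A T / A j j" by (simp add: pivot_transform_def)
  moreover have "sym_diff T {j} = insert j T" using False by auto
  ultimately show ?thesis using nz by simp
qed

section \<open>Positive semidefinite kernels and the signs of their minors\<close>

definition psd :: "nat set \<Rightarrow> (nat \<Rightarrow> nat \<Rightarrow> real) \<Rightarrow> bool" where
  "psd I A \<longleftrightarrow> (\<forall>a\<in>I. \<forall>b\<in>I. A a b = A b a) \<and> (\<forall>v. 0 \<le> (\<Sum>a\<in>I. \<Sum>b\<in>I. A a b * v a * v b))"

lemma psd_sym: "psd I A \<Longrightarrow> a \<in> I \<Longrightarrow> b \<in> I \<Longrightarrow> A a b = A b a"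
  by (simp add: psd_def)

lemma psd_form: "psd I A \<Longrightarrow> 0 \<le> (\<Sum>a\<in>I. \<Sum>b\<in>I. A a b * v a * v b)"
  by (simp add: psd_def)

lemma psd_subset:
  assumes "psd I A" "J \<subseteq> I" "finite I"
  shows "psd J A"
  unfolding psd_def
proof (intro conjI ballI allI)
  fix v
  have "(\<Sum>a\<in>J. \<Sum>b\<in>J. A a b * v a * v b)
    = (\<Sum>a\<in>I. \<Sum>b\<in>I. A a b * (if a \<in> J then v a else 0) * (if b \<in> J then v b else 0))"
    using assms by (intro sum.mono_neutral_cong_left) auto
  then show "0 \<le> (\<Sum>a\<in>J. \<Sum>b\<in>J. A a b * v a * v b)" using psd_form[OF assms(1)] by simp
qed (use assms psd_sym in blast)

lemma psd_diag:
  assumes "psd I A" "finite I" "j \<in> I" shows "0 \<le> A j j"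
  using psd_form[OF psd_subset[OF assms(1) _ assms(2), of "{j}"], of "\<lambda>_. 1"] assms(3) by simp

lemma psd_pair:
  assumes "psd I A" "finite I" "i \<in> I" "j \<in> I"
  shows "(A i j)\<^sup>2 \<le> A i i * A j j"
proof (cases "i = j")
  case False
  have sym: "A j i = A i j" using psd_sym[OF assms(1,4,3)] .
  have form: "0 \<le> A i i * x\<^sup>2 + 2 * A i j * x * y + A j j * y\<^sup>2" for x y
    using psd_form[OF psd_subset[OF assms(1) _ assms(2), of "{i,j}"], of "\<lambda>k. if k = i then x else y"] assms(3,4) False sym
    by (simp add: power2_eq_square algebra_simps)
  have nn: "0 \<le> A i i" "0 \<le> A j j" using psd_diag assms by blast+
  show ?thesis
  proof (cases "A j j = 0")
    case True
    have "A i j = 0"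
    proof (rule ccontr)
      assume "A i j \<noteq> 0"
      \<comment> \<open>At this witness the form takes the value -1.\<close>
      then show False using form[of 1 "- (A i i + 1) / (2 * A i j)"] True nn by (simp add: field_simps)
    qed
    then show ?thesis using True by simp
  next
    case False
    then have pos: "0 < A j j" using nn by simp
    have "0 \<le> A j j * (A i i * A j j - (A i j)\<^sup>2)"
      using form[of "A j j" "- A i j"] by (simp add: power2_eq_square algebra_simps)
    then show ?thesis using pos by (simp add: zero_le_mult_iff)
  qed
qed (simp add: power2_eq_square)

text \<open>The form of the Schur complement at \<open>v\<close> is the form of \<open>A\<close> at
  \<open>w\<close>, where coordinate \<open>j\<close> of \<open>v\<close> has been moved to the
  minimiser of the form.\<close>

lemma psd_schur:
  assumes A: "psd I A" "finite I" and j: "j \<in> I" and pos: "0 < A j j"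
  shows "psd I (schur A j)"
  unfolding psd_def
proof (intro conjI ballI allI)
  show "schur A j a b = schur A j b a" if "a \<in> I" "b \<in> I" for a b
    using that psd_sym[OF A(1)] j by (simp add: schur_def mult.commute)
  fix v
  define c where "c = (\<Sum>a\<in>I. A j a * v a)"
  define w where "w a = v a - (if a = j then c / A j j else 0)" for a
  have wsum: "(\<Sum>a\<in>I. g a * w a) = (\<Sum>a\<in>I. g a * v a) - g j * c / A j j" for g
  proof -
    have "(\<Sum>a\<in>I. g a * w a) = (\<Sum>a\<in>I. g a * v a) - (\<Sum>a\<in>I. if a = j then g a * c / A j j else 0)"
      unfolding w_def sum_subtractf[symmetric] by (intro sum.cong refl) (simp add: right_diff_distrib)
    then show ?thesis using A(2) j by simp
  qed
  have "(\<Sum>a\<in>I. \<Sum>b\<in>I. A a b * w a * w b) = (\<Sum>a\<in>I. (\<Sum>b\<in>I. A a b * w b) * w a)"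
    unfolding sum_distrib_right by (intro sum.cong refl) simp
  also have "\<dots> = (\<Sum>a\<in>I. ((\<Sum>b\<in>I. A a b * v b) - A a j * c / A j j) * w a)"
    unfolding wsum ..
  also have "\<dots> = (\<Sum>a\<in>I. ((\<Sum>b\<in>I. A a b * v b) - A a j * c / A j j) * v a)"
    unfolding wsum using pos by (simp add: c_def)
  also have "\<dots> = (\<Sum>a\<in>I. \<Sum>b\<in>I. schur A j a b * v a * v b)"
  proof (rule sum.cong[OF refl])
    fix a
    have "A a j * c / A j j = (\<Sum>b\<in>I. A a j * A j b / A j j * v b)"
      unfolding c_def sum_distrib_left sum_divide_distrib by (intro sum.cong refl) simp
    then show "((\<Sum>b\<in>I. A a b * v b) - A a j * c / A j j) * v a = (\<Sum>b\<in>I. schur A j a b * v a * v b)"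
      unfolding schur_def
      by (simp only: sum_subtractf[symmetric] sum_distrib_right) (intro sum.cong refl, simp add: algebra_simps)
  qed
  finally show "0 \<le> (\<Sum>a\<in>I. \<Sum>b\<in>I. schur A j a b * v a * v b)"
    using psd_form[OF A(1), of w] by simp
qed

lemma minor_psd_pivot:
  assumes A: "psd {..<n} A" and j: "j \<in> S" and S: "S \<subseteq> {..<n}"
  shows "0 < A j j \<and> psd {..<n} (schur A j) \<and> minor n A S = A j j * minor n (schur A j) (S - {j})
       \<or> A j j = 0 \<and> minor n A S = 0"
proof (cases "A j j = 0")
  case True
  have "A j b = 0" if "b \<in> S" for b
    using psd_pair[OF A finite_lessThan, of j b] S j that True by auto
  then show ?thesis using minor_zero_row[OF j S] True by simp
next
  case False
  moreover have "0 \<le> A j j" using psd_diag[OF A] j S by auto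
  ultimately show ?thesis using minor_pivot[OF j S] psd_schur[OF A finite_lessThan, of j] j S by auto
qed

lemma minor_nonneg:
  assumes "psd {..<n} A" "S \<subseteq> {..<n}"
  shows "0 \<le> minor n A S"
proof -
  have "finite S" using assms(2) finite_subset by blast
  then show ?thesis using assms
  proof (induction S arbitrary: A rule: finite_induct)
    case (insert j S)
    then have "insert j S - {j} = S" by auto
    then show ?case using minor_psd_pivot[OF insert.prems(1) insertI1 insert.prems(2)] insert.IH[of "schur A j"] insert.prems
      by (auto intro!: mult_nonneg_nonneg)
  qed simp
qed

text \<open>When the elements of \<open>S\<close> are eliminated one after another, positivity of
  the larger minor forces every pivot to be positive, and the smaller minor is the product of these
  pivots.\<close>

lemma minor_insert_pos:
  assumes "psd {..<n} A" "insert j S \<subseteq> {..<n}" "0 < minor n A (insert j S)"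
  shows "0 < minor n A S"
proof (cases "j \<in> S")
  case False
  have "finite S" using finite_subset[OF assms(2)] by simp
  then show ?thesis using assms False
  proof (induction S arbitrary: A rule: finite_induct)
    case (insert k S)
    have k: "insert j (insert k S) - {k} = insert j S" "insert k S - {k} = S" using insert.hyps(2) insert.prems(4) by auto
    have k1: "k \<in> insert j (insert k S)" "k \<in> insert k S" "insert k S \<subseteq> {..<n}" "insert j S \<subseteq> {..<n}" "j \<notin> S"
      using insert.prems(2,4) by auto
    have p: "0 < A k k \<and> psd {..<n} (schur A k)
        \<and> minor n A (insert j (insert k S)) = A k k * minor n (schur A k) (insert j S)"
      using minor_psd_pivot[OF insert.prems(1) k1(1) insert.prems(2)] insert.prems(3) unfolding k
      by (elim disjE) simp_all
    note p = conjunct1[OF p] conjunct1[OF conjunct2[OF p]] conjunct2[OF conjunct2[OF p]]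
    have "0 < minor n (schur A k) (insert j S)"
      using insert.prems(3) p(1) by (simp add: p(3) zero_less_mult_iff)
    then have "0 < minor n (schur A k) S" by (rule insert.IH[OF p(2) k1(4) _ k1(5)])
    moreover have "minor n A (insert k S) = A k k * minor n (schur A k) S"
      using minor_pivot[OF k1(2,3), of A] p(1) unfolding k by linarith
    ultimately show ?case using p(1) by simp
  qed simp
next
  case True
  then have "insert j S = S" by auto
  then show ?thesis using assms(3) by metis
qed

lemma minor_subset_pos:
  assumes A: "psd {..<n} A" and S: "S \<subseteq> {..<n}" and pos: "0 < minor n A S" and T: "T \<subseteq> S"
  shows "0 < minor n A T"
proof -
  have "0 < minor n A T" if "finite D" "T \<union> D \<subseteq> {..<n}" "0 < minor n A (T \<union> D)" for D
    using that
  proof (induction D rule: finite_induct)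
    case (insert k D)
    have "T \<union> insert k D = insert k (T \<union> D)" by simp
    then have "0 < minor n A (T \<union> D)"
      using minor_insert_pos[OF A, of k "T \<union> D"] insert.prems by metis
    then show ?case using insert by simp
  qed simp
  moreover have "T \<union> (S - T) = S" using T by auto
  moreover have "finite (S - T)" using S finite_subset by blast
  ultimately show ?thesis using S pos by metis
qed

text \<open>Pivot successively on the elements of \<open>S\<close>; \<open>B\<close> is the Schur complement outside \<open>S\<close> and the
  inverse inside.\<close>

lemma principal_pivot:
  assumes A: "psd {..<n} A" and S: "S \<subseteq> {..<n}" and pos: "0 < minor n A S"
  obtains B where "\<And>T. T \<subseteq> {..<n} \<Longrightarrow> minor n A T = minor n A S * minor n B (sym_diff T S)"
    "psd ({..<n} - S) B" "\<And>a b. a \<in> S \<Longrightarrow> b \<in> S \<Longrightarrow> B a b = B b a"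
    "\<And>a b. a \<in> S \<Longrightarrow> b \<in> {..<n} - S \<Longrightarrow> B a b = - B b a"
proof -
  have "finite S" using S finite_subset by blast
  then have "\<exists>B. (\<forall>T. T \<subseteq> {..<n} \<longrightarrow> minor n A T = minor n A S * minor n B (sym_diff T S))
    \<and> psd ({..<n} - S) B \<and> (\<forall>a\<in>S. \<forall>b\<in>S. B a b = B b a) \<and> (\<forall>a\<in>S. \<forall>b\<in>{..<n}-S. B a b = - B b a)"
    using S pos
  proof (induction S rule: finite_induct)
    case empty
    then show ?case using A by (intro exI[of _ A]) simp
  next
    case (insert j S)
    have posS: "0 < minor n A S"
      using minor_subset_pos[OF A insert.prems] by blast
    have j: "j < n" and SV: "S \<subseteq> {..<n}" using insert.prems by auto
    from insert.IH[OF SV posS] obtain B where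
      B: "\<And>T. T \<subseteq> {..<n} \<Longrightarrow> minor n A T = minor n A S * minor n B (sym_diff T S)"
        "psd ({..<n} - S) B" "\<And>a b. a \<in> S \<Longrightarrow> b \<in> S \<Longrightarrow> B a b = B b a"
        "\<And>a b. a \<in> S \<Longrightarrow> b \<in> {..<n} - S \<Longrightarrow> B a b = - B b a" by blast
    have "sym_diff (insert j S) S = {j}" using insert.hyps by auto
    then have mj: "minor n A (insert j S) = minor n A S * B j j"
      using B(1)[OF insert.prems(1)] minor_singleton[OF j] by simp
    then have bj: "0 < B j j" using insert.prems(2) posS by (simp add: zero_less_mult_iff)
    have "minor n A T = minor n A (insert j S) * minor n (pivot_transform B j) (sym_diff T (insert j S))" if T: "T \<subseteq> {..<n}" for T
    proof -
      have "sym_diff (sym_diff T S) {j} = sym_diff T (insert j S)" using insert.hyps by auto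
      moreover have "sym_diff T S \<subseteq> {..<n}" using T SV by auto
      ultimately have "minor n B (sym_diff T S) = B j j * minor n (pivot_transform B j) (sym_diff T (insert j S))"
        using minor_pivot_transform[OF j, of "sym_diff T S" B] bj by simp
      then show ?thesis using B(1)[OF T] mj by simp
    qed
    moreover have "psd ({..<n} - insert j S) (pivot_transform B j)"
    proof -
      have "psd ({..<n} - S) (schur B j)"
        by (rule psd_schur[OF B(2) _ _ bj]) (use j insert.hyps in auto)
      then have "psd ({..<n} - insert j S) (schur B j)" by (rule psd_subset) auto
      moreover have "pivot_transform B j a b = schur B j a b" if "a \<noteq> j" "b \<noteq> j" for a b using that by (simp add: pivot_transform_def)
      ultimately show ?thesis unfolding psd_def by simp
    qed
    moreover have "pivot_transform B j a b = pivot_transform B j b a" if "a \<in> insert j S" "b \<in> insert j S" for a b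
    proof -
      have "B c j = - B j c" if "c \<in> S" for c using B(4)[OF that, of j] j insert.hyps by auto
      then show ?thesis using that B(3) by (auto simp: pivot_transform_def schur_def)
    qed
    moreover have "pivot_transform B j a b = - pivot_transform B j b a" if a: "a \<in> insert j S" and b: "b \<in> {..<n} - insert j S" for a b
    proof -
      have "B c j = - B j c" if "c \<in> S" for c using B(4)[OF that, of j] j insert.hyps by auto
      moreover have "B b j = B j b" using psd_sym[OF B(2), of b j] b j insert.hyps by auto
      ultimately show ?thesis using a b B(4)[of a b] by (auto simp: pivot_transform_def schur_def)
    qed
    ultimately show ?case by (intro exI[of _ "pivot_transform B j"]) blast
  qed
  then show ?thesis using that by blast
qed

lemma schur_complement:
  assumes A: "psd {..<n} A" and S: "S \<subseteq> {..<n}" and pos: "0 < minor n A S"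
  obtains K where "psd ({..<n} - S) K"
    "\<And>i. i \<in> {..<n} - S \<Longrightarrow> minor n A (insert i S) = minor n A S * K i i"
    "\<And>i j. i \<in> {..<n} - S \<Longrightarrow> j \<in> {..<n} - S \<Longrightarrow> i \<noteq> j \<Longrightarrow>
       minor n A (insert i (insert j S)) = minor n A S * (K i i * K j j - (K i j)\<^sup>2)"
proof -
  obtain B where B: "\<And>T. T \<subseteq> {..<n} \<Longrightarrow> minor n A T = minor n A S * minor n B (sym_diff T S)"
    "psd ({..<n} - S) B" by (rule principal_pivot[OF A S pos]) blast
  show ?thesis
  proof (rule that[OF B(2)])
    fix i assume i: "i \<in> {..<n} - S"
    then have "sym_diff (insert i S) S = {i}" by auto
    then show "minor n A (insert i S) = minor n A S * B i i"
      using B(1)[of "insert i S"] i S minor_singleton by simp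
  next
    fix i j assume i: "i \<in> {..<n} - S" and j: "j \<in> {..<n} - S" and ij: "i \<noteq> j"
    then have "sym_diff (insert i (insert j S)) S = {i, j}" by auto
    then have 1: "minor n A (insert i (insert j S)) = minor n A S * minor n B {i, j}"
      using B(1)[of "insert i (insert j S)"] i j S by simp
    have sym: "B j i = B i j" using psd_sym[OF B(2) j i] .
    have "minor n B {i, j} = B i i * B j j - (B i j)\<^sup>2"
    proof (cases "B j j = 0")
      case True
      then have "B i j = 0" using psd_pair[OF B(2) _ i j] by simp
      then have "minor n B {i, j} = 0"
        using minor_zero_row[of j "{i,j}" n B] i j sym True by auto
      then show ?thesis using True \<open>B i j = 0\<close> by simp
    next
      case False
      then show ?thesis using minor_pair[OF _ _ ij, of n B] i j sym by (simp add: power2_eq_square)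
    qed
    then show "minor n A (insert i (insert j S)) = minor n A S * (B i i * B j j - (B i j)\<^sup>2)"
      using 1 by simp
  qed
qed

text \<open>Leibniz expansion with the trivial bound for each permutation. Such crudeness is
  affordable, since masses are only compared with \<open>1 / 2 ^ (4 * n^2)\<close>.\<close>

lemma minor_le_fact:
  assumes l: "1 \<le> l" and B: "\<And>a b. a < n \<Longrightarrow> b < n \<Longrightarrow> \<bar>B a b\<bar> \<le> l"
  shows "minor n B U \<le> fact n * l ^ n"
proof -
  let ?M = "masked n B U"
  have "minor n B U = (\<Sum>p\<in>{p. p permutes {0..<n}}. signof p * (\<Prod>i = 0..<n. ?M $$ (i, p i)))"
    unfolding minor_def by (rule det_def'[OF masked_carrier])
  also have "\<dots> \<le> (\<Sum>p\<in>{p. p permutes {0..<n}}. l ^ n)"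
  proof (rule sum_mono)
    fix p assume "p \<in> {p. p permutes {0..<n}}"
    then have p: "p permutes {0..<n}" by simp
    have "\<bar>\<Prod>i = 0..<n. ?M $$ (i, p i)\<bar> \<le> (\<Prod>i = 0..<n. l)"
      unfolding abs_prod
    proof (rule prod_mono)
      fix i assume i: "i \<in> {0..<n}"
      then have "p i < n" using permutes_in_image[OF p, of i] by simp
      then show "0 \<le> \<bar>?M $$ (i, p i)\<bar> \<and> \<bar>?M $$ (i, p i)\<bar> \<le> l"
        using i B[of i "p i"] l by (auto simp: masked_def)
    qed
    then show "signof p * (\<Prod>i = 0..<n. ?M $$ (i, p i)) \<le> l ^ n"
      by (cases p rule: sign_cases) auto
  qed
  also have "\<dots> = fact n * l ^ n"
    using card_permutations[of "{0..<n}" n] by simp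
  finally show ?thesis .
qed

text \<open>The hypotheses bound all entries of the principal pivot transform on \<open>S\<close>, whose minors are the
  ratios to be bounded.\<close>

lemma minor_local_max:
  assumes A: "psd {..<n} A" and S: "S \<subseteq> {..<n}" and pos: "0 < minor n A S" and l: "1 \<le> l"
    and add: "\<And>j. j \<in> {..<n} - S \<Longrightarrow> minor n A (insert j S) \<le> l * minor n A S"
    and rem: "\<And>i. i \<in> S \<Longrightarrow> minor n A (S - {i}) \<le> l * minor n A S"
    and exch: "\<And>i j. i \<in> S \<Longrightarrow> j \<in> {..<n} - S \<Longrightarrow> minor n A (insert j (S - {i})) \<le> l * minor n A S"
    and T: "T \<subseteq> {..<n}"
  shows "minor n A T \<le> fact n * l ^ n * minor n A S"
proof -
  obtain B where B: "\<And>T. T \<subseteq> {..<n} \<Longrightarrow> minor n A T = minor n A S * minor n B (sym_diff T S)"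
    "psd ({..<n} - S) B" "\<And>a b. a \<in> S \<Longrightarrow> b \<in> S \<Longrightarrow> B a b = B b a"
    "\<And>a b. a \<in> S \<Longrightarrow> b \<in> {..<n} - S \<Longrightarrow> B a b = - B b a"
    by (rule principal_pivot[OF A S pos]) blast
  have out: "B j j \<le> l" "0 \<le> B j j" if j: "j \<in> {..<n} - S" for j
  proof -
    have "sym_diff (insert j S) S = {j}" using j by auto
    then have "minor n A (insert j S) = minor n A S * B j j"
      using B(1)[of "insert j S"] j S minor_singleton by simp
    then show "B j j \<le> l" using add[OF j] pos by (simp add: mult.commute[of l])
    show "0 \<le> B j j" using psd_diag[OF B(2) _ j] by simp
  qed
  have inn: "B i i \<le> l" "0 < B i i" if i: "i \<in> S" for i
  proof -
    have "sym_diff (S - {i}) S = {i}" "i < n" using i S by auto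
    then have e: "minor n A (S - {i}) = minor n A S * B i i"
      using B(1)[of "S - {i}"] S minor_singleton by auto
    then show "B i i \<le> l" using rem[OF i] pos by (simp add: mult.commute[of l])
    have "0 < minor n A (S - {i})" by (rule minor_subset_pos[OF A S pos]) auto
    then show "0 < B i i" using e pos by (simp add: zero_less_mult_iff)
  qed
  have ent: "(B a b)\<^sup>2 \<le> l\<^sup>2" if a: "a < n" and b: "b < n" for a b
  proof -
    have ll: "x * y \<le> l\<^sup>2" if "0 \<le> x" "x \<le> l" "0 \<le> y" "y \<le> l" for x y
      using mult_mono[OF that(2,4)] that l by (simp add: power2_eq_square)
    \<comment> \<open>Skew-symmetry between \<open>S\<close> and its complement makes the exchange
      minor the sum \<open>B j j * B i i + (B i j)^2\<close>, without cancellation, so that a bound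
      on the minor bounds the entry.\<close>
    have mixed: "(B i j)\<^sup>2 \<le> l\<^sup>2" if i: "i \<in> S" and j: "j \<in> {..<n} - S" for i j
    proof -
      have "sym_diff (insert j (S - {i})) S = {j, i}" using i j by auto
      then have "minor n A (insert j (S - {i})) = minor n A S * minor n B {j, i}"
        using B(1)[of "insert j (S - {i})"] j S by auto
      then have "minor n B {j, i} \<le> l" using exch[OF i j] pos by (simp add: mult.commute[of l])
      moreover have "minor n B {j, i} = B j j * B i i + (B i j)\<^sup>2"
        using minor_pair[of j n i B] i j S inn[OF i] B(4)[OF i j] by (auto simp: power2_eq_square)
      moreover have "0 \<le> B j j * B i i" using out[OF j] inn[OF i] by simp
      moreover have "l \<le> l\<^sup>2" using l by (simp add: power2_eq_square)
      ultimately show ?thesis by linarith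
    qed
    consider "a \<in> S" "b \<in> S" | "a \<in> S" "b \<notin> S" | "a \<notin> S" "b \<in> S" | "a \<notin> S" "b \<notin> S" by blast
    then show ?thesis
    proof cases
      case 1
      show ?thesis
      proof (cases "a = b")
        case True
        then show ?thesis using ll[of "B a a" "B a a"] inn[OF 1(1)] by (simp add: power2_eq_square)
      next
        case False
        \<comment> \<open>\<open>principal_pivot\<close> gives semidefiniteness outside
          \<open>S\<close>; inside, the 2 by 2 inequality comes from the non-negative minor of
          \<open>A\<close> at \<open>S - {a, b}\<close>.\<close>
        have "sym_diff (S - {a, b}) S = {a, b}" using 1 by auto
        then have "minor n A (S - {a, b}) = minor n A S * minor n B {a, b}"
          using B(1)[of "S - {a, b}"] S by auto
        moreover have "0 \<le> minor n A (S - {a, b})" by (rule minor_nonneg[OF A]) (use S in auto)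
        ultimately have "0 \<le> minor n B {a, b}" using pos by (simp add: zero_le_mult_iff)
        then have "(B a b)\<^sup>2 \<le> B a a * B b b"
          using minor_pair[OF a b False, of B] inn[OF 1(2)] B(3)[OF 1] by (simp add: power2_eq_square)
        also have "\<dots> \<le> l\<^sup>2" using inn[OF 1(1)] inn[OF 1(2)] by (intro ll) auto
        finally show ?thesis .
      qed
    next
      case 2
      then show ?thesis using mixed b by simp
    next
      case 3
      then show ?thesis using mixed[of b a] B(4)[of b a] a by simp
    next
      case 4
      then have "(B a b)\<^sup>2 \<le> B a a * B b b" using psd_pair[OF B(2), of a b] a b by simp
      also have "\<dots> \<le> l\<^sup>2" using out[of a] out[of b] 4 a b by (intro ll) auto
      finally show ?thesis .
    qed
  qed
  have "\<bar>B a b\<bar> \<le> l" if "a < n" "b < n" for a b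
    using power2_le_imp_le[of "\<bar>B a b\<bar>" l] ent[OF that] l by simp
  then have "minor n B (sym_diff T S) \<le> fact n * l ^ n" by (rule minor_le_fact[OF l])
  then show ?thesis using B(1)[OF T] pos by (simp add: mult.commute mult_left_mono)
qed

text \<open>Two Leibniz sums are compared. \<open>pick S\<close> enumerates \<open>S\<close> in
  increasing order and carries permutations of \<open>{0..<card S}\<close> to permutations of
  \<open>S\<close>; a permutation of all indices that moves one outside \<open>S\<close> meets a
  zero entry of the masked matrix.\<close>

lemma principal_minor_eq_minor:
  assumes L: "L \<in> carrier_mat n n" and S: "S \<subseteq> {..<n}"
  shows "principal_minor L S = minor n (\<lambda>i j. L $$ (i, j)) S"
proof -
  define k where "k = card S"
  define A where "A i j = L $$ (i, j)" for i j
  have finS: "finite S" using S finite_subset by blast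
  have eqS: "{i. i < n \<and> i \<in> S} = S" using S by auto
  have sub: "submatrix L S S = mat k k (\<lambda>(i,j). A (pick S i) (pick S j))"
    using L unfolding submatrix_def A_def k_def by (simp add: eqS)
  have bij: "bij_betw (pick S) {0..<k} S"
  proof (rule bij_betw_imageI)
    show inj: "inj_on (pick S) {0..<k}"
      by (rule inj_onI) (metis atLeastLessThan_iff k_def linorder_neq_iff pick_mono_le)
    have "pick S ` {0..<k} \<subseteq> S" using pick_in_set_le by (auto simp: k_def)
    then show "pick S ` {0..<k} = S"
      using card_image[OF inj] by (intro card_subset_eq[OF finS]) (auto simp: k_def)
  qed
  have fS: "pick S ` {0..<k} = S" and inj: "inj_on (pick S) {0..<k}" using bij by (auto simp: bij_betw_def)
  define \<phi> where "\<phi> p = map_permutation {0..<k} (pick S) p" for p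
  have \<phi>: "\<phi> p = (\<lambda>x. if x \<in> S then pick S (p (inv_into {0..<k} (pick S) x)) else x)" for p
    unfolding \<phi>_def map_permutation_def fS restrict_id_def by auto
  have bij\<phi>: "bij_betw \<phi> {p. p permutes {0..<k}} {p. p permutes S}"
    using bij_betw_permutations[OF bij] unfolding \<phi> by simp
  have "principal_minor L S = (\<Sum>p\<in>{p. p permutes {0..<k}}.
      signof p * (\<Prod>i = 0..<k. A (pick S i) (pick S (p i))))"
    unfolding principal_minor_def sub
    by (subst det_def'[where n=k]) (auto intro!: sum.cong prod.cong dest: permutes_in_image)
  also have "\<dots> = (\<Sum>p\<in>{p. p permutes {0..<k}}. signof (\<phi> p) * (\<Prod>i\<in>S. A i (\<phi> p i)))"
  proof (rule sum.cong[OF refl])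
    fix p assume "p \<in> {p. p permutes {0..<k}}"
    then have p: "p permutes {0..<k}" by simp
    have "sign (\<phi> p) = sign p" unfolding \<phi>_def by (rule sign_map_permutation[OF inj p]) simp
    moreover have "(\<Prod>i\<in>S. A i (\<phi> p i)) = (\<Prod>i = 0..<k. A (pick S i) (\<phi> p (pick S i)))"
      by (rule prod.reindex_bij_betw[OF bij, symmetric])
    moreover have "\<phi> p (pick S i) = pick S (p i)" if "i \<in> {0..<k}" for i
      unfolding \<phi>_def by (rule map_permutation_apply[OF inj that])
    ultimately show "signof p * (\<Prod>i = 0..<k. A (pick S i) (pick S (p i)))
       = signof (\<phi> p) * (\<Prod>i\<in>S. A i (\<phi> p i))" by simp
  qed
  also have "\<dots> = (\<Sum>q\<in>{p. p permutes S}. signof q * (\<Prod>i\<in>S. A i (q i)))"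
    by (rule sum.reindex_bij_betw[OF bij\<phi>])
  also have "\<dots> = (\<Sum>q\<in>{p. p permutes {0..<n}}. signof q * (\<Prod>i = 0..<n. masked n A S $$ (i, q i)))"
  proof (rule sum.mono_neutral_cong_left)
    show "finite {p. p permutes {0..<n}}" by (rule finite_permutations) simp
    show "{p. p permutes S} \<subseteq> {p. p permutes {0..<n}}" 
    proof -
      have "S \<subseteq> {0..<n}" using S by auto
      then show ?thesis by (auto intro: permutes_subset)
    qed
    show "\<forall>q\<in>{p. p permutes {0..<n}} - {p. p permutes S}. signof q * (\<Prod>i = 0..<n. masked n A S $$ (i, q i)) = 0"
    proof
      fix q assume q: "q \<in> {p. p permutes {0..<n}} - {p. p permutes S}"
      then have qn: "q permutes {0..<n}" by simp
      obtain i where i: "i \<notin> S" "q i \<noteq> i"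
        using q permutes_superset[OF qn, of S] by auto
      then have "i < n" using permutes_not_in[OF qn, of i] by force
      moreover have "q i < n" using permutes_in_image[OF qn, of i] calculation by simp
      ultimately have "masked n A S $$ (i, q i) = 0" using i by (simp add: masked_def)
      then show "signof q * (\<Prod>i = 0..<n. masked n A S $$ (i, q i)) = 0"
        using \<open>i < n\<close> by (auto simp: prod_zero_iff)
    qed
    fix q assume "q \<in> {p. p permutes S}"
    then have q: "q permutes S" by simp
    have "(\<Prod>i\<in>S. A i (q i)) = (\<Prod>i = 0..<n. masked n A S $$ (i, q i))"
    proof (rule prod.mono_neutral_cong_left)
      show "S \<subseteq> {0..<n}" using S by auto
      show "\<forall>i\<in>{0..<n} - S. masked n A S $$ (i, q i) = 1"
        using permutes_not_in[OF q] by (auto simp: masked_def)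
      show "A i (q i) = masked n A S $$ (i, q i)" if "i \<in> S" for i
        using that subsetD[OF S that] subsetD[OF S, of "q i"] permutes_in_image[OF q, of i] by (simp add: masked_def)
    qed simp
    then show "signof q * (\<Prod>i\<in>S. A i (q i)) = signof q * (\<Prod>i = 0..<n. masked n A S $$ (i, q i))" by simp
  qed
  also have "\<dots> = minor n A S" unfolding minor_def by (rule det_def'[OF masked_carrier, symmetric])
  finally show ?thesis unfolding A_def .
qed

section \<open>Hadamard powers of positive semidefinite kernels\<close>

text \<open>Cholesky factorisation: row \<open>p\<close> of \<open>B'\<close> comes from the pivot,
  the other rows from the Schur complement on \<open>J\<close>. If the pivot is 0, its row and
  column vanish.\<close>

lemma psd_gram:
  assumes "finite I" "psd I A"
  shows "\<exists>B. \<forall>a\<in>I. \<forall>b\<in>I. A a b = (\<Sum>k\<in>I. B k a * B k b :: real)"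
  using assms
proof (induction I arbitrary: A rule: finite_induct)
  case (insert p J)
  have fin: "finite (insert p J)" using insert.hyps by simp
  have psdJ: "psd J A" by (rule psd_subset[OF insert.prems _ fin]) auto
  show ?case
  proof (cases "A p p = 0")
    case True
    have z: "A a p = 0" "A p a = 0" if "a \<in> insert p J" for a
      using psd_pair[OF insert.prems fin, of a p] psd_pair[OF insert.prems fin, of p a] that True by auto
    obtain B where B: "\<And>a b. a \<in> J \<Longrightarrow> b \<in> J \<Longrightarrow> A a b = (\<Sum>k\<in>J. B k a * B k b)"
      using insert.IH[OF psdJ] by blast
    define B' where "B' k a = (if k = p \<or> a = p then 0 else B k a)" for k a
    have s: "(\<Sum>k\<in>insert p J. B' k a * B' k b) = (\<Sum>k\<in>J. B' k a * B' k b)" for a b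
      using insert.hyps by (simp add: B'_def)
    have "A a b = (\<Sum>k\<in>insert p J. B' k a * B' k b)" if "a \<in> insert p J" "b \<in> insert p J" for a b
    proof (cases "a = p \<or> b = p")
      case True
      then show ?thesis unfolding s using z[OF that(1)] z[OF that(2)] by (auto simp: B'_def)
    next
      case False
      then show ?thesis unfolding s using that B[of a b] insert.hyps
        by (auto intro!: sum.cong simp: B'_def)
    qed
    then show ?thesis by blast
  next
    case False
    then have pos: "0 < A p p" using psd_diag[OF insert.prems fin, of p] by simp
    have "psd (insert p J) (schur A p)" by (rule psd_schur[OF insert.prems fin _ pos]) simp
    then have "psd J (schur A p)" by (rule psd_subset[OF _ _ fin]) auto
    from insert.IH[OF this] obtain B where
      B: "\<And>a b. a \<in> J \<Longrightarrow> b \<in> J \<Longrightarrow> schur A p a b = (\<Sum>k\<in>J. B k a * B k b)" by blast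
    define B' where "B' k a = (if k = p then A p a / sqrt (A p p) else if a = p then 0 else B k a)" for k a
    have s: "(\<Sum>k\<in>insert p J. B' k a * B' k b) = A p a * A p b / A p p + (\<Sum>k\<in>J. B' k a * B' k b)" for a b
      using insert.hyps pos by (simp add: B'_def)
    have sym: "A a p = A p a" if "a \<in> insert p J" for a
      using psd_sym[OF insert.prems that] by simp
    have "A a b = (\<Sum>k\<in>insert p J. B' k a * B' k b)" if "a \<in> insert p J" "b \<in> insert p J" for a b
    proof (cases "a = p \<or> b = p")
      case True
      then have "(\<Sum>k\<in>J. B' k a * B' k b) = 0" using insert.hyps by (intro sum.neutral) (auto simp: B'_def)
      then show ?thesis unfolding s using True pos sym[OF that(1)] by auto
    next
      case False
      then have "(\<Sum>k\<in>J. B' k a * B' k b) = schur A p a b"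
        using that B[of a b] insert.hyps by (auto intro!: sum.cong simp: B'_def)
      then show ?thesis unfolding s by (simp add: schur_def sym[OF that(1)])
    qed
    then show ?thesis by blast
  qed
qed simp

text \<open>Schur's product theorem: with a Gram factor \<open>B\<close> of \<open>A\<close>, the
  form is a sum over \<open>k\<close> of forms of \<open>C\<close> at the vectors
  \<open>B k a * v a\<close>.\<close>

lemma psd_hadamard:
  assumes fin: "finite I" and A: "psd I A" and C: "psd I C"
  shows "psd I (\<lambda>a b. A a b * C a b)"
  unfolding psd_def
proof (intro conjI ballI allI)
  show "A a b * C a b = A b a * C b a" if "a \<in> I" "b \<in> I" for a b
    using psd_sym[OF A that] psd_sym[OF C that] by simp
  fix v
  obtain B where B: "\<And>a b. a \<in> I \<Longrightarrow> b \<in> I \<Longrightarrow> A a b = (\<Sum>k\<in>I. B k a * B k b)"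
    using psd_gram[OF fin A] by blast
  have "(\<Sum>a\<in>I. \<Sum>b\<in>I. A a b * C a b * v a * v b)
    = (\<Sum>a\<in>I. \<Sum>b\<in>I. \<Sum>k\<in>I. C a b * (B k a * v a) * (B k b * v b))"
    by (intro sum.cong refl) (simp add: B sum_distrib_left sum_distrib_right mult_ac)
  also have "\<dots> = (\<Sum>a\<in>I. \<Sum>k\<in>I. \<Sum>b\<in>I. C a b * (B k a * v a) * (B k b * v b))"
    by (intro sum.cong refl sum.swap)
  also have "\<dots> = (\<Sum>k\<in>I. \<Sum>a\<in>I. \<Sum>b\<in>I. C a b * (B k a * v a) * (B k b * v b))"
    by (rule sum.swap)
  also have "\<dots> \<ge> 0" by (intro sum_nonneg psd_form[OF C])
  finally show "0 \<le> (\<Sum>a\<in>I. \<Sum>b\<in>I. A a b * C a b * v a * v b)" .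
qed

lemma psd_square_power:
  assumes fin: "finite I" and r: "psd I r"
  shows "psd I (\<lambda>a b. ((r a b)\<^sup>2) ^ k)"
proof (induction k)
  case 0
  have "(\<Sum>a\<in>I. \<Sum>b\<in>I. v a * v b) = (\<Sum>a\<in>I. v a)\<^sup>2" for v :: "nat \<Rightarrow> real"
    by (simp add: power2_eq_square sum_product)
  then show ?case by (simp add: psd_def)
next
  case (Suc k)
  have "psd I (\<lambda>a b. r a b * (r a b * ((r a b)\<^sup>2) ^ k))"
    by (intro psd_hadamard fin r Suc)
  then show ?case by (simp add: power2_eq_square mult_ac)
qed

text \<open>These are the coefficients of \<open>(1 - x) powr \<alpha>\<close> beyond the constant
  one. After negating the upper index, all factors \<open>k - \<alpha> - i\<close> of the product
  are non-negative except the last, which is \<open>- \<alpha>\<close>.\<close>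

lemma gbinomial_alternating_nonpos:
  fixes \<alpha> :: real
  assumes "0 \<le> \<alpha>" "\<alpha> \<le> 1"
  shows "(\<alpha> gchoose Suc k) * (-1) ^ Suc k \<le> 0"
proof -
  have e: "(\<alpha> gchoose Suc k) * (-1) ^ Suc k = (real k - \<alpha>) gchoose Suc k"
    using gbinomial_negated_upper[of \<alpha> "Suc k"] by (simp add: power_mult_distrib[symmetric] mult.commute)
  have "(\<Prod>i = 0..<k. real k - \<alpha> - real i) \<ge> 0"
    by (rule prod_nonneg) (use assms in auto)
  moreover have "(\<Prod>i = 0..<Suc k. real k - \<alpha> - real i) = (\<Prod>i = 0..<k. real k - \<alpha> - real i) * (- \<alpha>)"
    by simp
  ultimately have "(\<Prod>i = 0..<Suc k. real k - \<alpha> - real i) \<le> 0"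
    using assms by (simp add: mult_nonneg_nonpos)
  then show ?thesis unfolding e unfolding gbinomial_prod_rev by (simp add: divide_nonpos_pos)
qed

text \<open>The function \<open>x \<mapsto> 1 - (1 - x)\<^sup>\<alpha>\<close> is a power series with non-negative coefficients, so
  Schur's product theorem applies; for \<open>\<alpha> = 0\<close> it degenerates to the indicator of \<open>x = 1\<close>, a
  limit of powers.\<close>

lemma psd_one_minus_powr:
  assumes fin: "finite I" and r: "psd I r" and r1: "\<And>a b. a \<in> I \<Longrightarrow> b \<in> I \<Longrightarrow> (r a b)\<^sup>2 \<le> 1"
    and \<alpha>: "0 \<le> \<alpha>" "\<alpha> \<le> 1"
  shows "0 \<le> (\<Sum>a\<in>I. \<Sum>b\<in>I. (1 - (if (r a b)\<^sup>2 < 1 then (1 - (r a b)\<^sup>2) powr \<alpha> else 0)) * v a * v b)"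
proof -
  have pow: "0 \<le> (\<Sum>a\<in>I. \<Sum>b\<in>I. ((r a b)\<^sup>2) ^ k * v a * v b)" for k
    by (rule psd_form[OF psd_square_power[OF fin r]])
  show ?thesis
  proof (cases "\<alpha> = 0")
    case True
    have lim: "(\<lambda>k. ((r a b)\<^sup>2) ^ k) \<longlonglongrightarrow> 1 - (if (r a b)\<^sup>2 < 1 then (1 - (r a b)\<^sup>2) powr \<alpha> else 0)"
      if "a \<in> I" "b \<in> I" for a b
    proof (cases "(r a b)\<^sup>2 < 1")
      case True
      then show ?thesis using LIMSEQ_realpow_zero[of "(r a b)\<^sup>2"] \<open>\<alpha> = 0\<close> by simp
    next
      case False
      then have "(r a b)\<^sup>2 = 1" using r1[OF that] by simp
      then show ?thesis by simp
    qed
    have "(\<lambda>k. \<Sum>a\<in>I. \<Sum>b\<in>I. ((r a b)\<^sup>2) ^ k * v a * v b) \<longlonglongrightarrow>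
       (\<Sum>a\<in>I. \<Sum>b\<in>I. (1 - (if (r a b)\<^sup>2 < 1 then (1 - (r a b)\<^sup>2) powr \<alpha> else 0)) * v a * v b)"
      by (intro tendsto_sum tendsto_mult_right lim)
    then show ?thesis by (rule LIMSEQ_le_const) (use pow in blast)
  next
    case False
    then have \<alpha>0: "0 < \<alpha>" using \<alpha> by simp
    \<comment> \<open>The binomial series is available for arguments of absolute value below 1,
      while \<open>(r a b)^2 = 1\<close> may occur, as it does on the diagonal in the application.
      The factor \<open>t < 1\<close> is removed by a limit.\<close>
    define \<psi> where "\<psi> t a b = 1 - (1 - t * (r a b)\<^sup>2) powr \<alpha>" for t a b
    have nonneg: "0 \<le> (\<Sum>a\<in>I. \<Sum>b\<in>I. \<psi> t a b * v a * v b)" if t: "0 < t" "t < 1" for t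
    proof -
      define c where "c k = (if k = 0 then 0 else - ((\<alpha> gchoose k) * (-1) ^ k))" for k
      have c: "0 \<le> c k" for k
        using gbinomial_alternating_nonpos[OF \<alpha>, of "k - 1"] by (cases k) (auto simp: c_def)
      have s: "(\<lambda>k. c k * t ^ k * ((r a b)\<^sup>2) ^ k) sums \<psi> t a b" if ab: "a \<in> I" "b \<in> I" for a b
      proof -
        define x where "x = t * (r a b)\<^sup>2"
        have "0 \<le> x" "x < 1" unfolding x_def using t r1[OF ab]
          by (auto intro: le_less_trans[OF mult_left_mono[of "(r a b)\<^sup>2" 1 t]])
        then have "(\<lambda>k. (\<alpha> gchoose k) * (- x) ^ k) sums (1 + - x) powr \<alpha>"
          by (intro gen_binomial_real) simp
        from sums_diff[OF sums_single[of 0 "\<lambda>_. 1"] this]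
        have "(\<lambda>k. (if k = 0 then 1 else 0) - (\<alpha> gchoose k) * (- x) ^ k) sums (1 - (1 + - x) powr \<alpha>)"
          by (simp add: if_distrib cong: if_cong)
        moreover have "(if k = 0 then 1 else 0) - (\<alpha> gchoose k) * (- x) ^ k = c k * t ^ k * ((r a b)\<^sup>2) ^ k" for k
        proof -
          have "(- x) ^ k = (-1) ^ k * (t ^ k * ((r a b)\<^sup>2) ^ k)"
            unfolding x_def power_minus[of "t * _"] power_mult_distrib ..
          then show ?thesis by (cases k) (simp_all add: c_def)
        qed
        ultimately show ?thesis by (simp add: \<psi>_def x_def)
      qed
      have S: "(\<lambda>k. \<Sum>a\<in>I. \<Sum>b\<in>I. c k * t ^ k * ((r a b)\<^sup>2) ^ k * v a * v b) sums (\<Sum>a\<in>I. \<Sum>b\<in>I. \<psi> t a b * v a * v b)"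
        by (intro sums_sum sums_mult2 s)
      have nn: "0 \<le> (\<Sum>a\<in>I. \<Sum>b\<in>I. c k * t ^ k * ((r a b)\<^sup>2) ^ k * v a * v b)" for k
      proof -
        have "0 \<le> c k * t ^ k * (\<Sum>a\<in>I. \<Sum>b\<in>I. ((r a b)\<^sup>2) ^ k * v a * v b)"
          using c[of k] t pow[of k] by simp
        then show ?thesis by (simp add: sum_distrib_left mult_ac)
      qed
      show ?thesis by (rule sums_le[OF nn sums_zero S])
    qed
    have lim: "((\<lambda>t. \<psi> t a b) \<longlongrightarrow> 1 - (if (r a b)\<^sup>2 < 1 then (1 - (r a b)\<^sup>2) powr \<alpha> else 0)) (at_left 1)"
      if ab: "a \<in> I" "b \<in> I" for a b
    proof -
      have "((\<lambda>t. 1 - t * (r a b)\<^sup>2) \<longlongrightarrow> 1 - 1 * (r a b)\<^sup>2) (at_left 1)" by (intro tendsto_intros)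
      moreover have "\<forall>\<^sub>F t in at_left 1. 0 \<le> 1 - t * (r a b)\<^sup>2"
      proof -
        have "0 \<le> 1 - t * (r a b)\<^sup>2" if "0 < t" "t < 1" for t
          using mult_mono[of t 1 "(r a b)\<^sup>2" 1] r1[OF ab] that by simp
        moreover have "\<forall>\<^sub>F t::real in at_left 1. t \<in> {0<..<1}" by (rule eventually_at_leftI[of 0]) auto
        ultimately show ?thesis by (auto elim: eventually_mono)
      qed
      ultimately have "((\<lambda>t. (1 - t * (r a b)\<^sup>2) powr \<alpha>) \<longlongrightarrow> (1 - 1 * (r a b)\<^sup>2) powr \<alpha>) (at_left 1)"
        using \<alpha>0 by (intro tendsto_powr'[OF _ tendsto_const]) auto
      then have "((\<lambda>t. \<psi> t a b) \<longlongrightarrow> 1 - (1 - 1 * (r a b)\<^sup>2) powr \<alpha>) (at_left 1)"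
        unfolding \<psi>_def by (intro tendsto_diff tendsto_const)
      moreover have "(1 - 1 * (r a b)\<^sup>2) powr \<alpha> = (if (r a b)\<^sup>2 < 1 then (1 - (r a b)\<^sup>2) powr \<alpha> else 0)"
        using r1[OF ab] by auto
      ultimately show ?thesis by simp
    qed
    have "((\<lambda>t. \<Sum>a\<in>I. \<Sum>b\<in>I. \<psi> t a b * v a * v b) \<longlongrightarrow>
       (\<Sum>a\<in>I. \<Sum>b\<in>I. (1 - (if (r a b)\<^sup>2 < 1 then (1 - (r a b)\<^sup>2) powr \<alpha> else 0)) * v a * v b)) (at_left 1)"
      by (intro tendsto_sum tendsto_mult_right lim)
    moreover have "\<forall>\<^sub>F t::real in at_left 1. t \<in> {0<..<1}" by (rule eventually_at_leftI[of 0]) auto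
    then have "\<forall>\<^sub>F t in at_left 1. 0 \<le> (\<Sum>a\<in>I. \<Sum>b\<in>I. \<psi> t a b * v a * v b)"
      by (rule eventually_mono) (use nonneg in auto)
    ultimately show ?thesis by (rule tendsto_lowerbound) simp
  qed
qed

text \<open>The power \<open>x\<^sup>\<alpha>\<close> restricted to positive \<open>x\<close>, so that zero minors keep weight 0 when \<open>\<alpha> = 0\<close>.\<close>

definition ppow :: "real \<Rightarrow> real \<Rightarrow> real" where
  "ppow \<alpha> x = (if 0 < x then x powr \<alpha> else 0)"

lemma ppow_mult: "0 < x \<Longrightarrow> ppow \<alpha> (x * y) = ppow \<alpha> x * ppow \<alpha> y"
  by (simp add: ppow_def powr_mult zero_less_mult_iff)

text \<open>Dividing by the diagonal turns \<open>K\<close> into the correlation kernel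
  \<open>r\<close> on \<open>J\<close>, and the factors \<open>ppow \<alpha> (K a a)\<close> are
  absorbed into the test vector. A pair with an index outside \<open>J\<close> has coefficient
  0.\<close>

lemma psd_ppow:
  assumes fin: "finite I" and K: "psd I K" and \<alpha>: "0 \<le> \<alpha>" "\<alpha> \<le> 1"
  shows "0 \<le> (\<Sum>a\<in>I. \<Sum>b\<in>I. (ppow \<alpha> (K a a) * ppow \<alpha> (K b b)
      - ppow \<alpha> (K a a * K b b - (K a b)\<^sup>2)) * u a * u b)"
proof -
  define J where "J = {a\<in>I. 0 < K a a}"
  define r where "r a b = K a b / (sqrt (K a a) * sqrt (K b b))" for a b
  define v where "v a = ppow \<alpha> (K a a) * u a" for a
  have finJ: "finite J" and JI: "J \<subseteq> I" using fin by (auto simp: J_def)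
  have KJ: "psd J K" by (rule psd_subset[OF K JI fin])
  have pos: "0 < K a a" if "a \<in> J" for a using that by (simp add: J_def)
  have r2: "(r a b)\<^sup>2 = (K a b)\<^sup>2 / (K a a * K b b)" if "a \<in> J" "b \<in> J" for a b
    using pos[OF that(1)] pos[OF that(2)] by (simp add: r_def power_divide power_mult_distrib)
  have "psd J r" unfolding psd_def
  proof (intro conjI ballI allI)
    show "r a b = r b a" if "a \<in> J" "b \<in> J" for a b using psd_sym[OF KJ that] by (simp add: r_def)
    fix w
    have eq: "(\<Sum>a\<in>J. \<Sum>b\<in>J. r a b * w a * w b)
      = (\<Sum>a\<in>J. \<Sum>b\<in>J. K a b * (w a / sqrt (K a a)) * (w b / sqrt (K b b)))"
      by (intro sum.cong refl) (simp add: r_def)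
    show "0 \<le> (\<Sum>a\<in>J. \<Sum>b\<in>J. r a b * w a * w b)" unfolding eq by (rule psd_form[OF KJ])
  qed
  moreover have "(r a b)\<^sup>2 \<le> 1" if "a \<in> J" "b \<in> J" for a b
    unfolding r2[OF that] using psd_pair[OF KJ finJ that] pos[OF that(1)] pos[OF that(2)] by simp
  ultimately have "0 \<le> (\<Sum>a\<in>J. \<Sum>b\<in>J. (1 - (if (r a b)\<^sup>2 < 1 then (1 - (r a b)\<^sup>2) powr \<alpha> else 0)) * v a * v b)"
    by (intro psd_one_minus_powr finJ \<alpha>)
  also have "\<dots> = (\<Sum>a\<in>J. \<Sum>b\<in>J. (ppow \<alpha> (K a a) * ppow \<alpha> (K b b)
      - ppow \<alpha> (K a a * K b b - (K a b)\<^sup>2)) * u a * u b)"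
  proof (intro sum.cong refl)
    fix a b assume ab: "a \<in> J" "b \<in> J"
    have p: "0 < K a a" "0 < K b b" using ab pos by auto
    have e: "K a a * K b b - (K a b)\<^sup>2 = K a a * (K b b * (1 - (r a b)\<^sup>2))"
      unfolding r2[OF ab] using p by (simp add: field_simps)
    have "ppow \<alpha> (1 - (r a b)\<^sup>2) = (if (r a b)\<^sup>2 < 1 then (1 - (r a b)\<^sup>2) powr \<alpha> else 0)"
      by (simp add: ppow_def)
    then show "(1 - (if (r a b)\<^sup>2 < 1 then (1 - (r a b)\<^sup>2) powr \<alpha> else 0)) * v a * v b
      = (ppow \<alpha> (K a a) * ppow \<alpha> (K b b) - ppow \<alpha> (K a a * K b b - (K a b)\<^sup>2)) * u a * u b"
      unfolding e ppow_mult[OF p(1)] ppow_mult[OF p(2)] v_def by (simp add: algebra_simps)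
  qed
  also have "\<dots> = (\<Sum>a\<in>I. \<Sum>b\<in>I. (ppow \<alpha> (K a a) * ppow \<alpha> (K b b)
      - ppow \<alpha> (K a a * K b b - (K a b)\<^sup>2)) * u a * u b)"
  proof -
    have z: "ppow \<alpha> (K a a) * ppow \<alpha> (K b b) - ppow \<alpha> (K a a * K b b - (K a b)\<^sup>2) = 0"
      if "a \<in> I" "b \<in> I" "a \<notin> J \<or> b \<notin> J" for a b
    proof -
      have "K a a = 0 \<or> K b b = 0"
        using that psd_diag[OF K fin that(1)] psd_diag[OF K fin that(2)] by (auto simp: J_def)
      then show ?thesis using zero_le_power2[of "K a b"] by (auto simp: ppow_def not_less)
    qed
    show ?thesis unfolding sum.cartesian_product
    proof (rule sum.mono_neutral_left)
      show "\<forall>p\<in>I \<times> I - J \<times> J. (case p of (a, b) \<Rightarrow> (ppow \<alpha> (K a a) * ppow \<alpha> (K b b)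
          - ppow \<alpha> (K a a * K b b - (K a b)\<^sup>2)) * u a * u b) = 0"
      proof
        fix p assume "p \<in> I \<times> I - J \<times> J"
        then obtain a b where p: "p = (a, b)" "a \<in> I" "b \<in> I" "a \<notin> J \<or> b \<notin> J" by auto
        show "(case p of (a, b) \<Rightarrow> (ppow \<alpha> (K a a) * ppow \<alpha> (K b b)
          - ppow \<alpha> (K a a * K b b - (K a b)\<^sup>2)) * u a * u b) = 0"
          unfolding p(1) prod.case z[OF p(2-4)] by simp
      qed
    qed (use fin JI in auto)
  qed
  finally show ?thesis .
qed

section \<open>Mixing of reversible chains from a modified log-Sobolev inequality\<close>

text \<open>\<open>p_psd\<close> excludes negative eigenvalues and takes the place of laziness: it
  gives \<open>P^2 \<le> P\<close> as forms and underlies the square function estimate. Heat-bath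
  dynamics have it because every update is an orthogonal projection.\<close>

locale reversible_chain =
  fixes X :: "'s set" and \<mu> :: "'s \<Rightarrow> real" and p :: "'s \<Rightarrow> 's \<Rightarrow> real"
  assumes finX: "finite X"
    and mu_pos: "\<And>x. x \<in> X \<Longrightarrow> 0 < \<mu> x" and mu_sum: "(\<Sum>x\<in>X. \<mu> x) = 1"
    and p_nonneg: "\<And>x y. x \<in> X \<Longrightarrow> y \<in> X \<Longrightarrow> 0 \<le> p x y"
    and p_sum: "\<And>x. x \<in> X \<Longrightarrow> (\<Sum>y\<in>X. p x y) = 1"
    and rev: "\<And>x y. x \<in> X \<Longrightarrow> y \<in> X \<Longrightarrow> \<mu> x * p x y = \<mu> y * p y x"
    and p_psd: "\<And>f. 0 \<le> (\<Sum>x\<in>X. \<Sum>y\<in>X. \<mu> x * p x y * f x * f y)"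
begin

text \<open>The value 0 outside \<open>X\<close> makes \<open>P f\<close>, as a function on the
  whole type, depend only on the values of \<open>f\<close> on \<open>X\<close>.\<close>

definition P :: "('s \<Rightarrow> real) \<Rightarrow> 's \<Rightarrow> real" where
  "P f x = (if x \<in> X then \<Sum>y\<in>X. p x y * f y else 0)"

definition ip :: "('s \<Rightarrow> real) \<Rightarrow> ('s \<Rightarrow> real) \<Rightarrow> real" where
  "ip f g = (\<Sum>x\<in>X. \<mu> x * f x * g x)"

lemma P_add: "P (\<lambda>x. f x + g x) x = P f x + P g x"
  by (simp add: P_def distrib_left sum.distrib)

lemma P_diff: "P (\<lambda>x. f x - g x) x = P f x - P g x"
  by (simp add: P_def right_diff_distrib sum_subtractf)

lemma P_cong: "(\<And>x. x \<in> X \<Longrightarrow> f x = g x) \<Longrightarrow> P f = P g"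
  unfolding P_def fun_eq_iff by (auto intro!: sum.cong)

lemma P_mono: "(\<And>x. x \<in> X \<Longrightarrow> f x \<le> g x) \<Longrightarrow> P f x \<le> P g x"
  unfolding P_def by (auto intro!: sum_mono mult_left_mono p_nonneg)

lemma P_const: "x \<in> X \<Longrightarrow> P (\<lambda>_. c) x = c"
  by (simp add: P_def sum_distrib_right[symmetric] p_sum)

lemma P_nonneg: "(\<And>x. x \<in> X \<Longrightarrow> 0 \<le> f x) \<Longrightarrow> 0 \<le> P f x"
  unfolding P_def by (auto intro!: sum_nonneg mult_nonneg_nonneg p_nonneg)

lemma Pk_diff: "(P ^^ k) (\<lambda>x. f x - g x) = (\<lambda>x. (P ^^ k) f x - (P ^^ k) g x)"
  by (induction k) (auto simp: P_diff)

lemma Pk_nonneg: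
  assumes "\<And>x. x \<in> X \<Longrightarrow> 0 \<le> f x" "x \<in> X"
  shows "0 \<le> (P ^^ k) f x"
  using assms(2) by (induction k arbitrary: x) (auto intro: assms(1) P_nonneg)

lemma Pk_abs_le:
  assumes "\<And>x. x \<in> X \<Longrightarrow> \<bar>f x\<bar> \<le> g x" "x \<in> X"
  shows "\<bar>(P ^^ k) f x\<bar> \<le> (P ^^ k) g x"
  using assms(2)
proof (induction k arbitrary: x)
  case (Suc k)
  have "\<bar>P ((P ^^ k) f) x\<bar> \<le> (\<Sum>y\<in>X. \<bar>p x y * (P ^^ k) f y\<bar>)"
    unfolding P_def[of "(P ^^ k) f"] using Suc.prems by simp
  also have "\<dots> \<le> (\<Sum>y\<in>X. p x y * (P ^^ k) g y)"
    by (intro sum_mono) (use Suc p_nonneg in \<open>auto simp: abs_mult intro!: mult_left_mono\<close>)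
  finally show ?case using Suc.prems by (simp add: P_def[of "(P ^^ k) g"])
qed (use assms(1) in auto)

lemma Pk_const: "x \<in> X \<Longrightarrow> (P ^^ k) (\<lambda>_. c) x = c"
proof (induction k arbitrary: x)
  case (Suc k)
  have "P ((P ^^ k) (\<lambda>_. c)) = P (\<lambda>_. c)" by (rule P_cong) (use Suc in auto)
  then show ?case using P_const Suc.prems by simp
qed simp

lemma Pk_bounded:
  assumes "\<And>x. x \<in> X \<Longrightarrow> \<bar>f x\<bar> \<le> c" "x \<in> X"
  shows "\<bar>(P ^^ k) f x\<bar> \<le> c"
  using Pk_abs_le[of f "\<lambda>_. c" x k] Pk_const[of x k c] assms by simp

lemma ip_commute: "ip f g = ip g f"
  by (simp add: ip_def mult_ac)

lemma ip_P: "ip f (P g) = (\<Sum>x\<in>X. \<Sum>y\<in>X. \<mu> x * p x y * f x * g y)"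
  unfolding ip_def P_def by (intro sum.cong refl) (auto simp: sum_distrib_left mult_ac)

lemma P_adjoint: "ip (P f) g = ip f (P g)"
proof -
  have "ip (P f) g = (\<Sum>x\<in>X. \<Sum>y\<in>X. \<mu> x * p x y * g x * f y)"
    unfolding ip_commute[of "P f"] by (rule ip_P)
  also have "\<dots> = (\<Sum>y\<in>X. \<Sum>x\<in>X. \<mu> x * p x y * g x * f y)" by (rule sum.swap)
  also have "\<dots> = ip f (P g)" unfolding ip_P by (intro sum.cong refl) (simp add: rev)
  finally show ?thesis .
qed

lemma Pk_adjoint: "ip ((P ^^ k) f) g = ip f ((P ^^ k) g)"
proof (induction k arbitrary: g)
  case (Suc k)
  have "(P ^^ Suc k) g = (P ^^ k) (P g)" by (simp only: funpow_Suc_right o_apply)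
  then show ?case using Suc[of "P g"] by (simp add: P_adjoint)
qed simp

lemma ip_nonneg: "0 \<le> ip f f"
  unfolding ip_def using mu_pos by (intro sum_nonneg) (auto simp: mult.assoc less_imp_le)

lemma ip_diff_self: "ip (\<lambda>x. f x - g x) (\<lambda>x. f x - g x) = ip f f - 2 * ip f g + ip g g"
  unfolding ip_def sum_distrib_left sum_subtractf[symmetric] sum.distrib[symmetric]
  by (intro sum.cong refl) (simp add: algebra_simps)

lemma ip_P_nonneg: "0 \<le> ip f (P f)"
  unfolding ip_P by (rule p_psd)

lemma ip_P_eq_edges: "ip f f - ip f (P f) = (\<Sum>x\<in>X. \<Sum>y\<in>X. \<mu> x * p x y * (f x - f y)\<^sup>2) / 2"
proof -
  have a: "(\<Sum>x\<in>X. \<Sum>y\<in>X. \<mu> x * p x y * (f x)\<^sup>2) = ip f f"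
    unfolding ip_def
  proof (intro sum.cong refl)
    fix x assume "x \<in> X"
    have "(\<Sum>y\<in>X. \<mu> x * p x y * (f x)\<^sup>2) = \<mu> x * (f x)\<^sup>2 * (\<Sum>y\<in>X. p x y)"
      unfolding sum_distrib_left by (intro sum.cong refl) simp
    then show "(\<Sum>y\<in>X. \<mu> x * p x y * (f x)\<^sup>2) = \<mu> x * f x * f x"
      using p_sum[OF \<open>x \<in> X\<close>] by (simp add: power2_eq_square)
  qed
  have "(\<Sum>x\<in>X. \<Sum>y\<in>X. \<mu> x * p x y * (f y)\<^sup>2) = (\<Sum>y\<in>X. \<Sum>x\<in>X. \<mu> x * p x y * (f y)\<^sup>2)"
    by (rule sum.swap)
  also have "\<dots> = (\<Sum>x\<in>X. \<Sum>y\<in>X. \<mu> x * p x y * (f x)\<^sup>2)"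
    by (intro sum.cong refl) (metis rev)
  also note a
  finally have b: "(\<Sum>x\<in>X. \<Sum>y\<in>X. \<mu> x * p x y * (f y)\<^sup>2) = ip f f" .
  have "(\<Sum>x\<in>X. \<Sum>y\<in>X. \<mu> x * p x y * (f x - f y)\<^sup>2)
    = (\<Sum>x\<in>X. \<Sum>y\<in>X. \<mu> x * p x y * (f x)\<^sup>2) - 2 * (\<Sum>x\<in>X. \<Sum>y\<in>X. \<mu> x * p x y * f x * f y)
      + (\<Sum>x\<in>X. \<Sum>y\<in>X. \<mu> x * p x y * (f y)\<^sup>2)"
  proof -
    have "(\<Sum>y\<in>X. \<mu> x * p x y * (f x - f y)\<^sup>2) = (\<Sum>y\<in>X. \<mu> x * p x y * (f x)\<^sup>2)
       - 2 * (\<Sum>y\<in>X. \<mu> x * p x y * f x * f y) + (\<Sum>y\<in>X. \<mu> x * p x y * (f y)\<^sup>2)" for x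
      unfolding sum_distrib_left sum_subtractf[symmetric] sum.distrib[symmetric]
      by (intro sum.cong refl) (simp add: power2_eq_square algebra_simps)
    then show ?thesis by (simp only: sum.distrib sum_subtractf sum_distrib_left[symmetric])
  qed
  then show ?thesis unfolding a b unfolding ip_P by simp
qed

lemma ip_P_le: "ip f (P f) \<le> ip f f"
proof -
  have "0 \<le> (\<Sum>x\<in>X. \<Sum>y\<in>X. \<mu> x * p x y * (f x - f y)\<^sup>2)"
    using mu_pos p_nonneg by (intro sum_nonneg mult_nonneg_nonneg) (auto simp: less_imp_le)
  then show ?thesis using ip_P_eq_edges[of f] by simp
qed

text \<open>That is \<open>P^2 \<le> P\<close>: semidefiniteness at \<open>f - P f\<close>, combined
  with \<open>P \<le> I\<close> at \<open>P f\<close>.\<close>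

lemma ip_P_P_le: "ip (P f) (P f) \<le> ip f (P f)"
proof -
  have "0 \<le> ip (\<lambda>x. f x - P f x) (P (\<lambda>x. f x - P f x))" by (rule ip_P_nonneg)
  also have "P (\<lambda>x. f x - P f x) = (\<lambda>x. P f x - P (P f) x)" by (rule ext) (rule P_diff)
  also have "ip (\<lambda>x. f x - P f x) (\<lambda>x. P f x - P (P f) x)
    = ip f (P f) - ip f (P (P f)) - ip (P f) (P f) + ip (P f) (P (P f))"
    unfolding ip_def sum_subtractf[symmetric] sum.distrib[symmetric]
    by (intro sum.cong refl) (simp add: algebra_simps)
  also have "ip f (P (P f)) = ip (P f) (P f)" by (rule P_adjoint[symmetric])
  finally show ?thesis using ip_P_le[of "P f"] by simp
qed

lemma ip_Pk: "ip ((P ^^ i) f) ((P ^^ j) f) = ip f ((P ^^ (i + j)) f)"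
  by (simp add: Pk_adjoint funpow_add)

lemma mean_Pk: "(\<Sum>x\<in>X. \<mu> x * (P ^^ k) f x) = (\<Sum>x\<in>X. \<mu> x * f x)"
proof -
  have "(\<Sum>x\<in>X. \<mu> x * (P ^^ k) f x) = ip (\<lambda>_. 1) ((P ^^ k) f)" by (simp add: ip_def)
  also have "\<dots> = ip ((P ^^ k) (\<lambda>_. 1)) f" by (rule Pk_adjoint[symmetric])
  also have "\<dots> = (\<Sum>x\<in>X. \<mu> x * f x)" unfolding ip_def by (intro sum.cong refl) (simp add: Pk_const)
  finally show ?thesis .
qed

text \<open>The square function estimate, by summation by parts: \<open>a k = \<langle>h, P\<^sup>k h\<rangle>\<close> has non-negative second
  differences, and its even ones are the squared norms on the left.\<close>

lemma square_function:
  "(\<Sum>j<N. (2 * real j + 1) * ip (\<lambda>x. (P ^^ j) h x - (P ^^ Suc j) h x) (\<lambda>x. (P ^^ j) h x - (P ^^ Suc j) h x)) \<le> ip h h"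
proof -
  define a where "a k = ip h ((P ^^ k) h)" for k
  define d where "d k = a k - 2 * a (k+1) + a (k+2)" for k
  have aa: "ip ((P ^^ i) h) ((P ^^ j) h) = a (i + j)" for i j unfolding a_def by (rule ip_Pk)
  have idx: "j + j = 2 * j" "j + Suc j = 2 * j + 1" "2 * Suc j = 2 * j + 2"
    "j + Suc (Suc j) = 2 * j + 2" "Suc j + Suc (Suc j) = 2 * j + 3" for j :: nat by auto
  have ev: "ip (\<lambda>x. (P ^^ j) h x - (P ^^ Suc j) h x) (\<lambda>x. (P ^^ j) h x - (P ^^ Suc j) h x) = d (2*j)" for j
    by (simp only: ip_diff_self aa idx d_def)
  have d0: "0 \<le> d (2*j)" for j unfolding ev[symmetric] by (rule ip_nonneg)
  have d1: "0 \<le> d (2*j+1)" for j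
  proof -
    define g where "g = (\<lambda>x. (P ^^ j) h x - (P ^^ Suc j) h x)"
    have "P g = (\<lambda>x. (P ^^ Suc j) h x - (P ^^ Suc (Suc j)) h x)" 
      unfolding g_def by (rule ext) (simp only: P_diff funpow.simps o_apply)
    then have "ip g (P g) = ip ((P ^^ j) h) ((P ^^ Suc j) h) - ip ((P ^^ j) h) ((P ^^ Suc (Suc j)) h)
       - ip ((P ^^ Suc j) h) ((P ^^ Suc j) h) + ip ((P ^^ Suc j) h) ((P ^^ Suc (Suc j)) h)"
      unfolding g_def ip_def sum_subtractf[symmetric] sum.distrib[symmetric]
      by (intro sum.cong refl) (simp add: algebra_simps)
    also have "\<dots> = a (2*j+1) - a (2*j+2) - a (2*j+2) + a (2*j+2+1)" by (simp only: aa idx)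
    also have "\<dots> = d (2*j+1)" by (simp add: d_def eval_nat_numeral)
    finally show ?thesis using ip_P_nonneg[of g] by simp
  qed
  \<comment> \<open>The weights \<open>k + 1\<close> make the sum of second differences telescope.
    Of these non-negative terms only those of even index are kept, where
    \<open>k + 1 = 2 * j + 1\<close>.\<close>
  have tele: "(\<Sum>k<n. (real k + 1) * d k) = a 0 - (real n + 1) * a n + real n * a (n+1)" for n
  proof (induction n)
    case (Suc n)
    have "a (n + 2) = a (Suc n + 1)" by simp
    with Suc show ?case by (simp add: d_def algebra_simps)
  qed simp
  have "(\<Sum>j<N. (2 * real j + 1) * d (2*j)) \<le> (\<Sum>k<2*N. (real k + 1) * d k)"
  proof (induction N)
    case (Suc N)
    have "(\<Sum>k<2*Suc N. (real k + 1) * d k) = (\<Sum>k<2*N. (real k + 1) * d k)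
      + (2 * real N + 1) * d (2*N) + (2 * real N + 2) * d (2*N+1)" by simp
    moreover have "0 \<le> (2 * real N + 2) * d (2*N+1)" using d1[of N] by simp
    ultimately show ?case using Suc.IH unfolding sum.lessThan_Suc[of _ N] by linarith
  qed simp
  also have "\<dots> = a 0 - a (2*N) - real (2*N) * (a (2*N) - a (2*N+1))"
    unfolding tele by (simp add: algebra_simps)
  also have "\<dots> \<le> a 0"
  proof -
    have "a (2*N) = ip ((P ^^ N) h) ((P ^^ N) h)" by (simp only: aa idx)
    moreover have "a (2*N+1) = ip ((P ^^ N) h) (P ((P ^^ N) h))"
      using aa[of N "Suc N"] by (simp only: idx funpow.simps o_apply)
    ultimately have "0 \<le> a (2*N)" "a (2*N+1) \<le> a (2*N)"
      using ip_nonneg[of "(P ^^ N) h"] ip_P_le[of "(P ^^ N) h"] by linarith+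
    then have "0 \<le> real (2*N) * (a (2*N) - a (2*N+1))" by (intro mult_nonneg_nonneg) auto
    with \<open>0 \<le> a (2*N)\<close> show ?thesis by linarith
  qed
  finally show ?thesis unfolding ev by (simp add: a_def)
qed

lemma norm_Pk_le: "ip ((P ^^ k) h) ((P ^^ k) h) \<le> ip h h"
proof (induction k)
  case (Suc k)
  then show ?case using ip_P_P_le[of "(P ^^ k) h"] ip_P_le[of "(P ^^ k) h"] by simp
qed simp

text \<open>On the window from \<open>r\<close> to \<open>2 * r\<close>, \<open>P^k h\<close>
  differs from \<open>P^r h\<close> by at most \<open>r\<close> increments. Cauchy-Schwarz costs a
  factor \<open>r\<close>, which is paid by the weights \<open>2 * j + 1 > 2 * r\<close> of the
  square function. The constant 3 is 2 for \<open>P^r h\<close> plus 2 times 1/2 for the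
  increments.\<close>

lemma maximal_inequality:
  assumes r: "1 \<le> r" and e: "0 < \<epsilon>"
  shows "(\<Sum>x\<in>{x\<in>X. \<exists>k\<in>{r..2*r}. \<epsilon> < \<bar>(P ^^ k) h x\<bar>}. \<mu> x) * \<epsilon>\<^sup>2 \<le> 3 * ip h h"
proof -
  define D where "D j x = (P ^^ j) h x - (P ^^ Suc j) h x" for j x
  define M where "M x = (\<Sum>j\<in>{r..<2*r}. \<bar>D j x\<bar>)" for x
  define B where "B = {x\<in>X. \<exists>k\<in>{r..2*r}. \<epsilon> < \<bar>(P ^^ k) h x\<bar>}"
  have bound: "\<bar>(P ^^ k) h x\<bar> \<le> \<bar>(P ^^ r) h x\<bar> + M x" if k: "k \<in> {r..2*r}" for k x
  proof -
    have "(P ^^ r) h x - (P ^^ k) h x = (\<Sum>j\<in>{r..<k}. D j x)"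
    proof -
      have "r \<le> k" using k by simp
      then show ?thesis by (induction k rule: dec_induct) (auto simp: D_def)
    qed
    then have "\<bar>(P ^^ k) h x\<bar> \<le> \<bar>(P ^^ r) h x\<bar> + (\<Sum>j\<in>{r..<k}. \<bar>D j x\<bar>)"
      using sum_abs[of "\<lambda>j. D j x" "{r..<k}"] by linarith
    also have "(\<Sum>j\<in>{r..<k}. \<bar>D j x\<bar>) \<le> M x"
      unfolding M_def using k by (intro sum_mono2) auto
    finally show ?thesis by simp
  qed
  have M2: "(M x)\<^sup>2 \<le> real r * (\<Sum>j\<in>{r..<2*r}. (D j x)\<^sup>2)" for x
  proof -
    have "(\<Sum>j\<in>{r..<2*r}. 1 * \<bar>D j x\<bar>)\<^sup>2 \<le> (\<Sum>j\<in>{r..<2*r}. 1\<^sup>2) * (\<Sum>j\<in>{r..<2*r}. \<bar>D j x\<bar>\<^sup>2)"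
      by (rule Cauchy_Schwarz_ineq_sum)
    then show ?thesis unfolding M_def by simp
  qed
  have "(\<Sum>x\<in>X. \<mu> x * (M x)\<^sup>2) \<le> (\<Sum>x\<in>X. \<mu> x * (real r * (\<Sum>j\<in>{r..<2*r}. (D j x)\<^sup>2)))"
    using mu_pos by (intro sum_mono mult_left_mono M2) (auto simp: less_imp_le)
  also have "\<dots> = (\<Sum>x\<in>X. \<Sum>j\<in>{r..<2*r}. real r * (\<mu> x * D j x * D j x))"
    by (simp add: sum_distrib_left power2_eq_square mult_ac)
  also have "\<dots> = (\<Sum>j\<in>{r..<2*r}. real r * ip (D j) (D j))"
    unfolding ip_def sum_distrib_left by (rule sum.swap)
  also have "\<dots> \<le> (\<Sum>j\<in>{r..<2*r}. (2 * real j + 1) * ip (D j) (D j) / 2)"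
  proof (rule sum_mono)
    fix j assume "j \<in> {r..<2*r}"
    then have "real r \<le> (2 * real j + 1) / 2" by simp
    from mult_right_mono[OF this ip_nonneg[of "D j"]]
    show "real r * ip (D j) (D j) \<le> (2 * real j + 1) * ip (D j) (D j) / 2" by simp
  qed
  also have "\<dots> \<le> (\<Sum>j<2*r. (2 * real j + 1) * ip (D j) (D j) / 2)"
    using ip_nonneg by (intro sum_mono2) auto
  also have "\<dots> \<le> ip h h / 2"
    using square_function[where N="2*r" and h=h] unfolding D_def sum_divide_distrib[symmetric] by simp
  finally have Msum: "(\<Sum>x\<in>X. \<mu> x * (M x)\<^sup>2) \<le> ip h h / 2" .
  have "(\<Sum>x\<in>B. \<mu> x) * \<epsilon>\<^sup>2 = (\<Sum>x\<in>B. \<mu> x * \<epsilon>\<^sup>2)" by (simp add: sum_distrib_right)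
  also have "\<dots> \<le> (\<Sum>x\<in>B. \<mu> x * (2 * ((P ^^ r) h x)\<^sup>2 + 2 * (M x)\<^sup>2))"
  proof (rule sum_mono)
    fix x assume x: "x \<in> B"
    then obtain k where k: "k \<in> {r..2*r}" "\<epsilon> < \<bar>(P ^^ k) h x\<bar>" by (auto simp: B_def)
    have "\<epsilon>\<^sup>2 \<le> (\<bar>(P ^^ r) h x\<bar> + M x)\<^sup>2" using bound[OF k(1), of x] k(2) e by (intro power_mono) auto
    also have "\<dots> \<le> 2 * ((P ^^ r) h x)\<^sup>2 + 2 * (M x)\<^sup>2"
      using zero_le_power2[of "\<bar>(P ^^ r) h x\<bar> - M x"] by (simp add: power2_eq_square algebra_simps)
    finally show "\<mu> x * \<epsilon>\<^sup>2 \<le> \<mu> x * (2 * ((P ^^ r) h x)\<^sup>2 + 2 * (M x)\<^sup>2)"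
      using x mu_pos[of x] by (intro mult_left_mono) (auto simp: B_def)
  qed
  also have "\<dots> \<le> (\<Sum>x\<in>X. \<mu> x * (2 * ((P ^^ r) h x)\<^sup>2 + 2 * (M x)\<^sup>2))"
    using finX mu_pos by (intro sum_mono2) (auto simp: B_def less_imp_le)
  also have "\<dots> = 2 * ip ((P ^^ r) h) ((P ^^ r) h) + 2 * (\<Sum>x\<in>X. \<mu> x * (M x)\<^sup>2)"
    unfolding ip_def sum_distrib_left sum.distrib[symmetric]
    by (intro sum.cong refl) (simp add: power2_eq_square algebra_simps)
  also have "\<dots> \<le> 3 * ip h h" using norm_Pk_le[of r h] Msum by simp
  finally show ?thesis unfolding B_def .
qed

text \<open>Exit from \<open>B\<close>: the Green function killed outside \<open>B\<close> is largest at its pole, so a bound on the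
  effective resistance from every point of \<open>B\<close> to the complement bounds the expected exit time from
  every starting point, irrespective of how small its stationary mass is.\<close>

lemma exit_bound:
  fixes W c :: real and K J :: nat
  assumes B: "B \<subseteq> X" and W: "0 \<le> W"
    and res: "\<And>x u. x \<in> B \<Longrightarrow> (\<And>z. z \<in> X - B \<Longrightarrow> u z = 0) \<Longrightarrow> \<mu> x * (u x)\<^sup>2 \<le> W * (ip u u - ip u (P u))"
    and f: "\<And>x. x \<in> X \<Longrightarrow> \<bar>f x\<bar> \<le> 1" and c: "0 \<le> c"
    and good: "\<And>y j. y \<in> X - B \<Longrightarrow> \<bar>(P ^^ (K + j)) f y\<bar> \<le> c"
    and x: "x \<in> X" and J: "1 \<le> J"
  shows "\<bar>(P ^^ (K + J)) f x\<bar> \<le> c + card B * W / J"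
proof -
  \<comment> \<open>\<open>Q\<close> is the chain killed on leaving \<open>B\<close>,
    \<open>h k\<close> the probability of staying in \<open>B\<close> up to time \<open>k\<close>,
    and \<open>u z k\<close> below the Green function with pole \<open>z\<close> truncated at
    \<open>k\<close> steps, each as a function of the starting point.\<close>
  define Q where "Q = (\<lambda>(g::'s \<Rightarrow> real) x. if x \<in> B then P g x else 0)"
  define v where "v z k = (Q ^^ k) (\<lambda>x. if x = z then 1 else 0)" for z k
  define h where "h k = (Q ^^ k) (\<lambda>x. if x \<in> B then 1 else 0)" for k
  have finB: "finite B" using B finX finite_subset by blast
  have Q_nonneg: "0 \<le> Q g x" if "\<And>y. y \<in> X \<Longrightarrow> 0 \<le> g y" for g x
    unfolding Q_def using P_nonneg[OF that] by simp
  have Q_mono: "Q g x \<le> Q g' x" if "\<And>y. y \<in> X \<Longrightarrow> g y \<le> g' y" for g g' x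
    unfolding Q_def using P_mono[OF that] by simp
  have Q_sum: "Q (\<lambda>x. \<Sum>i\<in>I. g i x) x = (\<Sum>i\<in>I. Q (g i) x)" for I :: "'b set" and g x
    unfolding Q_def P_def by (auto simp: sum_distrib_left sum.swap[of _ X])
  have v_Suc: "v z (Suc k) = Q (v z k)" for z k by (simp add: v_def)
  have v0: "0 \<le> v z k y" for z k y
    by (induction k arbitrary: y) (auto simp: v_def intro!: Q_nonneg)
  have vout: "v z k y = 0" if "z \<in> B" "y \<notin> B" for z k y
    using that by (cases k) (auto simp: v_def Q_def)
  define u where "u z k y = (\<Sum>i<k. v z i y)" for z k y
  have u0: "0 \<le> u z k y" for z k y unfolding u_def by (intro sum_nonneg v0)
  have u_Suc: "u z (Suc k) y = (if y = z then 1 else 0) + Q (u z k) y" for z k y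
  proof -
    have "u z (Suc k) y = v z 0 y + (\<Sum>i<k. v z (Suc i) y)" unfolding u_def by (rule sum.lessThan_Suc_shift)
    moreover have "Q (u z k) y = (\<Sum>i<k. v z (Suc i) y)" unfolding u_def v_Suc by (rule Q_sum)
    ultimately show ?thesis by (simp add: v_def)
  qed
  have u_mono: "u z k y \<le> u z (Suc k) y" for z k y unfolding u_def using v0 by simp
  \<comment> \<open>Maximum principle: away from the pole, \<open>u\<close> is 0 or an average of
    values of the preceding truncation.\<close>
  have u_max: "u z k y \<le> u z k z" if z: "z \<in> B" and y: "y \<in> X" for z k y
    using y
  proof (induction k arbitrary: y)
    case (Suc k)
    show ?case
    proof (cases "y = z")
      case False
      have "u z (Suc k) y = Q (u z k) y" using False by (simp add: u_Suc)
      also have "\<dots> \<le> Q (\<lambda>_. u z k z) y" by (rule Q_mono) (rule Suc.IH)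
      also have "\<dots> \<le> u z k z" using Suc.prems u0 by (auto simp: Q_def P_const)
      also have "\<dots> \<le> u z (Suc k) z" by (rule u_mono)
      finally show ?thesis .
    qed simp
  qed (simp add: u_def)
  have u_le: "u z k y \<le> W" if z: "z \<in> B" and y: "y \<in> X" for z k y
  proof -
    have zX: "z \<in> X" using z B by blast
    have out: "u z k y = 0" if "y \<notin> B" for y unfolding u_def using vout[OF z that] by simp
    have "ip (u z k) (u z k) - ip (u z k) (P (u z k)) = (\<Sum>y\<in>X. \<mu> y * u z k y * (u z k y - P (u z k) y))"
      unfolding ip_def sum_subtractf[symmetric] by (intro sum.cong refl) (simp add: algebra_simps)
    also have "\<dots> \<le> (\<Sum>y\<in>X. if y = z then \<mu> z * u z k z else 0)"
    proof (rule sum_mono)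
      fix y assume y: "y \<in> X"
      show "\<mu> y * u z k y * (u z k y - P (u z k) y) \<le> (if y = z then \<mu> z * u z k z else 0)"
      proof (cases "y \<in> B")
        case True
        then have "P (u z k) y = u z (Suc k) y - (if y = z then 1 else 0)" by (simp add: u_Suc Q_def)
        then have "u z k y - P (u z k) y \<le> (if y = z then 1 else 0)" using u_mono[of z k y] by simp
        then have "\<mu> y * u z k y * (u z k y - P (u z k) y) \<le> \<mu> y * u z k y * (if y = z then 1 else 0)"
          using mu_pos[OF y] u0[of z k y] by (intro mult_left_mono) auto
        then show ?thesis by (auto split: if_splits)
      next
        case False
        then show ?thesis using out z by auto
      qed
    qed
    also have "\<dots> = \<mu> z * u z k z" using finX zX by simp
    \<comment> \<open>The resistance hypothesis is tested on the Green function itself, whose energy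
      is at most \<open>\<mu> z * u z k z\<close>; the stationary mass of the pole then
      cancels.\<close>
    finally have "\<mu> z * (u z k z)\<^sup>2 \<le> W * (\<mu> z * u z k z)"
      using order_trans[OF res[OF z, of "u z k"] mult_left_mono[OF _ W]] out by blast
    then have "\<mu> z * (u z k z * u z k z) \<le> \<mu> z * (W * u z k z)" by (simp add: power2_eq_square mult_ac)
    then have "u z k z * u z k z \<le> W * u z k z" using mu_pos[OF zX] by simp
    then have "u z k z \<le> W" using u0[of z k z] W by (cases "u z k z = 0") auto
    then show ?thesis using u_max[OF z y, of k] by simp
  qed
  have h_eq: "h k y = (\<Sum>z\<in>B. v z k y)" for k y
  proof (induction k arbitrary: y)
    case 0
    then show ?case using finB by (simp add: h_def v_def)
  next
    case (Suc k)
    have "h (Suc k) y = Q (h k) y" by (simp add: h_def)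
    also have "h k = (\<lambda>y. \<Sum>z\<in>B. v z k y)" using Suc by (rule ext)
    finally show ?case by (simp only: Q_sum v_Suc)
  qed
  have h_decr: "h (Suc k) y \<le> h k y" if "y \<in> X" for k y
    using that
  proof (induction k arbitrary: y)
    case 0
    have "P (\<lambda>x. if x \<in> B then 1 else 0) y \<le> P (\<lambda>_. 1) y" by (rule P_mono) simp
    then show ?case using P_const[OF 0] by (simp add: h_def Q_def)
  next
    case (Suc k)
    have "Q (h (Suc k)) y \<le> Q (h k) y" by (rule Q_mono) (rule Suc.IH)
    then show ?case by (simp add: h_def)
  qed
  have h_anti: "h J x \<le> h k x" if "k \<le> J" for k
    using that
  proof (induction J rule: dec_induct)
    case (step n)
    then show ?case using h_decr[OF x, of n] by simp
  qed simp
  \<comment> \<open>Survival decreases with time, so \<open>J\<close> times its last value is at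
    most the expected time spent in \<open>B\<close>, which is the sum of the Green functions over
    their poles.\<close>
  have "real J * h J x = (\<Sum>k<J. h J x)" by simp
  also have "\<dots> \<le> (\<Sum>k<J. h k x)" by (intro sum_mono h_anti) simp
  also have "\<dots> = (\<Sum>z\<in>B. u z J x)" unfolding h_eq u_def by (rule sum.swap)
  also have "\<dots> \<le> (\<Sum>z\<in>B. W)" by (intro sum_mono u_le x)
  finally have hJ: "h J x \<le> card B * W / J" using J by (simp add: field_simps)
  have "\<bar>(P ^^ (K + j)) f x\<bar> \<le> c + h j x" if "x \<in> X" for j x
    using that
  proof (induction j arbitrary: x)
    case 0
    show ?case
    proof (cases "x \<in> B")
      case True
      have "\<bar>(P ^^ K) f x\<bar> \<le> 1" by (rule Pk_bounded[OF f 0])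
      then show ?thesis using True c by (simp add: h_def)
    next
      case False
      then show ?thesis using good[of x 0] 0 by (simp add: h_def)
    qed
  next
    case (Suc j)
    show ?case
    proof (cases "x \<in> B")
      case True
      have "\<bar>(P ^^ 1) ((P ^^ (K + j)) f) x\<bar> \<le> (P ^^ 1) (\<lambda>y. c + h j y) x"
        by (rule Pk_abs_le) (use Suc in auto)
      then have "\<bar>P ((P ^^ (K + j)) f) x\<bar> \<le> P (\<lambda>y. c + h j y) x" by simp
      also have "\<dots> = c + Q (h j) x" using True Suc.prems P_add[of "\<lambda>_. c" "h j" x] P_const
        by (simp add: Q_def)
      finally show ?thesis by (simp add: h_def)
    next
      case False
      then show ?thesis using good[of x "Suc j"] Suc.prems by (simp add: h_def Q_def)
    qed
  qed
  from this[OF x, of J] hJ show ?thesis by simp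
qed

end

locale log_sobolev_chain = reversible_chain X \<mu> p
  for X :: "'s set" and \<mu> :: "'s \<Rightarrow> real" and p :: "'s \<Rightarrow> 's \<Rightarrow> real" +
  fixes \<Lambda> :: real
  assumes Lam: "1 \<le> \<Lambda>"
    and poincare: "\<And>f. (\<Sum>x\<in>X. \<mu> x * f x) = 0 \<Longrightarrow> ip f f \<le> \<Lambda> * (ip f f - ip f (P f))"
    and log_sobolev: "\<And>f. (\<And>x. x \<in> X \<Longrightarrow> 0 < f x) \<Longrightarrow> (\<Sum>x\<in>X. \<mu> x * f x) = 1 \<Longrightarrow>
      (\<Sum>x\<in>X. \<mu> x * f x * ln (f x)) \<le> \<Lambda> * (\<Sum>x\<in>X. \<mu> x * (f x - P f x) * ln (f x))"
begin

lemma norm_decay: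
  assumes "(\<Sum>x\<in>X. \<mu> x * f x) = 0"
  shows "ip ((P ^^ k) f) ((P ^^ k) f) \<le> (1 - 1 / \<Lambda>) ^ k * ip f f"
proof (induction k)
  case (Suc k)
  define g where "g = (P ^^ k) f"
  have "(\<Sum>x\<in>X. \<mu> x * g x) = 0" unfolding g_def mean_Pk using assms .
  from poincare[OF this] have "ip g (P g) \<le> (1 - 1 / \<Lambda>) * ip g g"
    using Lam by (simp add: field_simps)
  then have "ip (P g) (P g) \<le> (1 - 1 / \<Lambda>) * ip g g" using ip_P_P_le[of g] by linarith
  also have "\<dots> \<le> (1 - 1 / \<Lambda>) * ((1 - 1 / \<Lambda>) ^ k * ip f f)"
    unfolding g_def by (rule mult_left_mono[OF Suc]) (use Lam in simp)
  finally show ?case by (simp add: g_def mult.assoc)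
qed simp

section \<open>Averages over geometric times\<close>

definition q :: real where "q = \<Lambda> / (1 + \<Lambda>)"

lemma q: "0 < q" "q < 1" "1 - q = 1 / (1 + \<Lambda>)" "q / (1 - q) = \<Lambda>"
  using Lam by (auto simp: q_def field_simps)

text \<open>The resolvent \<open>(I + \<Lambda> * (I - P))^-1\<close>, written as the expectation of
  \<open>P^k f\<close> at a geometric time \<open>k\<close>; \<open>q\<close> makes the mean
  \<open>q / (1 - q)\<close> of this time equal to \<open>\<Lambda>\<close>.\<close>

definition R :: "('s \<Rightarrow> real) \<Rightarrow> 's \<Rightarrow> real" where
  "R f x = (\<Sum>k. (1 - q) * q ^ k * (P ^^ k) f x)"

lemma R_sums:
  assumes "x \<in> X" shows "(\<lambda>k. (1 - q) * q ^ k * (P ^^ k) f x) sums R f x"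
proof -
  define c where "c = (\<Sum>x\<in>X. \<bar>f x\<bar>)"
  have "\<bar>f x\<bar> \<le> c" if "x \<in> X" for x
    unfolding c_def using finX that by (intro member_le_sum) auto
  then have b: "\<bar>(P ^^ k) f x\<bar> \<le> c" for k using Pk_bounded assms by blast
  have "summable (\<lambda>k. (1 - q) * c * q ^ k)"
    using q by (intro summable_mult summable_geometric) simp
  moreover have "norm ((1 - q) * q ^ k * (P ^^ k) f x) \<le> (1 - q) * c * q ^ k" for k
  proof -
    have "(1 - q) * q ^ k * \<bar>(P ^^ k) f x\<bar> \<le> (1 - q) * q ^ k * c"
      using b[of k] q(1,2) by (intro mult_left_mono) auto
    then show ?thesis using q(1,2) by (simp add: abs_mult mult_ac)
  qed
  ultimately have "summable (\<lambda>k. (1 - q) * q ^ k * (P ^^ k) f x)"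
    by (rule summable_comparison_test'[where N=0])
  then show ?thesis unfolding R_def by (rule summable_sums)
qed

lemma R_resolvent:
  assumes x: "x \<in> X" shows "f x - R f x = \<Lambda> * (R f x - P (R f) x)"
proof -
  have "(\<lambda>k. \<Sum>y\<in>X. p x y * ((1 - q) * q ^ k * (P ^^ k) f y)) sums (\<Sum>y\<in>X. p x y * R f y)"
    by (intro sums_sum sums_mult R_sums)
  moreover have "(\<Sum>y\<in>X. p x y * ((1 - q) * q ^ k * (P ^^ k) f y)) = (1 - q) * q ^ k * (P ^^ Suc k) f x" for k
  proof -
    have "(P ^^ Suc k) f x = (\<Sum>y\<in>X. p x y * (P ^^ k) f y)" using x by (simp add: P_def[of "(P ^^ k) f"])
    then show ?thesis by (simp only: sum_distrib_left) (intro sum.cong refl, simp)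
  qed
  moreover have "P (R f) x = (\<Sum>y\<in>X. p x y * R f y)" using x by (simp add: P_def)
  ultimately have "(\<lambda>k. (1 - q) * q ^ k * (P ^^ Suc k) f x) sums P (R f) x" by simp
  then have "(\<lambda>k. q * ((1 - q) * q ^ k * (P ^^ Suc k) f x)) sums (q * P (R f) x)" by (rule sums_mult)
  then have "(\<lambda>k. (1 - q) * q ^ Suc k * (P ^^ Suc k) f x) sums (q * P (R f) x)" by (simp add: mult_ac)
  then have "(\<lambda>k. (1 - q) * q ^ k * (P ^^ k) f x) sums (q * P (R f) x + (1 - q) * f x)"
    by (subst (asm) sums_Suc_iff) simp
  then have "R f x = q * P (R f) x + (1 - q) * f x" using R_sums[OF x, of f] sums_unique2 by blast
  then have "(1 + \<Lambda>) * R f x = (1 + \<Lambda>) * (q * P (R f) x + (1 - q) * f x)" by simp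
  also have "\<dots> = \<Lambda> * P (R f) x + f x"
    using q(3) Lam by (simp add: q_def distrib_left)
  finally show ?thesis by (simp add: algebra_simps)
qed

lemma R_pos:
  assumes f: "\<And>x. x \<in> X \<Longrightarrow> 0 < f x" and x: "x \<in> X" shows "0 < R f x"
proof -
  have s: "(\<lambda>k. if k = 0 then (1 - q) * f x else 0) sums ((1 - q) * f x)"
    using sums_single[of 0 "\<lambda>_. (1 - q) * f x"] by simp
  have le: "(if k = 0 then (1 - q) * f x else 0) \<le> (1 - q) * q ^ k * (P ^^ k) f x" for k
    using Pk_nonneg[of f x k] f x q(1,2) by (auto simp: less_imp_le)
  have "(1 - q) * f x \<le> R f x" by (rule sums_le[OF le s R_sums[OF x]])
  then show ?thesis using f[OF x] q(2) by (smt (verit) mult_pos_pos)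
qed

lemma mean_R: "(\<Sum>x\<in>X. \<mu> x * R f x) = (\<Sum>x\<in>X. \<mu> x * f x)"
proof -
  have "(\<Sum>x\<in>X. \<mu> x * f x) - (\<Sum>x\<in>X. \<mu> x * R f x) = (\<Sum>x\<in>X. \<mu> x * (f x - R f x))"
    by (simp add: right_diff_distrib sum_subtractf)
  also have "\<dots> = (\<Sum>x\<in>X. \<mu> x * (\<Lambda> * (R f x - P (R f) x)))"
    by (intro sum.cong refl) (simp add: R_resolvent)
  also have "\<dots> = \<Lambda> * ((\<Sum>x\<in>X. \<mu> x * R f x) - (\<Sum>x\<in>X. \<mu> x * (P ^^ 1) (R f) x))"
    by (simp add: right_diff_distrib sum_subtractf sum_distrib_left mult.left_commute)
  also have "\<dots> = 0" unfolding mean_Pk by simp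
  finally show ?thesis by simp
qed

lemma ip_R_sums: "(\<lambda>j. (1 - q) * q ^ j * ip g ((P ^^ j) f)) sums ip (R g) f"
proof -
  have "(\<lambda>j. \<Sum>x\<in>X. \<mu> x * ((1 - q) * q ^ j * (P ^^ j) g x) * f x) sums (\<Sum>x\<in>X. \<mu> x * R g x * f x)"
    by (intro sums_sum sums_mult2 sums_mult R_sums)
  moreover have "(\<Sum>x\<in>X. \<mu> x * ((1 - q) * q ^ j * (P ^^ j) g x) * f x) = (1 - q) * q ^ j * ip ((P ^^ j) g) f" for j
    unfolding ip_def sum_distrib_left by (intro sum.cong refl) simp
  ultimately show ?thesis by (simp add: ip_def[of "R g"] Pk_adjoint)
qed

text \<open>For \<open>g = R f\<close> the implicit step is
  \<open>f - g = \<Lambda> * (g - P g)\<close>. The inequality is applied at the end point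
  \<open>g\<close>, and convexity of \<open>x * ln x\<close> bounds the resulting sum by the entropy
  lost in the step.\<close>

lemma R_entropy:
  assumes f: "\<And>x. x \<in> X \<Longrightarrow> 0 < f x" and 1: "(\<Sum>x\<in>X. \<mu> x * f x) = 1"
  shows "2 * (\<Sum>x\<in>X. \<mu> x * R f x * ln (R f x)) \<le> (\<Sum>x\<in>X. \<mu> x * f x * ln (f x))"
proof -
  define g where "g = R f"
  have g: "0 < g x" if "x \<in> X" for x unfolding g_def using R_pos f that by blast
  have g1: "(\<Sum>x\<in>X. \<mu> x * g x) = 1" unfolding g_def mean_R by (rule 1)
  have "(\<Sum>x\<in>X. \<mu> x * g x * ln (g x)) \<le> \<Lambda> * (\<Sum>x\<in>X. \<mu> x * (g x - P g x) * ln (g x))"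
    by (rule log_sobolev[OF g g1])
  also have "\<dots> = (\<Sum>x\<in>X. \<mu> x * (f x - g x) * ln (g x))"
    unfolding sum_distrib_left g_def by (intro sum.cong refl) (simp add: R_resolvent)
  also have "\<dots> \<le> (\<Sum>x\<in>X. \<mu> x * (f x * ln (f x) - g x * ln (g x) - (f x - g x)))"
  proof (rule sum_mono)
    fix x assume x: "x \<in> X"
    have "(f x - g x) * ln (g x) \<le> f x * ln (f x) - g x * ln (g x) - (f x - g x)"
      using relative_entropy_term_ge[OF f[OF x] g[OF x]] by (simp add: algebra_simps)
    then show "\<mu> x * (f x - g x) * ln (g x) \<le> \<mu> x * (f x * ln (f x) - g x * ln (g x) - (f x - g x))"
      using mu_pos[OF x] by (simp add: mult.assoc)
  qed
  also have "\<dots> = (\<Sum>x\<in>X. \<mu> x * f x * ln (f x)) - (\<Sum>x\<in>X. \<mu> x * g x * ln (g x))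
      - ((\<Sum>x\<in>X. \<mu> x * f x) - (\<Sum>x\<in>X. \<mu> x * g x))"
    unfolding sum_subtractf[symmetric] by (intro sum.cong refl) (simp add: algebra_simps)
  finally show ?thesis unfolding 1 g1 by (simp add: g_def)
qed

text \<open>The Gibbs (Donsker-Varadhan) variational principle: the relative entropy of
  \<open>g\<close> with respect to the density \<open>exp (h x) / Z\<close> is non-negative.\<close>

lemma entropy_variational:
  assumes g: "\<And>x. x \<in> X \<Longrightarrow> 0 < g x" and g1: "(\<Sum>x\<in>X. \<mu> x * g x) = 1"
  shows "(\<Sum>x\<in>X. \<mu> x * g x * h x) \<le> (\<Sum>x\<in>X. \<mu> x * g x * ln (g x)) + ln (\<Sum>x\<in>X. \<mu> x * exp (h x))"
proof -
  define Z where "Z = (\<Sum>x\<in>X. \<mu> x * exp (h x))"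
  have ne: "X \<noteq> {}" using mu_sum by auto
  have Z: "0 < Z" unfolding Z_def by (intro sum_pos finX ne) (simp add: mu_pos)
  have "(\<Sum>x\<in>X. \<mu> x * (g x - exp (h x) / Z)) \<le> (\<Sum>x\<in>X. \<mu> x * (g x * (ln (g x) - (h x - ln Z))))"
  proof (intro sum_mono mult_left_mono)
    fix x assume x: "x \<in> X"
    have "ln (exp (h x) / Z) = h x - ln Z" using Z by (simp add: ln_div)
    then show "g x - exp (h x) / Z \<le> g x * (ln (g x) - (h x - ln Z))"
      using relative_entropy_term_ge[OF g[OF x], of "exp (h x) / Z"] Z by simp
    show "0 \<le> \<mu> x" using mu_pos[OF x] by simp
  qed
  moreover have "(\<Sum>x\<in>X. \<mu> x * (g x - exp (h x) / Z)) = 1 - Z / Z"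
  proof -
    have "(\<Sum>x\<in>X. \<mu> x * (exp (h x) / Z)) = (\<Sum>x\<in>X. \<mu> x * exp (h x)) / Z"
      by (simp add: sum_divide_distrib)
    then show ?thesis unfolding right_diff_distrib sum_subtractf g1 Z_def[symmetric] by simp
  qed
  moreover have "(\<Sum>x\<in>X. \<mu> x * (g x * (ln (g x) - (h x - ln Z))))
    = (\<Sum>x\<in>X. \<mu> x * g x * ln (g x)) - (\<Sum>x\<in>X. \<mu> x * g x * h x) + ln Z * (\<Sum>x\<in>X. \<mu> x * g x)"
    unfolding sum_distrib_left sum_subtractf[symmetric] sum.distrib[symmetric]
    by (intro sum.cong refl) (simp add: algebra_simps)
  ultimately show ?thesis unfolding g1 Z_def[symmetric] using Z by simp
qed

text \<open>Averaging over independent geometric times (the resolvent) halves the entropy. After \<open>m\<close>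
  rounds the entropy is bounded, so that some deterministic time in the range of the averaged
  time avoids a given set of very small measure.\<close>

lemma avoid_small_set:
  assumes y: "y \<in> X" and m: "ln (1 / \<mu> y) \<le> 2 ^ m" and B: "B \<subseteq> X" "(\<Sum>x\<in>B. \<mu> x) \<le> exp (-100)"
    and k0: "2 * real m * \<Lambda> \<le> real k0" "1 \<le> k0"
  shows "\<exists>k\<le>k0. (P ^^ k) (\<lambda>x. if x \<in> B then 1 else 0) y \<le> 1 / 10"
proof (rule ccontr)
  define F where "F = (\<lambda>x. if x \<in> B then 1 else 0 :: real)"
  assume "\<not> ?thesis"
  then have big: "1 / 10 < (P ^^ k) F y" if "k \<le> k0" for k
    using that unfolding F_def by (meson not_le)
  \<comment> \<open>Half of the point mass at \<open>y\<close> is replaced by the stationary law,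
    since the logarithmic inequality asks for strictly positive densities. This halves the lower
    bound 1/10 to 1/20.\<close>
  define f0 where "f0 x = (if x = y then 1 / (2 * \<mu> y) else 0) + 1 / 2" for x
  define f where "f j = (R ^^ j) f0" for j
  have f0: "0 < f0 x" if "x \<in> X" for x using mu_pos[OF y] by (simp add: f0_def add_nonneg_pos)
  have f01: "(\<Sum>x\<in>X. \<mu> x * f0 x) = 1"
  proof -
    have "(\<Sum>x\<in>X. \<mu> x * f0 x) = (\<Sum>x\<in>X. if x = y then \<mu> y * (1 / (2 * \<mu> y)) else 0) + (\<Sum>x\<in>X. \<mu> x) / 2"
      unfolding f0_def sum_divide_distrib sum.distrib[symmetric] by (intro sum.cong refl) (simp add: distrib_left)
    then show ?thesis using y finX mu_pos[OF y] mu_sum by simp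
  qed
  have f: "(\<forall>x\<in>X. 0 < f j x) \<and> (\<Sum>x\<in>X. \<mu> x * f j x) = 1
     \<and> 2 ^ j * (\<Sum>x\<in>X. \<mu> x * f j x * ln (f j x)) \<le> (\<Sum>x\<in>X. \<mu> x * f0 x * ln (f0 x))" for j
  proof (induction j)
    case 0
    then show ?case using f0 f01 by (simp add: f_def)
  next
    case (Suc j)
    have e: "f (Suc j) = R (f j)" by (simp add: f_def)
    have "2 * (\<Sum>x\<in>X. \<mu> x * R (f j) x * ln (R (f j) x)) \<le> (\<Sum>x\<in>X. \<mu> x * f j x * ln (f j x))"
      using Suc by (intro R_entropy) auto
    then have "2 ^ j * (2 * (\<Sum>x\<in>X. \<mu> x * R (f j) x * ln (R (f j) x))) \<le> 2 ^ j * (\<Sum>x\<in>X. \<mu> x * f j x * ln (f j x))"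
      by (rule mult_left_mono) simp
    also have "\<dots> \<le> (\<Sum>x\<in>X. \<mu> x * f0 x * ln (f0 x))" using Suc by blast
    finally have "2 ^ Suc j * (\<Sum>x\<in>X. \<mu> x * R (f j) x * ln (R (f j) x)) \<le> (\<Sum>x\<in>X. \<mu> x * f0 x * ln (f0 x))"
      by (simp only: power_Suc2 mult.assoc)
    then show ?case unfolding e mean_R using Suc R_pos by blast
  qed
  have "(\<Sum>x\<in>X. \<mu> x * f0 x * ln (f0 x)) \<le> (\<Sum>x\<in>X. \<mu> x * f0 x * ln (1 / \<mu> y))"
  proof (intro sum_mono mult_left_mono)
    fix x assume x: "x \<in> X"
    have "\<mu> y \<le> 1" using member_le_sum[OF y, of \<mu>] mu_pos finX mu_sum by (auto simp: less_imp_le)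
    then have "f0 x \<le> 1 / \<mu> y" using mu_pos[OF y] by (simp add: f0_def field_simps)
    then show "ln (f0 x) \<le> ln (1 / \<mu> y)" using f0[OF x] by (intro ln_mono) auto
    show "0 \<le> \<mu> x * f0 x" using f0[OF x] mu_pos[OF x] by simp
  qed
  also have "\<dots> = ln (1 / \<mu> y)" unfolding sum_distrib_right[symmetric] f01 by simp
  finally have "2 ^ m * (\<Sum>x\<in>X. \<mu> x * f m x * ln (f m x)) \<le> 2 ^ m * 1"
    using f[of m] m by linarith
  then have Ent: "(\<Sum>x\<in>X. \<mu> x * f m x * ln (f m x)) \<le> 1" by simp
  \<comment> \<open>The weight 100 matches the bound \<open>exp (-100)\<close> for the mass of
    \<open>B\<close>: the exponential moment is then at most 2, and \<open>B\<close> has probability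
    at most 1/50 after \<open>m\<close> rounds.\<close>
  have "(\<Sum>x\<in>X. \<mu> x * f m x * (100 * F x)) \<le> 1 + ln (\<Sum>x\<in>X. \<mu> x * exp (100 * F x))"
    using entropy_variational[of "f m" "\<lambda>x. 100 * F x"] f[of m] Ent by auto
  also have "(\<Sum>x\<in>X. \<mu> x * exp (100 * F x)) \<le> 2"
  proof -
    have "(\<Sum>x\<in>X. \<mu> x * exp (100 * F x)) \<le> (\<Sum>x\<in>X. \<mu> x + (if x \<in> B then \<mu> x * exp 100 else 0))"
      by (intro sum_mono) (use mu_pos in \<open>auto simp: F_def less_imp_le\<close>)
    also have "\<dots> = 1 + (\<Sum>x\<in>B. \<mu> x) * exp 100"
      unfolding sum.distrib mu_sum using B(1) finX
      by (simp add: sum.If_cases sum_distrib_right Int_absorb1 Int_absorb2)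
    also have "\<dots> \<le> 1 + exp (-100) * exp 100"
      by (intro add_left_mono mult_right_mono B) simp
    finally show ?thesis by (simp add: exp_minus)
  qed
  then have "ln (\<Sum>x\<in>X. \<mu> x * exp (100 * F x)) \<le> 1"
  proof -
    have "0 < (\<Sum>x\<in>X. \<mu> x * exp (100 * F x))"
      using y mu_pos by (intro sum_pos finX) auto
    then have "ln (\<Sum>x\<in>X. \<mu> x * exp (100 * F x)) \<le> (\<Sum>x\<in>X. \<mu> x * exp (100 * F x)) - 1"
      by (rule ln_le_minus_one)
    then show ?thesis using \<open>(\<Sum>x\<in>X. \<mu> x * exp (100 * F x)) \<le> 2\<close> by simp
  qed
  finally have "100 * ip (f m) F \<le> 2"
    unfolding ip_def sum_distrib_left by (simp add: mult_ac)
  \<comment> \<open>\<open>1 - k / k0\<close> lies below the indicator of \<open>k \<le> k0\<close>,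
    the times at which the probability of \<open>B\<close> is assumed to be large. Being affine in
    time, it loses exactly \<open>\<Lambda> / k0\<close> per geometric average; after
    \<open>m\<close> rounds 1/40 remains, more than 1/50.\<close>
  moreover have low: "1 / 20 * (1 - (real k + real j * \<Lambda>) / real k0) \<le> ip (f j) ((P ^^ k) F)" for j k
  proof (induction j arbitrary: k)
    case 0
    have F0: "0 \<le> (P ^^ k) F x" if "x \<in> X" for x using that by (intro Pk_nonneg) (auto simp: F_def)
    have "\<mu> y * (1 / (2 * \<mu> y)) * (P ^^ k) F y \<le> \<mu> y * f0 y * (P ^^ k) F y"
      using mu_pos[OF y] F0[OF y] by (intro mult_right_mono mult_left_mono) (auto simp: f0_def)
    also have "\<dots> \<le> ip f0 ((P ^^ k) F)" unfolding ip_def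
      using finX y by (intro member_le_sum) (auto intro!: mult_nonneg_nonneg F0 simp: less_imp_le[OF f0] less_imp_le[OF mu_pos])
    finally have a: "(P ^^ k) F y / 2 \<le> ip f0 ((P ^^ k) F)" using mu_pos[OF y] by simp
    show ?case
    proof (cases "k \<le> k0")
      case True
      then have "1 / 20 \<le> (P ^^ k) F y / 2" using big[of k] by simp
      moreover have "1 / 20 * (1 - (real k + real 0 * \<Lambda>) / real k0) \<le> 1 / 20" by simp
      ultimately have "1 / 20 * (1 - (real k + real 0 * \<Lambda>) / real k0) \<le> ip f0 ((P ^^ k) F)"
        using a by linarith
      then show ?thesis by (simp add: f_def)
    next
      case False
      then have "1 \<le> real k / real k0" using k0 by simp
      then show ?thesis using a F0[OF y] by (simp add: f_def)
    qed
  next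
    case (Suc j)
    define A where "A = 1 / 20 * (1 - (real k + real j * \<Lambda>) / real k0)"
    define b where "b = 1 / (20 * real k0)"
    have "(\<lambda>i. q ^ i) sums (1 / (1 - q))" using q by (intro geometric_sums) simp
    from sums_mult[OF this, of "(1 - q) * A"]
    have "(\<lambda>i. (1 - q) * A * q ^ i) sums ((1 - q) * A * (1 / (1 - q)))" .
    moreover have "(1 - q) * A * (1 / (1 - q)) = A" using q(2) by simp
    moreover have "(1 - q) * A * q ^ i = (1 - q) * q ^ i * A" for i by simp
    ultimately have 1: "(\<lambda>i. (1 - q) * q ^ i * A) sums A" by (simp only:)
    have "(\<lambda>i. of_nat (Suc i) * q ^ i) sums (1 / (1 - q)\<^sup>2)" using q by (intro geometric_deriv_sums) simp
    from sums_mult[OF this, of "(1 - q) * q * b"]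
    have "(\<lambda>i. (1 - q) * q * b * (of_nat (Suc i) * q ^ i)) sums ((1 - q) * q * b * (1 / (1 - q)\<^sup>2))" .
    moreover have "(1 - q) * q * b * (1 / (1 - q)\<^sup>2) = b * (q / (1 - q))"
      using q(2) by (simp add: power2_eq_square)
    moreover have "(1 - q) * q * b * (of_nat (Suc i) * q ^ i) = (1 - q) * q ^ Suc i * (b * real (Suc i))" for i
      by simp
    ultimately have "(\<lambda>i. (1 - q) * q ^ Suc i * (b * real (Suc i))) sums (b * \<Lambda>)"
      unfolding q(4) by (simp only:)
    then have 2: "(\<lambda>i. (1 - q) * q ^ i * (b * real i)) sums (b * \<Lambda>)"
      by (subst (asm) sums_Suc_iff) simp
    have s1: "(\<lambda>i. (1 - q) * q ^ i * A - (1 - q) * q ^ i * (b * real i)) sums (A - b * \<Lambda>)"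
      by (rule sums_diff[OF 1 2])
    have s2: "(\<lambda>i. (1 - q) * q ^ i * ip (f j) ((P ^^ (i + k)) F)) sums ip (f (Suc j)) ((P ^^ k) F)"
      using ip_R_sums[of "f j" "(P ^^ k) F"] by (simp add: f_def funpow_add)
    have "A - b * \<Lambda> \<le> ip (f (Suc j)) ((P ^^ k) F)"
    proof (rule sums_le[OF _ s1 s2])
      fix i
      have "A - b * real i = 1 / 20 * (1 - (real (i + k) + real j * \<Lambda>) / real k0)"
        using k0 by (simp add: A_def b_def field_simps)
      then have "A - b * real i \<le> ip (f j) ((P ^^ (i + k)) F)" using Suc[of "i + k"] by simp
      then have "(1 - q) * q ^ i * (A - b * real i) \<le> (1 - q) * q ^ i * ip (f j) ((P ^^ (i + k)) F)"
        using q(1,2) by (intro mult_left_mono) auto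
      then show "(1 - q) * q ^ i * A - (1 - q) * q ^ i * (b * real i) \<le> (1 - q) * q ^ i * ip (f j) ((P ^^ (i + k)) F)"
        by (simp add: right_diff_distrib)
    qed
    moreover have "A - b * \<Lambda> = 1 / 20 * (1 - (real k + real (Suc j) * \<Lambda>) / real k0)"
      using k0 by (simp add: A_def b_def field_simps)
    ultimately show ?case by simp
  qed
  have "real m * \<Lambda> / real k0 \<le> 1 / 2" using k0 by (simp add: field_simps)
  then have "1 / 40 \<le> ip (f m) F" using low[of 0 m] by simp
  ultimately show False by simp
qed

text \<open>The last \<open>k0\<close> of the \<open>3 * k0\<close> steps make the norm tiny by
  spectral decay. The maximal inequality then yields a single exceptional set for all times between
  \<open>k0\<close> and \<open>2 * k0\<close>, and some \<open>k \<le> k0\<close> initial steps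
  avoid it, \<open>2 * k0 - k\<close> being one of those times. The gap between 120 and 100 absorbs
  the constant \<open>3 * 100^2\<close>, and \<open>1/100 + 1/10 \<le> 1/8\<close>.\<close>

lemma contraction_from_good_state:
  assumes y: "y \<in> X" and m: "ln (1 / \<mu> y) \<le> 2 ^ m"
    and k0: "2 * real m * \<Lambda> \<le> real k0" "120 * \<Lambda> \<le> real k0"
    and f: "\<And>x. x \<in> X \<Longrightarrow> \<bar>f x\<bar> \<le> 1" "(\<Sum>x\<in>X. \<mu> x * f x) = 0"
  shows "\<bar>(P ^^ (3 * k0)) f y\<bar> \<le> 1 / 8"
proof -
  define h where "h = (P ^^ k0) f"
  define B where "B = {x\<in>X. \<exists>k\<in>{k0..2*k0}. 1 / 100 < \<bar>(P ^^ k) h x\<bar>}"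
  have k1: "1 \<le> k0" using k0(2) Lam by simp
  have "ip f f \<le> 1"
  proof -
    have "ip f f \<le> (\<Sum>x\<in>X. \<mu> x)" unfolding ip_def
    proof (rule sum_mono)
      fix x assume x: "x \<in> X"
      have "f x * f x \<le> 1" using f(1)[OF x] mult_mono[of "\<bar>f x\<bar>" 1 "\<bar>f x\<bar>" 1] by simp
      then show "\<mu> x * f x * f x \<le> \<mu> x" using mu_pos[OF x] by (simp add: mult.assoc)
    qed
    then show ?thesis using mu_sum by simp
  qed
  then have "ip h h \<le> (1 - 1 / \<Lambda>) ^ k0 * 1"
    unfolding h_def by (intro order_trans[OF norm_decay[OF f(2)]] mult_left_mono) (use Lam in auto)
  also have "(1 - 1 / \<Lambda>) ^ k0 \<le> exp (- 1 / \<Lambda>) ^ k0"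
    using exp_ge_add_one_self[of "- 1 / \<Lambda>"] Lam by (intro power_mono) auto
  also have "\<dots> = exp (- (real k0 / \<Lambda>))" by (simp add: exp_of_nat_mult[symmetric])
  also have "\<dots> \<le> exp (- 120)" using k0(2) Lam by (simp add: field_simps)
  finally have hh: "ip h h \<le> exp (- 120)" by simp
  have "(\<Sum>x\<in>B. \<mu> x) * (1 / 100)\<^sup>2 \<le> 3 * ip h h"
    unfolding B_def by (rule maximal_inequality[OF k1]) simp
  then have "(\<Sum>x\<in>B. \<mu> x) \<le> 30000 * exp (- 120)" using hh by (simp add: power2_eq_square)
  also have "\<dots> \<le> exp 20 * exp (- 120)"
  proof (rule mult_right_mono)
    have "(2::real) ^ 20 \<le> exp 1 ^ 20" using exp_ge_add_one_self[of 1] by (intro power_mono) auto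
    then show "(30000::real) \<le> exp 20" by (simp add: exp_of_nat_mult[symmetric])
  qed simp
  also have "\<dots> = exp (- 100)" by (simp add: exp_add[symmetric])
  finally obtain k where k: "k \<le> k0" "(P ^^ k) (\<lambda>x. if x \<in> B then 1 else 0) y \<le> 1 / 10"
    using avoid_small_set[OF y m _ _ k0(1) k1, of B] by (auto simp: B_def)
  define g where "g = (P ^^ (3 * k0 - k)) f"
  have "3 * k0 = k + (3 * k0 - k)" using k by simp
  then have e: "(P ^^ (3 * k0)) f = (P ^^ k) g" unfolding g_def by (metis funpow_add o_apply)
  have gb: "\<bar>g x\<bar> \<le> 1 / 100 + (if x \<in> B then 1 else 0)" if x: "x \<in> X" for x
  proof (cases "x \<in> B")
    case True
    have "\<bar>g x\<bar> \<le> 1" unfolding g_def by (rule Pk_bounded[OF f(1) x])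
    then show ?thesis using True by simp
  next
    case False
    have "2 * k0 - k \<in> {k0..2*k0}" "3 * k0 - k = (2 * k0 - k) + k0" using k by auto
    then have "\<bar>(P ^^ (2 * k0 - k)) h x\<bar> \<le> 1 / 100" "g x = (P ^^ (2 * k0 - k)) h x"
      using False x by (auto simp: B_def g_def h_def funpow_add not_less)
    then show ?thesis using False by simp
  qed
  have "\<bar>(P ^^ k) g y\<bar> \<le> (P ^^ k) (\<lambda>x. 1 / 100 + (if x \<in> B then 1 else 0)) y"
    by (rule Pk_abs_le[OF gb y])
  also have "\<dots> = 1 / 100 + (P ^^ k) (\<lambda>x. if x \<in> B then 1 else 0) y"
    using Pk_diff[of k "\<lambda>x. 1 / 100 + (if x \<in> B then 1 else 0)" "\<lambda>x. if x \<in> B then 1 else 0"]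
      Pk_const[OF y, of k "1/100"] by (simp add: fun_eq_iff)
  also have "\<dots> \<le> 1 / 8" using k(2) by simp
  finally show ?thesis unfolding e .
qed

end

section \<open>Glauber dynamics of a weighted set family\<close>

locale glauber_family = weighted_family "{..<n}" m for n :: nat and m +
  fixes M :: real
  assumes n_pos: "1 \<le> n"
    and total_1: "(\<Sum>S\<in>Pow {..<n}. m S) = 1"
    and M_nonneg: "0 \<le> M"
    and ratio_le: "\<And>S i. i \<in> {..<n} - S \<Longrightarrow> m (insert i S) \<le> M * m S"
begin

abbreviation V :: "nat set" where "V \<equiv> {..<n}"

definition X :: "nat set set" where "X = {S. S \<subseteq> V \<and> 0 < m S}"

definition kernel :: "nat set \<Rightarrow> nat set \<Rightarrow> real" where
  "kernel S T = pmf (glauber n X m S) T"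

text \<open>Conditional expectation given the state off \<open>i\<close>. If
  \<open>insert i S\<close> lies outside the support, its weight is 0 and the formula covers the
  forced move as well.\<close>

definition refresh :: "nat \<Rightarrow> (nat set \<Rightarrow> real) \<Rightarrow> nat set \<Rightarrow> real" where
  "refresh i f S = (m (S - {i}) * f (S - {i}) + m (insert i S) * f (insert i S)) / (m (S - {i}) + m (insert i S))"

lemma finite_X: "finite X" unfolding X_def by simp

lemma in_X_iff: "S \<in> X \<longleftrightarrow> 0 < m S"
  by (cases "S \<subseteq> V") (simp_all add: X_def outside)

lemma X_remove: "S \<in> X \<Longrightarrow> S - {i} \<in> X"
  using down[of S "S - {i}"] by (auto simp: in_X_iff)

lemma not_in_X: "S \<notin> X \<Longrightarrow> m S = 0"
  using nonneg[of S] by (simp add: in_X_iff)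

lemma sum_X_eq: "(\<Sum>S\<in>X. m S * f S) = (\<Sum>S\<in>Pow V. m S * f S)"
  by (rule sum.mono_neutral_left) (auto simp: X_def intro: not_in_X[unfolded X_def])

lemma sum_pmf_eq_expectation:
  assumes "finite A" "set_pmf r \<subseteq> A"
  shows "(\<Sum>y\<in>A. pmf r y * f y) = measure_pmf.expectation r f"
  by (subst integral_measure_pmf_real[of A]) (use assms in \<open>auto simp: mult.commute\<close>)

definition glauber_step :: "nat \<Rightarrow> nat set \<Rightarrow> nat set pmf" where
  "glauber_step i S = (let S' = S - {i} in
       if insert i S' \<notin> X then return_pmf S'
       else map_pmf (\<lambda>b. if b then insert i S' else S')
              (bernoulli_pmf (m (insert i S') / (m S' + m (insert i S')))))"

lemma glauber_step:
  assumes S: "S \<in> X"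
  shows "set_pmf (glauber_step i S) \<subseteq> X" "(\<Sum>T\<in>X. pmf (glauber_step i S) T * f T) = refresh i f S"
proof -
  have S': "S - {i} \<in> X" by (rule X_remove[OF S])
  then have pos: "0 < m (S - {i})" by (simp add: in_X_iff)
  show sub: "set_pmf (glauber_step i S) \<subseteq> X"
    using S' by (auto simp: glauber_step_def Let_def)
  have "(\<Sum>T\<in>X. pmf (glauber_step i S) T * f T) = measure_pmf.expectation (glauber_step i S) f"
    by (rule sum_pmf_eq_expectation[OF finite_X sub])
  also have "\<dots> = refresh i f S"
  proof (cases "insert i S \<in> X")
    case False
    then show ?thesis using pos not_in_X[OF False] by (simp add: glauber_step_def Let_def refresh_def)
  next
    case True
    then have pos2: "0 < m (insert i S)" by (simp add: in_X_iff)
    define r where "r = m (insert i S) / (m (S - {i}) + m (insert i S))"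
    have r: "0 \<le> r" "r \<le> 1" using pos pos2 by (auto simp: r_def)
    have "measure_pmf.expectation (glauber_step i S) f = f (insert i S) * r + f (S - {i}) * (1 - r)"
      using True r by (simp add: glauber_step_def Let_def r_def[symmetric])
    also have "1 - r = m (S - {i}) / (m (S - {i}) + m (insert i S))"
      using pos pos2 by (simp add: r_def field_simps)
    finally show ?thesis by (simp add: refresh_def r_def add_divide_distrib mult.commute)
  qed
  finally show "(\<Sum>T\<in>X. pmf (glauber_step i S) T * f T) = refresh i f S" .
qed

lemma glauber_eq: "glauber n X m S = bind_pmf (pmf_of_set V) (\<lambda>i. glauber_step i S)"
  unfolding glauber_def glauber_step_def ..

lemma V_nonempty: "V \<noteq> {}" using n_pos by (auto simp: lessThan_empty_iff)

lemma set_glauber: "S \<in> X \<Longrightarrow> set_pmf (glauber n X m S) \<subseteq> X"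
  using glauber_step(1)[of S] V_nonempty by (auto simp: glauber_eq)

lemma kernel_sum:
  assumes S: "S \<in> X"
  shows "(\<Sum>T\<in>X. kernel S T * f T) = (\<Sum>i\<in>V. refresh i f S) / n"
proof -
  have "(\<Sum>T\<in>X. kernel S T * f T) = (\<Sum>T\<in>X. (\<Sum>i\<in>V. pmf (glauber_step i S) T * f T) / n)"
    unfolding kernel_def glauber_eq
    by (intro sum.cong refl) (use V_nonempty in \<open>simp add: pmf_bind_pmf_of_set sum_distrib_right\<close>)
  also have "\<dots> = (\<Sum>i\<in>V. \<Sum>T\<in>X. pmf (glauber_step i S) T * f T) / n"
    unfolding sum_divide_distrib[symmetric] by (subst sum.swap) simp
  finally show ?thesis using glauber_step(2)[OF S] by simp
qed

definition edge_form :: "(nat set \<Rightarrow> real) \<Rightarrow> (nat set \<Rightarrow> real) \<Rightarrow> real" where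
  "edge_form f g = (\<Sum>S\<in>Pow V. \<Sum>i\<in>V-S. m S * m (insert i S) / (m S + m (insert i S))
       * (f (insert i S) - f S) * (g (insert i S) - g S)) / n"

lemma sum_pairs:
  "(\<Sum>S\<in>Pow V. \<Sum>i\<in>V. H S i) = (\<Sum>S\<in>Pow V. \<Sum>i\<in>V-S. H S i + H (insert i S) i :: real)"
proof -
  have "(\<Sum>S\<in>Pow V. \<Sum>i\<in>V. H S i) = (\<Sum>S\<in>Pow V. (\<Sum>i\<in>V-S. H S i) + (\<Sum>i\<in>S. H S i))"
    by (intro sum.cong refl) (simp add: sum.subset_diff[of _ V])
  also have "\<dots> = (\<Sum>S\<in>Pow V. \<Sum>i\<in>V-S. H S i) + (\<Sum>S\<in>Pow V. \<Sum>i\<in>V-S. H (insert i S) i)"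
    unfolding sum.distrib sum_Pow_insert[OF finite_lessThan, of H] ..
  finally show ?thesis by (simp add: sum.distrib)
qed

text \<open>An update sends both ends of a pair to the same average. The result is symmetric in
  \<open>f\<close> and \<open>g\<close> and a non-negative combination of squares for
  \<open>f = g\<close>, hence reversibility and semidefiniteness at once.\<close>

lemma kernel_form:
  "(\<Sum>S\<in>X. m S * f S * (\<Sum>T\<in>X. kernel S T * g T))
     = (\<Sum>S\<in>Pow V. \<Sum>i\<in>V-S. (m S * f S + m (insert i S) * f (insert i S))
         * (m S * g S + m (insert i S) * g (insert i S)) / (m S + m (insert i S))) / n"
proof -
  have "(\<Sum>S\<in>X. m S * f S * (\<Sum>T\<in>X. kernel S T * g T)) = (\<Sum>S\<in>X. m S * (f S * ((\<Sum>i\<in>V. refresh i g S) / n)))"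
    by (intro sum.cong refl) (simp add: kernel_sum mult.assoc)
  also have "\<dots> = (\<Sum>S\<in>Pow V. \<Sum>i\<in>V. m S * f S * refresh i g S) / n"
    unfolding sum_X_eq by (simp add: sum_divide_distrib sum_distrib_left mult_ac)
  also have "(\<Sum>S\<in>Pow V. \<Sum>i\<in>V. m S * f S * refresh i g S)
    = (\<Sum>S\<in>Pow V. \<Sum>i\<in>V-S. m S * f S * refresh i g S + m (insert i S) * f (insert i S) * refresh i g (insert i S))"
    by (rule sum_pairs)
  also have "\<dots> = (\<Sum>S\<in>Pow V. \<Sum>i\<in>V-S. (m S * f S + m (insert i S) * f (insert i S))
         * (m S * g S + m (insert i S) * g (insert i S)) / (m S + m (insert i S)))"
  proof (intro sum.cong refl)
    fix S i assume "i \<in> V - S"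
    then have "insert i S - {i} = S" "S - {i} = S" by auto
    then have r: "refresh i g (insert i S) = (m S * g S + m (insert i S) * g (insert i S)) / (m S + m (insert i S))"
      "refresh i g S = (m S * g S + m (insert i S) * g (insert i S)) / (m S + m (insert i S))"
      by (simp_all add: refresh_def)
    show "m S * f S * refresh i g S + m (insert i S) * f (insert i S) * refresh i g (insert i S)
      = (m S * f S + m (insert i S) * f (insert i S))
         * (m S * g S + m (insert i S) * g (insert i S)) / (m S + m (insert i S))"
      unfolding r times_divide_eq_right add_divide_distrib[symmetric] distrib_right[symmetric] ..
  qed
  finally show ?thesis .
qed

lemma kernel_edge_form:
  "(\<Sum>S\<in>X. m S * f S * g S) - (\<Sum>S\<in>X. m S * f S * (\<Sum>T\<in>X. kernel S T * g T)) = edge_form f g"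
proof -
  have "(\<Sum>S\<in>X. m S * f S * g S) = (\<Sum>S\<in>Pow V. m S * f S * g S)"
    using sum_X_eq[of "\<lambda>S. f S * g S"] by (simp add: mult.assoc)
  also have "\<dots> = (\<Sum>S\<in>Pow V. \<Sum>i\<in>V. m S * f S * g S) / n" using n_pos by (simp add: sum_distrib_left[symmetric])
  also have "(\<Sum>S\<in>Pow V. \<Sum>i\<in>V. m S * f S * g S)
    = (\<Sum>S\<in>Pow V. \<Sum>i\<in>V-S. m S * f S * g S + m (insert i S) * f (insert i S) * g (insert i S))"
    by (rule sum_pairs)
  finally have eq: "(\<Sum>S\<in>X. m S * f S * g S)
    = (\<Sum>S\<in>Pow V. \<Sum>i\<in>V-S. m S * f S * g S + m (insert i S) * f (insert i S) * g (insert i S)) / n" .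
  show ?thesis
    unfolding eq kernel_form edge_form_def diff_divide_distrib[symmetric] sum_subtractf[symmetric]
  proof (intro arg_cong2[where f="(/)"] sum.cong refl)
    fix S i assume "S \<in> Pow V" "i \<in> V - S"
    define a where "a = m S"
    define b where "b = m (insert i S)"
    have ab: "0 \<le> a" "0 \<le> b" unfolding a_def b_def by (rule nonneg)+
    have "a * f S * g S + b * f (insert i S) * g (insert i S)
        - (a * f S + b * f (insert i S)) * (a * g S + b * g (insert i S)) / (a + b)
      = a * b / (a + b) * (f (insert i S) - f S) * (g (insert i S) - g S)"
    proof (cases "a + b = 0")
      case True
      then have "a = 0" "b = 0" using ab by auto
      then show ?thesis by simp
    next
      case False
      then show ?thesis by (simp add: field_simps)
    qed
    then show "m S * f S * g S + m (insert i S) * f (insert i S) * g (insert i S) -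
         (m S * f S + m (insert i S) * f (insert i S)) * (m S * g S + m (insert i S) * g (insert i S)) /
         (m S + m (insert i S)) =
         m S * m (insert i S) / (m S + m (insert i S)) * (f (insert i S) - f S) * (g (insert i S) - g S)"
      unfolding a_def b_def .
  qed
qed

lemma conductance_ge:
  assumes "i \<in> V - S"
  shows "m (insert i S) / (1 + M) \<le> m S * m (insert i S) / (m S + m (insert i S))"
proof (cases "m (insert i S) = 0")
  case False
  then have p: "0 < m (insert i S)" using nonneg[of "insert i S"] by simp
  then have pS: "0 < m S" using down by blast
  have "m S + m (insert i S) \<le> (1 + M) * m S" using ratio_le[OF assms] by (simp add: algebra_simps)
  then show ?thesis using p pS M_nonneg by (simp add: field_simps)
qed simp

definition L :: real where "L = (1 + M) * n"

text \<open>\<open>h\<close> is left free so that one comparison serves both the gap, where it is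
  the squared increment, and the entropy, where it is at most the product of the increments.\<close>

lemma birth_form_le_edge_form:
  assumes "\<And>S i. S \<in> Pow V \<Longrightarrow> i \<in> V - S \<Longrightarrow> 0 < m (insert i S) \<Longrightarrow>
      h S i \<le> (f (insert i S) - f S) * (g (insert i S) - g S)"
    and "\<And>S i. S \<in> Pow V \<Longrightarrow> i \<in> V - S \<Longrightarrow> 0 < m (insert i S) \<Longrightarrow>
      0 \<le> (f (insert i S) - f S) * (g (insert i S) - g S)"
  shows "(\<Sum>S\<in>Pow V. \<Sum>i\<in>V-S. m (insert i S) * h S i) \<le> L * edge_form f g"
proof -
  have "(\<Sum>S\<in>Pow V. \<Sum>i\<in>V-S. m (insert i S) * h S i)
    \<le> (\<Sum>S\<in>Pow V. \<Sum>i\<in>V-S. (1 + M) * (m S * m (insert i S) / (m S + m (insert i S))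
         * (f (insert i S) - f S) * (g (insert i S) - g S)))"
  proof (intro sum_mono)
    fix S i assume S: "S \<in> Pow V" and i: "i \<in> V - S"
    define D where "D = (f (insert i S) - f S) * (g (insert i S) - g S)"
    show "m (insert i S) * h S i \<le> (1 + M) * (m S * m (insert i S) / (m S + m (insert i S))
         * (f (insert i S) - f S) * (g (insert i S) - g S))"
    proof (cases "m (insert i S) = 0")
      case False
      then have p: "0 < m (insert i S)" using nonneg[of "insert i S"] by simp
      have "m (insert i S) * h S i \<le> m (insert i S) * D"
        using assms(1)[OF S i p] p by (simp add: D_def)
      also have "\<dots> \<le> ((1 + M) * (m S * m (insert i S) / (m S + m (insert i S)))) * D"
        using conductance_ge[OF i] assms(2)[OF S i p] M_nonneg unfolding D_def[symmetric]
        by (intro mult_right_mono) (auto simp: field_simps)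
      finally show ?thesis by (simp add: D_def mult.assoc)
    qed simp
  qed
  also have "\<dots> = L * edge_form f g"
  proof -
    have "L * edge_form f g = (1 + M) * (\<Sum>S\<in>Pow V. \<Sum>i\<in>V-S. m S * m (insert i S) / (m S + m (insert i S))
       * (f (insert i S) - f S) * (g (insert i S) - g S))"
      using n_pos by (simp add: L_def edge_form_def)
    then show ?thesis by (simp only: sum_distrib_left)
  qed
  finally show ?thesis .
qed

text \<open>The one-sided term \<open>b * (ln b - ln a) - b + a\<close> of the birth process is at
  most \<open>(b - a) * (ln b - ln a)\<close>; the difference is the same term with \<open>a\<close>
  and \<open>b\<close> exchanged, hence non-negative.\<close>

lemma entropy_le_edge_form:
  assumes f: "\<And>S. S \<in> X \<Longrightarrow> 0 < f S"
  shows "(\<Sum>S\<in>X. m S * f S * ln (f S)) - (\<Sum>S\<in>X. m S * f S) * ln (\<Sum>S\<in>X. m S * f S)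
     \<le> L * edge_form f (\<lambda>S. ln (f S))"
proof -
  have f': "0 < f S" if "0 < m S" for S using f that by (simp add: in_X_iff)
  have "(\<Sum>S\<in>X. m S * f S * ln (f S)) = (\<Sum>S\<in>Pow V. m S * f S * ln (f S))"
    using sum_X_eq[of "\<lambda>S. f S * ln (f S)"] by (simp add: mult.assoc)
  then have "(\<Sum>S\<in>X. m S * f S * ln (f S)) - (\<Sum>S\<in>X. m S * f S) * ln (\<Sum>S\<in>X. m S * f S)
    \<le> (\<Sum>S\<in>Pow V. \<Sum>i\<in>V-S. m (insert i S) *
           (f (insert i S) * (ln (f (insert i S)) - ln (f S)) - f (insert i S) + f S))"
    using entropy_le_birth[of f, OF f'] by (simp add: sum_X_eq total_def total_1)
  also have "\<dots> \<le> L * edge_form f (\<lambda>S. ln (f S))"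
  proof (rule birth_form_le_edge_form)
    fix S i assume "S \<in> Pow V" "i \<in> V - S" and p: "0 < m (insert i S)"
    have "0 < f (insert i S)" "0 < f S" using f' p down[OF p subset_insertI] by auto
    then show "f (insert i S) * (ln (f (insert i S)) - ln (f S)) - f (insert i S) + f S
        \<le> (f (insert i S) - f S) * (ln (f (insert i S)) - ln (f S))"
      using relative_entropy_term_ge[of "f S" "f (insert i S)"] by (simp add: algebra_simps)
    show "0 \<le> (f (insert i S) - f S) * (ln (f (insert i S)) - ln (f S))"
      using \<open>0 < f (insert i S)\<close> \<open>0 < f S\<close> by (cases "f S \<le> f (insert i S)") (auto intro: mult_nonneg_nonneg mult_nonpos_nonpos)
  qed
  finally show ?thesis .
qed

lemma L_ge: "1 \<le> L"
  unfolding L_def using M_nonneg n_pos mult_mono[of 1 "1 + M" 1 "real n"] by simp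

lemma edge_form_nonneg: "0 \<le> edge_form f f"
  unfolding edge_form_def using nonneg
  by (intro divide_nonneg_nonneg sum_nonneg) (auto simp: mult.assoc)

lemma edge_form_commute: "edge_form f g = edge_form g f"
  unfolding edge_form_def by (simp add: mult_ac)

sublocale reversible_chain X m kernel
proof
  show "finite X" by (rule finite_X)
  show "0 < m S" if "S \<in> X" for S using that by (simp add: in_X_iff)
  show "(\<Sum>S\<in>X. m S) = 1" using sum_X_eq[of "\<lambda>_. 1"] total_1 by simp
  show "0 \<le> kernel S T" for S T by (simp add: kernel_def)
  show "(\<Sum>T\<in>X. kernel S T) = 1" if "S \<in> X" for S
    unfolding kernel_def by (rule sum_pmf_eq_1[OF finite_X set_glauber[OF that]])
  show "0 \<le> (\<Sum>S\<in>X. \<Sum>T\<in>X. m S * kernel S T * f S * f T)" for f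
  proof -
    have "(\<Sum>S\<in>X. \<Sum>T\<in>X. m S * kernel S T * f S * f T) = (\<Sum>S\<in>X. m S * f S * (\<Sum>T\<in>X. kernel S T * f T))"
      by (intro sum.cong refl) (simp add: sum_distrib_left mult_ac)
    also have "\<dots> \<ge> 0" unfolding kernel_form using nonneg
      by (intro divide_nonneg_nonneg sum_nonneg) (auto simp: zero_le_square)
    finally show ?thesis .
  qed
  show "m S * kernel S T = m T * kernel T S" if S: "S \<in> X" and T: "T \<in> X" for S T
  proof -
    \<comment> \<open>Detailed balance is the symmetry of the form, read off at indicators of single
      states.\<close>
    define d where "d S = (\<lambda>U. if U = S then 1 else 0 :: real)" for S :: "nat set"
    have k: "(\<Sum>U\<in>X. m U * d S U * (\<Sum>W\<in>X. kernel U W * d T W)) = m S * kernel S T" if "S \<in> X" "T \<in> X" for S T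
    proof -
      have "(\<Sum>W\<in>X. kernel U W * d T W) = kernel U T" for U
      proof -
        have "(\<Sum>W\<in>X. kernel U W * d T W) = (\<Sum>W\<in>X. if W = T then kernel U T else 0)"
          by (intro sum.cong refl) (simp add: d_def)
        then show ?thesis using that finite_X by simp
      qed
      then have "(\<Sum>U\<in>X. m U * d S U * (\<Sum>W\<in>X. kernel U W * d T W)) = (\<Sum>U\<in>X. if U = S then m S * kernel S T else 0)"
        by (intro sum.cong refl) (simp add: d_def)
      then show ?thesis using that finite_X by simp
    qed
    have "(\<Sum>U\<in>X. m U * d S U * (\<Sum>W\<in>X. kernel U W * d T W)) = (\<Sum>U\<in>X. m U * d T U * (\<Sum>W\<in>X. kernel U W * d S W))"
      unfolding kernel_form by (simp add: mult.commute)
    then show ?thesis unfolding k[OF S T] k[OF T S] .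
  qed
qed

lemma P_eq_refresh: "S \<in> X \<Longrightarrow> P f S = (\<Sum>i\<in>V. refresh i f S) / n"
  by (simp add: P_def kernel_sum)

lemma ip_edge_form: "ip f g - ip f (P g) = edge_form f g"
proof -
  have "ip f (P g) = (\<Sum>S\<in>X. m S * f S * (\<Sum>T\<in>X. kernel S T * g T))"
    unfolding ip_def by (intro sum.cong refl) (simp add: P_def)
  then show ?thesis unfolding kernel_edge_form[symmetric] by (simp add: ip_def)
qed

sublocale log_sobolev_chain X m kernel L
proof
  show "1 \<le> L" by (rule L_ge)
  show "ip f f \<le> L * (ip f f - ip f (P f))" if "(\<Sum>S\<in>X. m S * f S) = 0" for f
  proof -
    have "(\<Sum>S\<in>Pow V. m S * f S) = 0" using that sum_X_eq[of f] by simp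
    then have "ip f f = variance f"
      using sum_X_eq[of "\<lambda>S. f S * f S"] by (simp add: variance_def ip_def mult.assoc power2_eq_square)
    also have "\<dots> \<le> dirichlet f f" by (rule poincare)
    also have "\<dots> = (\<Sum>S\<in>Pow V. \<Sum>i\<in>V-S. m (insert i S) * ((f (insert i S) - f S) * (f (insert i S) - f S)))"
      by (simp add: dirichlet_def mult.assoc)
    also have "\<dots> \<le> L * edge_form f f" by (rule birth_form_le_edge_form) auto
    finally show ?thesis by (simp add: ip_edge_form)
  qed
  show "(\<Sum>S\<in>X. m S * f S * ln (f S)) \<le> L * (\<Sum>S\<in>X. m S * (f S - P f S) * ln (f S))"
    if f: "\<And>S. S \<in> X \<Longrightarrow> 0 < f S" and f1: "(\<Sum>S\<in>X. m S * f S) = 1" for f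
  proof -
    have "(\<Sum>S\<in>X. m S * (f S - P f S) * ln (f S)) = ip (\<lambda>S. ln (f S)) f - ip (\<lambda>S. ln (f S)) (P f)"
      unfolding ip_def sum_subtractf[symmetric] by (intro sum.cong refl) (simp add: algebra_simps)
    also have "\<dots> = edge_form f (\<lambda>S. ln (f S))" unfolding ip_edge_form by (rule edge_form_commute)
    finally show ?thesis using entropy_le_edge_form[of f, OF f] f1 by simp
  qed
qed

lemma MLSI_glauber: "MLSI X m (glauber n X m) (1 / L)"
  unfolding MLSI_def
proof (intro allI impI)
  fix f :: "nat set \<Rightarrow> real" assume f: "\<forall>S\<in>X. 0 < f S"
  have "(\<Sum>S\<in>X. m S * f S * (ln (f S) - (\<Sum>T\<in>X. pmf (glauber n X m S) T * ln (f T))))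
    = ip f (\<lambda>S. ln (f S)) - ip f (P (\<lambda>S. ln (f S)))"
    unfolding ip_def sum_subtractf[symmetric]
    by (intro sum.cong refl) (simp add: P_def kernel_def right_diff_distrib)
  also have "\<dots> = edge_form f (\<lambda>S. ln (f S))" by (rule ip_edge_form)
  finally have e: "(\<Sum>S\<in>X. m S * f S * (ln (f S) - (\<Sum>T\<in>X. pmf (glauber n X m S) T * ln (f T))))
    = edge_form f (\<lambda>S. ln (f S))" .
  have "Ent X m f = (\<Sum>S\<in>X. m S * f S * ln (f S)) - (\<Sum>S\<in>X. m S * f S) * ln (\<Sum>S\<in>X. m S * f S)"
    by (simp add: Ent_def expect_def mult.assoc)
  also have "\<dots> \<le> L * edge_form f (\<lambda>S. ln (f S))" using f by (intro entropy_le_edge_form) auto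
  finally show "1 / L * Ent X m f
    \<le> (\<Sum>S\<in>X. m S * f S * (ln (f S) - (\<Sum>T\<in>X. pmf (glauber n X m S) T * ln (f T))))"
    unfolding e using L_ge by (simp add: field_simps)
qed

lemma chain_after_support:
  assumes "S \<in> X" shows "set_pmf (chain_after (glauber n X m) t S) \<subseteq> X"
  unfolding chain_after_def using assms set_glauber by (induction t) auto

lemma chain_after_expectation:
  assumes S: "S \<in> X"
  shows "(\<Sum>T\<in>X. pmf (chain_after (glauber n X m) t S) T * f T) = (P ^^ t) f S"
proof (induction t arbitrary: f)
  case 0
  have "(\<Sum>T\<in>X. pmf (chain_after (glauber n X m) 0 S) T * f T) = (\<Sum>T\<in>X. if T = S then f S else 0)"
    by (intro sum.cong refl) (auto simp: chain_after_def)
  then show ?case using S finite_X by simp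
next
  case (Suc t)
  let ?p = "chain_after (glauber n X m) t S"
  have "chain_after (glauber n X m) (Suc t) S = bind_pmf ?p (glauber n X m)"
    by (simp add: chain_after_def)
  then have "pmf (chain_after (glauber n X m) (Suc t) S) T = (\<Sum>U\<in>X. pmf ?p U * kernel U T)" for T
    using sum_pmf_eq_expectation[OF finite_X chain_after_support[OF S, of t], of "\<lambda>U. kernel U T"]
    by (simp add: pmf_bind kernel_def)
  then have "(\<Sum>T\<in>X. pmf (chain_after (glauber n X m) (Suc t) S) T * f T)
    = (\<Sum>T\<in>X. \<Sum>U\<in>X. pmf ?p U * (kernel U T * f T))"
    by (simp add: sum_distrib_right mult.assoc)
  also have "\<dots> = (\<Sum>U\<in>X. pmf ?p U * P f U)"
    by (subst sum.swap) (intro sum.cong refl, simp add: P_def sum_distrib_left)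
  also have "\<dots> = (P ^^ t) (P f) S" by (rule Suc)
  also have "\<dots> = (P ^^ Suc t) f S" by (simp only: funpow_Suc_right o_apply)
  finally show ?case .
qed

text \<open>The extremal test function is the centred indicator of the states that receive at least
  their stationary mass; centring keeps it within \<open>[-1, 1]\<close>, and the distance is the
  excess on that set.\<close>

lemma tv_dist_le:
  assumes S: "S \<in> X" and c: "\<And>f. (\<And>T. T \<in> X \<Longrightarrow> \<bar>f T\<bar> \<le> 1) \<Longrightarrow> (\<Sum>T\<in>X. m T * f T) = 0 \<Longrightarrow> \<bar>(P ^^ t) f S\<bar> \<le> c"
  shows "tv_dist X (chain_after (glauber n X m) t S) m \<le> c"
proof -
  let ?p = "pmf (chain_after (glauber n X m) t S)"
  define A where "A = {T\<in>X. m T \<le> ?p T}"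
  define a where "a = (\<Sum>T\<in>A. m T)"
  define f where "f T = (if T \<in> A then 1 else 0) - a" for T
  have AX: "A \<subseteq> X" by (auto simp: A_def)
  have finA: "finite A" using AX finite_X finite_subset by blast
  have mX: "(\<Sum>T\<in>X. m T) = 1" by (rule mu_sum)
  have pX: "(\<Sum>T\<in>X. ?p T) = 1" by (rule sum_pmf_eq_1[OF finite_X chain_after_support[OF S]])
  have ind: "(\<Sum>T\<in>X. g T * (if T \<in> A then 1 else 0)) = (\<Sum>T\<in>A. g T)" for g :: "nat set \<Rightarrow> real"
    using AX finite_X by (simp add: if_distrib sum.If_cases Int_absorb1 cong: if_cong)
  have a: "0 \<le> a" "a \<le> 1"
    using sum_mono2[OF finite_X AX, of m] mX nonneg by (auto simp: a_def intro: sum_nonneg)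
  have "(\<Sum>T\<in>X. m T * f T) = 0"
    unfolding f_def right_diff_distrib sum_subtractf ind sum_distrib_right[symmetric] mX by (simp add: a_def)
  moreover have "\<bar>f T\<bar> \<le> 1" for T using a by (auto simp: f_def)
  ultimately have "\<bar>(P ^^ t) f S\<bar> \<le> c" using c by blast
  moreover have "(P ^^ t) f S = (\<Sum>T\<in>A. ?p T) - a"
    unfolding chain_after_expectation[OF S, symmetric] f_def right_diff_distrib sum_subtractf ind
      sum_distrib_right[symmetric] pX by simp
  moreover have "(\<Sum>T\<in>X. \<bar>?p T - m T\<bar>) = 2 * ((\<Sum>T\<in>A. ?p T) - a)"
  proof -
    have "(\<Sum>T\<in>X. \<bar>?p T - m T\<bar>) = (\<Sum>T\<in>X. 2 * ((?p T - m T) * (if T \<in> A then 1 else 0)) - (?p T - m T))"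
      by (intro sum.cong refl) (auto simp: A_def)
    also have "\<dots> = 2 * (\<Sum>T\<in>A. ?p T - m T) - ((\<Sum>T\<in>X. ?p T) - (\<Sum>T\<in>X. m T))"
      unfolding sum_subtractf sum_distrib_left[symmetric] ind by (simp add: ind sum_subtractf)
    finally show ?thesis unfolding mX pX by (simp add: sum_subtractf a_def)
  qed
  ultimately show ?thesis by (simp add: tv_dist_def)
qed

end

section \<open>Reaching states of large mass\<close>

context glauber_family
begin

section \<open>Expansion over sequences of updated elements\<close>

lemma refresh_cong:
  assumes "\<And>U. U \<in> X \<Longrightarrow> f U = g U" "Y \<in> X"
  shows "refresh i f Y = refresh i g Y"
  using assms X_remove[of Y i] not_in_X[of "insert i Y"]
  by (cases "insert i Y \<in> X") (simp_all add: refresh_def)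

lemma refresh_sum: "refresh i (\<lambda>U. \<Sum>w\<in>W. g w U) Y = (\<Sum>w\<in>W. refresh i (g w) Y)"
  by (simp add: refresh_def sum_distrib_left sum.distrib[symmetric] sum_divide_distrib)

lemma refresh_divide: "refresh i (\<lambda>U. f U / c) Y = refresh i f Y / c"
  by (simp add: refresh_def add_divide_distrib mult.commute)

text \<open>Conditioning on the chosen elements. The head of a word is the outermost operator, that
  is, the first update in time.\<close>

lemma Pk_eq_words:
  assumes "Y \<in> X"
  shows "(P ^^ t) f Y = (\<Sum>w | set w \<subseteq> V \<and> length w = t. foldr refresh w f Y) / n ^ t"
  using assms
proof (induction t arbitrary: Y)
  case 0
  have "{w. set w \<subseteq> V \<and> length w = 0} = {[]}" by auto
  then show ?case by simp
next
  case (Suc t)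
  let ?W = "\<lambda>t. {w. set w \<subseteq> V \<and> length w = t}"
  have r: "refresh i ((P ^^ t) f) Y = (\<Sum>w\<in>?W t. foldr refresh (i # w) f Y) / n ^ t" for i
  proof -
    have "refresh i ((P ^^ t) f) Y = refresh i (\<lambda>U. (\<Sum>w\<in>?W t. foldr refresh w f U) / n ^ t) Y"
      by (rule refresh_cong) (use Suc in auto)
    then show ?thesis by (simp add: refresh_divide refresh_sum)
  qed
  have "(P ^^ Suc t) f Y = (\<Sum>i\<in>V. (\<Sum>w\<in>?W t. foldr refresh (i # w) f Y) / n ^ t) / n"
    using Suc.prems by (simp add: P_eq_refresh r)
  also have "\<dots> = (\<Sum>i\<in>V. \<Sum>w\<in>?W t. foldr refresh (i # w) f Y) / n ^ Suc t"
    by (simp add: sum_divide_distrib[symmetric] mult.commute)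
  also have "(\<Sum>i\<in>V. \<Sum>w\<in>?W t. foldr refresh (i # w) f Y) = (\<Sum>(i,w)\<in>V \<times> ?W t. foldr refresh (i # w) f Y)"
    by (rule sum.cartesian_product)
  also have "\<dots> = (\<Sum>w\<in>?W (Suc t). foldr refresh w f Y)"
    by (rule sum.reindex_bij_witness[where i="\<lambda>w. (hd w, tl w)" and j="\<lambda>(i,w). i # w"])
       (auto simp: length_Suc_conv)
  finally show ?case .
qed

lemma refresh_le:
  assumes "\<And>U. U \<in> X \<Longrightarrow> f U \<le> c" "Y \<in> X"
  shows "refresh i f Y \<le> c"
proof -
  define a where "a = m (Y - {i})"
  define b where "b = m (insert i Y)"
  have a: "0 < a" using X_remove[OF assms(2)] by (simp add: a_def in_X_iff)
  have b: "0 \<le> b" by (simp add: b_def nonneg)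
  have "a * f (Y - {i}) \<le> a * c" using assms X_remove[OF assms(2)] a by (intro mult_left_mono) auto
  moreover have "b * f (insert i Y) \<le> b * c"
    using assms(1)[of "insert i Y"] not_in_X[of "insert i Y"] b by (cases "insert i Y \<in> X") (auto simp: b_def mult_left_mono)
  ultimately have "a * f (Y - {i}) + b * f (insert i Y) \<le> c * (a + b)" by (simp add: algebra_simps)
  then have "(a * f (Y - {i}) + b * f (insert i Y)) / (a + b) \<le> c" using a b by (simp add: pos_divide_le_eq)
  then show ?thesis by (simp add: refresh_def a_def b_def)
qed

lemma refresh_nonneg:
  assumes "\<And>U. U \<in> X \<Longrightarrow> 0 \<le> f U" "Y \<in> X"
  shows "0 \<le> refresh i f Y"
proof -
  have "m (insert i Y) * f (insert i Y) \<ge> 0"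
    using assms(1)[of "insert i Y"] not_in_X[of "insert i Y"] nonneg by (cases "insert i Y \<in> X") auto
  moreover have "m (Y - {i}) * f (Y - {i}) \<ge> 0" using assms X_remove[OF assms(2)] nonneg by simp
  ultimately show ?thesis using nonneg by (simp add: refresh_def)
qed

lemma word_nonneg:
  assumes "\<And>U. U \<in> X \<Longrightarrow> 0 \<le> f U" "Y \<in> X"
  shows "0 \<le> foldr refresh w f Y"
  using assms(2) by (induction w arbitrary: Y) (auto intro: assms(1) refresh_nonneg)

lemma word_le:
  assumes "\<And>U. U \<in> X \<Longrightarrow> f U \<le> c" "Y \<in> X"
  shows "foldr refresh w f Y \<le> c"
  using assms(2) by (induction w arbitrary: Y) (auto intro: assms(1) refresh_le)

lemma word_sum:
  assumes "finite W"
  shows "foldr refresh w (\<lambda>U. \<Sum>S\<in>W. g S U) = (\<lambda>Y. \<Sum>S\<in>W. foldr refresh w (g S) Y)"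
proof (induction w)
  case (Cons i w)
  show ?case by (rule ext) (simp add: Cons refresh_sum)
qed simp

text \<open>The last update of an element of \<open>S\<close> must insert it. At that time all elements of \<open>S\<close> updated
  for the last time before are present, so by monotonicity of the ratios the insertion is at most as
  likely as in the sequential construction of \<open>S\<close>; the product of these bounds telescopes.\<close>

lemma word_target:
  assumes anti: "\<And>S T i. T \<subseteq> S \<Longrightarrow> i \<in> V - S \<Longrightarrow> 0 < m S \<Longrightarrow> m (insert i S) * m T \<le> m (insert i T) * m S"
    and S: "S \<in> X" and Y: "Y \<in> X" and w: "set w \<subseteq> V"
  shows "foldr refresh w (\<lambda>U. if U = S then 1 else 0) Y \<le> (if Y - set w = S - set w then m S / m (S - set w) else 0)"
  using Y w
proof (induction w arbitrary: Y)
  case Nil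
  then show ?case using S by (auto simp: in_X_iff)
next
  case (Cons i w)
  define g where "g = foldr refresh w (\<lambda>U. if U = S then 1 else 0 :: real)"
  define W where "W = set w"
  have IH: "g U \<le> (if U - W = S - W then m S / m (S - W) else 0)" if "U \<in> X" for U
    using Cons.IH[OF that] Cons.prems unfolding g_def W_def by simp
  have g0: "0 \<le> g U" if "U \<in> X" for U unfolding g_def by (rule word_nonneg[OF _ that]) auto
  have pS: "0 < m (S - A)" "0 < m S" for A using S down[of S "S - A"] by (auto simp: in_X_iff)
  define c where "c = m S / m (S - W)"
  have c: "0 < c" unfolding c_def using pS by simp
  have iV: "i \<in> V" using Cons.prems by simp
  define a where "a = m (Y - {i})"
  define b where "b = m (insert i Y)"
  have YX: "Y - {i} \<in> X" by (rule X_remove[OF Cons.prems(1)])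
  have a: "0 < a" using YX by (simp add: a_def in_X_iff)
  have b: "0 \<le> b" by (simp add: b_def nonneg)
  have ref: "refresh i g Y = (a * g (Y - {i}) + b * g (insert i Y)) / (a + b)"
    by (simp add: refresh_def a_def b_def)
  have "refresh i g Y \<le> (if Y - insert i W = S - insert i W then m S / m (S - insert i W) else 0)"
  proof (cases "Y - insert i W = S - insert i W")
    case False
    have "g (Y - {i}) \<le> 0" using IH[OF YX] False by (auto split: if_splits)
    moreover have "b * g (insert i Y) \<le> 0"
    proof (cases "insert i Y \<in> X")
      case True
      then have "g (insert i Y) \<le> 0" using IH[OF True] False by (auto split: if_splits)
      then show ?thesis using b by (simp add: mult_nonneg_nonpos)
    qed (simp add: b_def not_in_X)
    ultimately have "a * g (Y - {i}) + b * g (insert i Y) \<le> 0"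
      using a by (simp add: add_nonpos_nonpos mult_nonneg_nonpos)
    then show ?thesis unfolding ref using False a b by (simp add: divide_nonpos_pos)
  next
    case eq: True
    show ?thesis
    proof (cases "i \<in> W")
      case True
      then have "insert i W = W" by auto
      moreover have "refresh i g Y \<le> c"
      proof (rule refresh_le[OF _ Cons.prems(1)])
        show "g U \<le> c" if "U \<in> X" for U using IH[OF that] c by (auto simp: c_def split: if_splits)
      qed
      ultimately show ?thesis using eq by (simp add: c_def)
    next
      \<comment> \<open>This is the last update of \<open>i\<close>, whose outcome must agree with
        \<open>S\<close>.\<close>
      case iW: False
      show ?thesis
      proof (cases "i \<in> S")
        case False
        have "b * g (insert i Y) \<le> 0"
        proof (cases "insert i Y \<in> X")
          case True
          have "insert i Y - W \<noteq> S - W" using iW False by auto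
          then have "g (insert i Y) \<le> 0" using IH[OF True] by simp
          then show ?thesis using b by (simp add: mult_nonneg_nonpos)
        qed (simp add: b_def not_in_X)
        moreover have "a * g (Y - {i}) \<le> a * c"
          using IH[OF YX] a c by (intro mult_left_mono) (auto simp: c_def split: if_splits)
        moreover have "0 \<le> b * c" using b c by simp
        ultimately have "a * g (Y - {i}) + b * g (insert i Y) \<le> c * (a + b)"
          unfolding distrib_left mult.commute[of c] by linarith
        then have "refresh i g Y \<le> c" unfolding ref using a b by (simp add: pos_divide_le_eq)
        moreover have "S - insert i W = S - W" using False by auto
        ultimately show ?thesis using eq by (simp add: c_def)
      next
        case True
        define T where "T = S - insert i W"
        have SW: "S - W = insert i T" using True iW by (auto simp: T_def)
        have TY: "T \<subseteq> Y - {i}" using eq by (auto simp: T_def)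
        have "Y - {i} - W \<noteq> S - W" using True iW by auto
        then have "g (Y - {i}) \<le> 0" using IH[OF YX] by simp
        then have 1: "a * g (Y - {i}) \<le> 0" using a by (simp add: mult_nonneg_nonpos)
        have 2: "b * g (insert i Y) \<le> b * c"
        proof (cases "insert i Y \<in> X")
          case True
          then show ?thesis using IH[OF True] b c by (intro mult_left_mono) (auto simp: c_def split: if_splits)
        qed (simp add: b_def not_in_X)
        \<comment> \<open>\<open>T\<close> consists of the elements of \<open>S\<close> that are
          already settled, all of them present in \<open>Y\<close>, so the ratio for inserting
          \<open>i\<close> is at most the one at \<open>T\<close>. Along the word the factors
          \<open>m (insert i T) / m T\<close> multiply up.\<close>
        have "b * m T \<le> m (insert i T) * a"
        proof -
          have "i \<in> V - (Y - {i})" using iV by simp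
          then have "m (insert i (Y - {i})) * m T \<le> m (insert i T) * m (Y - {i})"
            using a by (intro anti[OF TY]) (simp_all add: a_def)
          then show ?thesis by (simp add: a_def b_def)
        qed
        then have 3: "b * c \<le> m S / m T * a"
          using pS(1)[of W] pS(2) pS(1)[of "insert i W"] unfolding c_def SW T_def[symmetric]
          by (simp add: field_simps)
        have "m S / m T * a \<le> m S / m T * (a + b)"
          using pS(1)[of "insert i W"] pS(2) b by (intro mult_left_mono) (auto simp: T_def)
        then have "a * g (Y - {i}) + b * g (insert i Y) \<le> m S / m T * (a + b)"
          using 1 2 3 by linarith
        then have "refresh i g Y \<le> m S / m T" unfolding ref using a b by (simp add: pos_divide_le_eq)
        then show ?thesis using eq by (simp add: T_def)
      qed
    qed
  qed
  then show ?case unfolding g_def W_def by (simp only: foldr.simps o_apply list.set)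
qed

text \<open>A word that mentions every element forgets the start and reaches \<open>S\<close> with
  probability at most \<open>m S / m {}\<close>; the other words are counted by a union bound over
  an element never chosen.\<close>

lemma Pk_indicator_le:
  assumes anti: "\<And>S T i. T \<subseteq> S \<Longrightarrow> i \<in> V - S \<Longrightarrow> 0 < m S \<Longrightarrow> m (insert i S) * m T \<le> m (insert i T) * m S"
    and B: "B \<subseteq> X" and Y: "Y \<in> X"
  shows "(P ^^ t) (\<lambda>U. if U \<in> B then 1 else 0) Y \<le> (\<Sum>S\<in>B. m S) / m {} + n * (1 - 1 / n) ^ t"
proof -
  define W where "W = {w. set w \<subseteq> V \<and> length w = t}"
  define W0 where "W0 = {w\<in>W. set w \<noteq> V}"
  define c where "c = (\<Sum>S\<in>B. m S) / m {}"
  have finB: "finite B" using B finite_X finite_subset by blast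
  have finW: "finite W" and cardW: "card W = n ^ t"
    unfolding W_def using finite_lists_length_eq[of V t] card_lists_length_eq[of V t] by auto
  have c0: "0 \<le> c" unfolding c_def using nonneg by (intro divide_nonneg_nonneg sum_nonneg) auto
  have ind: "(\<lambda>U. if U \<in> B then 1 else 0) = (\<lambda>U. \<Sum>S\<in>B. if U = S then 1 else 0 :: real)"
    using finB by auto
  have each: "foldr refresh w (\<lambda>U. if U \<in> B then 1 else 0) Y \<le> c + (if w \<in> W0 then 1 else 0)" if w: "w \<in> W" for w
  proof (cases "set w = V")
    case True
    have "foldr refresh w (\<lambda>U. if U \<in> B then 1 else 0) Y = (\<Sum>S\<in>B. foldr refresh w (\<lambda>U. if U = S then 1 else 0) Y)"
      unfolding ind word_sum[OF finB] ..
    also have "\<dots> \<le> (\<Sum>S\<in>B. m S / m {})"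
    proof (rule sum_mono)
      fix S assume S: "S \<in> B"
      have "S - set w = {}" "Y - set w = {}" using S B Y True by (auto simp: X_def)
      moreover have "S \<in> X" using S B by blast
      ultimately show "foldr refresh w (\<lambda>U. if U = S then 1 else 0) Y \<le> m S / m {}"
        using word_target[OF anti _ Y, of S w] True by (simp only:) simp
    qed
    also have "\<dots> = c" by (simp add: c_def sum_divide_distrib)
    finally show ?thesis by (simp add: W0_def True)
  next
    case False
    have "foldr refresh w (\<lambda>U. if U \<in> B then 1 else 0) Y \<le> 1" by (rule word_le[OF _ Y]) simp
    then show ?thesis using False w c0 by (simp add: W0_def)
  qed
  have cardW0: "card W0 \<le> n * (n - 1) ^ t"
  proof -
    have "W0 \<subseteq> (\<Union>i\<in>V. {w. set w \<subseteq> V - {i} \<and> length w = t})" by (auto simp: W0_def W_def)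
    then have "card W0 \<le> card (\<Union>i\<in>V. {w. set w \<subseteq> V - {i} \<and> length w = t})"
      by (rule card_mono[rotated]) (auto intro: finite_lists_length_eq)
    also have "\<dots> \<le> (\<Sum>i\<in>V. card {w. set w \<subseteq> V - {i} \<and> length w = t})" by (rule card_UN_le) simp
    also have "\<dots> = n * (n - 1) ^ t" by (simp add: card_lists_length_eq)
    finally show ?thesis .
  qed
  have "(P ^^ t) (\<lambda>U. if U \<in> B then 1 else 0) Y \<le> (\<Sum>w\<in>W. c + (if w \<in> W0 then 1 else 0)) / n ^ t"
    unfolding Pk_eq_words[OF Y] W_def[symmetric] by (intro divide_right_mono sum_mono each) auto
  also have "(\<Sum>w\<in>W. c + (if w \<in> W0 then 1 else 0)) = c * n ^ t + card W0"
    using finW cardW by (simp add: sum.distrib sum.If_cases W0_def Int_def)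
  also have "(c * n ^ t + card W0) / n ^ t = c + card W0 / n ^ t"
    using n_pos by (simp add: add_divide_distrib)
  also have "\<dots> \<le> c + real n * real (n - 1) ^ t / real n ^ t"
  proof -
    have "real (card W0) \<le> real n * real (n - 1) ^ t" using cardW0 by (metis of_nat_le_iff of_nat_mult of_nat_power)
    then show ?thesis by (simp add: divide_right_mono)
  qed
  also have "real n * real (n - 1) ^ t / real n ^ t = n * (1 - 1 / n) ^ t"
  proof -
    have "real (n - 1) / real n = 1 - 1 / n" using n_pos by (simp add: of_nat_diff field_simps)
    then show ?thesis by (metis power_divide times_divide_eq_right)
  qed
  finally show ?thesis unfolding c_def by simp
qed

section \<open>Moves towards larger mass and effective resistance\<close>

lemma edge_bound:
  assumes S: "S \<subseteq> V" "i \<in> V - S"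
  shows "m S * m (insert i S) / (m S + m (insert i S)) * (u (insert i S) - u S)\<^sup>2 \<le> n * edge_form u u"
proof -
  define H where "H S i = m S * m (insert i S) / (m S + m (insert i S)) * (u (insert i S) - u S) * (u (insert i S) - u S)" for S i
  have H0: "0 \<le> H S i" for S i unfolding H_def using nonneg by (simp add: mult.assoc)
  have "H S i \<le> (\<Sum>i\<in>V-S. H S i)" using S H0 by (intro member_le_sum) auto
  also have "\<dots> \<le> (\<Sum>S\<in>Pow V. \<Sum>i\<in>V-S. H S i)" using S H0 by (intro member_le_sum sum_nonneg) auto
  also have "\<dots> = n * edge_form u u" using n_pos by (simp add: edge_form_def H_def)
  finally show ?thesis by (simp add: H_def power2_eq_square mult.assoc)
qed

text \<open>Exchanges are included because the bounds on the entries of the pivot transform call for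
  them. An exchange is two steps of the dynamics, through \<open>S - {i}\<close>.\<close>

definition adjacent_up :: "real \<Rightarrow> nat set \<Rightarrow> nat set \<Rightarrow> bool" where
  "adjacent_up \<kappa> S S' \<longleftrightarrow> \<kappa> * m S \<le> m S' \<and>
     ((\<exists>j\<in>V-S. S' = insert j S) \<or> (\<exists>i\<in>S. S' = S - {i}) \<or> (\<exists>i\<in>S. \<exists>j\<in>V-S. S' = insert j (S - {i})))"

text \<open>Every edge on the path has conductance at least
  \<open>\<kappa> * m S / (2 * (1 + M))\<close>, up to the factor \<open>1 / n\<close>. In an
  exchange the intermediate set might be light, but \<open>ratio_le\<close> keeps its mass above
  \<open>m S' / M\<close>. The factor 2 in front of the root counts the two edges.\<close>

lemma adjacent_up_diff:
  assumes S: "S \<in> X" and up: "adjacent_up \<kappa> S S'" and \<kappa>: "4 \<le> \<kappa>" "\<kappa> \<le> 1 + M"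
  shows "\<bar>u S' - u S\<bar> \<le> 2 * sqrt (2 * (L * edge_form u u) / (\<kappa> * m S))"
proof -
  define s where "s = sqrt (2 * (L * edge_form u u) / (\<kappa> * m S))"
  have mS: "0 < m S" "S \<subseteq> V" using S by (auto simp: X_def)
  have pM: "0 < 1 + M" using M_nonneg by simp
  have edge: "\<bar>u (insert i T) - u T\<bar> \<le> s"
    if T: "T \<subseteq> V" "i \<in> V - T" and c: "\<kappa> * m S \<le> 2 * (1 + M) * (m T * m (insert i T) / (m T + m (insert i T)))" for T i
  proof -
    have "\<kappa> * m S * (u (insert i T) - u T)\<^sup>2
      \<le> 2 * (1 + M) * (m T * m (insert i T) / (m T + m (insert i T))) * (u (insert i T) - u T)\<^sup>2"
      using c by (rule mult_right_mono) simp
    also have "\<dots> \<le> 2 * (1 + M) * (n * edge_form u u)"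
      unfolding mult.assoc[of "2 * (1 + M)"] using pM by (intro mult_left_mono edge_bound[OF T]) auto
    finally have "(u (insert i T) - u T)\<^sup>2 \<le> 2 * (L * edge_form u u) / (\<kappa> * m S)"
      using mS \<kappa> by (simp add: L_def field_simps)
    then show ?thesis unfolding s_def by (rule real_le_rsqrt[of "\<bar>_\<bar>", unfolded power2_abs])
  qed
  have s0: "0 \<le> s" unfolding s_def using edge_form_nonneg L_ge mS \<kappa> by simp
  have big: "\<kappa> * a \<le> 2 * (1 + M) * (a * b / (a + b))" if "0 < a" "\<kappa> * a \<le> b" for a b :: real
  proof -
    have "1 * a \<le> \<kappa> * a" using that \<kappa> by (intro mult_right_mono) auto
    then have ba: "a \<le> b" using that by linarith
    then have "a / 2 \<le> a * b / (a + b)" using that by (simp add: field_simps)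
    then have "2 * (1 + M) * (a / 2) \<le> 2 * (1 + M) * (a * b / (a + b))" using pM by (intro mult_left_mono) auto
    moreover have "\<kappa> * a \<le> (1 + M) * a" using \<kappa>(2) that by (intro mult_right_mono) auto
    moreover have "2 * (1 + M) * (a / 2) = (1 + M) * a" by simp
    ultimately show ?thesis by linarith
  qed
  from up consider j where "j \<in> V - S" "S' = insert j S" "\<kappa> * m S \<le> m S'"
    | i where "i \<in> S" "S' = S - {i}" "\<kappa> * m S \<le> m S'"
    | i j where "i \<in> S" "j \<in> V - S" "S' = insert j (S - {i})" "\<kappa> * m S \<le> m S'"
    unfolding adjacent_up_def by blast
  then have "\<bar>u S' - u S\<bar> \<le> 2 * s"
  proof cases
    case 1
    then show ?thesis using edge[of S j] big[of "m S" "m S'"] mS s0 by simp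
  next
    case 2
    then have e: "insert i S' = S" "i \<in> V - S'" "S' \<subseteq> V" using mS by auto
    have "\<kappa> * m S \<le> 2 * (1 + M) * (m S' * m (insert i S') / (m S' + m (insert i S')))"
      using big[of "m S" "m S'"] 2(3) mS unfolding e(1) by (simp add: mult.commute add.commute)
    from edge[OF e(3,2) this] show ?thesis using s0 unfolding e(1) by linarith
  next
    case 3
    define T where "T = S - {i}"
    have e: "insert i T = S" "i \<in> V - T" "j \<in> V - T" "T \<subseteq> V" "insert j T = S'" using 3 mS by (auto simp: T_def)
    define t where "t = m T"
    have t: "0 < t" using X_remove[OF S, of i] by (simp add: t_def T_def in_X_iff)
    have bt: "m S' \<le> M * t" using ratio_le[OF e(3)] e(5) by (simp add: t_def)
    have st: "\<kappa> * m S \<le> M * t" using 3(4) bt by simp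
    have "\<kappa> * m S \<le> 2 * (1 + M) * (t * m S / (t + m S))"
    proof -
      have "\<kappa> * (t + m S) = \<kappa> * t + \<kappa> * m S" by (simp add: algebra_simps)
      also have "\<dots> \<le> (1 + M) * t + M * t" using \<kappa>(2) t st by (intro add_mono mult_right_mono) auto
      also have "\<dots> \<le> 2 * (1 + M) * t" using t by (simp add: algebra_simps)
      finally have "\<kappa> * (t + m S) * m S \<le> 2 * (1 + M) * t * m S" using mS by (intro mult_right_mono) auto
      then show ?thesis using t mS by (simp add: field_simps)
    qed
    then have d1: "\<bar>u S - u T\<bar> \<le> s" using edge[OF e(4,2)] by (simp add: e(1) t_def)
    have pS': "0 < m S'" using 3(4) mS \<kappa> mult_pos_pos[of \<kappa> "m S"] by linarith
    have "\<kappa> * m S \<le> 2 * (1 + M) * (t * m S' / (t + m S'))"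
    proof -
      have "t + m S' \<le> (1 + M) * t" using bt by (simp add: algebra_simps)
      then have "m S' * (t + m S') \<le> (1 + M) * t * m S'" using pS' by (simp add: mult.commute mult_left_mono)
      then have "m S' \<le> (1 + M) * (t * m S' / (t + m S'))" using t pS' by (simp add: field_simps)
      moreover have "0 \<le> (1 + M) * (t * m S' / (t + m S'))" using t pS' pM by simp
      moreover have "x \<le> 2 * z" if "x \<le> y" "y \<le> z" "0 \<le> z" for x y z :: real using that by linarith
      ultimately have "\<kappa> * m S \<le> 2 * ((1 + M) * (t * m S' / (t + m S')))" using 3(4) by blast
      then show ?thesis by (simp only: mult.assoc)
    qed
    then have d2: "\<bar>u S' - u T\<bar> \<le> s" using edge[OF e(4,3)] by (simp add: e(5) t_def)
    show ?thesis using d1 d2 by linarith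
  qed
  then show ?thesis by (simp add: s_def)
qed

text \<open>Masses at least quadruple along an uphill path, so the bounds on the increments of
  \<open>u\<close> at least halve from step to step and their sum is at most twice the first one. In
  place of a path, a violating state of largest mass is taken, and the induction closes because
  \<open>2 + 4 / 2 = 4\<close>. The constant 32 is \<open>4^2 * 2\<close>.\<close>

lemma resistance_bound:
  assumes B: "B \<subseteq> X" and \<kappa>: "4 \<le> \<kappa>" "\<kappa> \<le> 1 + M"
    and up: "\<And>S. S \<in> B \<Longrightarrow> \<exists>S'\<in>X. adjacent_up \<kappa> S S'"
    and S: "S \<in> X" and u: "\<And>U. U \<in> X - B \<Longrightarrow> u U = 0"
  shows "m S * (u S)\<^sup>2 \<le> 32 * L / \<kappa> * edge_form u u"
proof -
  define K where "K = 2 * (L * edge_form u u) / \<kappa>"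
  have K0: "0 \<le> K" unfolding K_def using edge_form_nonneg L_ge \<kappa> by simp
  have main: "\<bar>u S\<bar> \<le> 4 * sqrt (K / m S)" if "S \<in> X" for S
  proof (rule ccontr)
    assume bad: "\<not> ?thesis"
    define Bad where "Bad = {S\<in>X. \<not> \<bar>u S\<bar> \<le> 4 * sqrt (K / m S)}"
    have "finite Bad" "Bad \<noteq> {}" using bad that finite_X by (auto simp: Bad_def)
    then obtain T where T: "T \<in> Bad" "\<And>U. U \<in> Bad \<Longrightarrow> m U \<le> m T"
      using obtains_MAX[of Bad m] by (metis Max_ge finite_imageI imageI)
    have TX: "T \<in> X" and Tbad: "4 * sqrt (K / m T) < \<bar>u T\<bar>" using T(1) by (auto simp: Bad_def)
    have mT: "0 < m T" using TX by (simp add: in_X_iff)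
    have "0 \<le> sqrt (K / m T)" using K0 mT by simp
    then have "u T \<noteq> 0" using Tbad by linarith
    then have "T \<in> B" using u[of T] TX by blast
    then obtain T' where T': "T' \<in> X" "adjacent_up \<kappa> T T'" using up by blast
    have "\<kappa> * m T \<le> m T'" using T'(2) by (simp add: adjacent_up_def)
    moreover have "4 * m T \<le> \<kappa> * m T" using \<kappa>(1) mT by (intro mult_right_mono) auto
    ultimately have "4 * m T \<le> m T'" by linarith
    then have "T' \<notin> Bad" using T(2)[of T'] mT by auto
    then have "\<bar>u T'\<bar> \<le> 4 * sqrt (K / m T')" using T'(1) by (auto simp: Bad_def)
    also have "sqrt (K / m T') \<le> sqrt (K / (4 * m T))"
      using K0 mT \<open>4 * m T \<le> m T'\<close> by (intro real_sqrt_le_mono divide_left_mono) auto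
    also have "sqrt (K / (4 * m T)) = sqrt (K / m T) / 2"
      by (simp add: real_sqrt_divide real_sqrt_mult)
    finally have "\<bar>u T'\<bar> \<le> 2 * sqrt (K / m T)" by simp
    moreover have "\<bar>u T' - u T\<bar> \<le> 2 * sqrt (K / m T)"
      using adjacent_up_diff[OF TX T'(2) \<kappa>, of u] by (simp add: K_def)
    ultimately show False using Tbad by linarith
  qed
  have mS: "0 < m S" using S by (simp add: in_X_iff)
  have "(u S)\<^sup>2 \<le> (4 * sqrt (K / m S))\<^sup>2" using main[OF S] by (metis abs_ge_zero power2_abs power_mono)
  also have "\<dots> = 16 * (K / m S)" using K0 mS by (simp add: power_mult_distrib)
  finally have "m S * (u S)\<^sup>2 \<le> 16 * K" using mS by (simp add: field_simps)
  then show ?thesis by (simp add: K_def)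
qed

end

section \<open>Mixing time\<close>

context glauber_family
begin

text \<open>\<open>2 ^ rounds\<close> is at least \<open>4 * n^2\<close>, an upper bound for
  \<open>ln (1 / m y)\<close> at states \<open>y\<close> above the threshold mass.\<close>

definition rounds :: nat where "rounds = 2 + 2 * nat \<lceil>log 2 n\<rceil>"

definition burn :: nat where "burn = 3 * nat \<lceil>(120 + 2 * real rounds) * L\<rceil>"

lemma contraction_good:
  assumes y: "y \<in> X" and my: "1 / 2 ^ (4 * n\<^sup>2) \<le> m y"
    and f: "\<And>x. x \<in> X \<Longrightarrow> \<bar>f x\<bar> \<le> 1" "(\<Sum>x\<in>X. m x * f x) = 0"
  shows "\<bar>(P ^^ burn) f y\<bar> \<le> 1 / 8"
proof -
  define k0 where "k0 = nat \<lceil>(120 + 2 * real rounds) * L\<rceil>"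
  have k0: "(120 + 2 * real rounds) * L \<le> real k0" unfolding k0_def by (rule real_nat_ceiling_ge)
  have pos: "0 < m y" using y by (simp add: in_X_iff)
  have "1 / m y \<le> 2 ^ (4 * n\<^sup>2)" using my pos by (simp add: field_simps)
  then have "ln (1 / m y) \<le> ln (2 ^ (4 * n\<^sup>2))" using pos by (intro ln_mono) auto
  also have "\<dots> = real (4 * n\<^sup>2) * ln 2" by (simp add: ln_realpow)
  also have "\<dots> \<le> real (4 * n\<^sup>2) * 1" using ln_le_minus_one[of "2::real"] by (intro mult_left_mono) auto
  also have "\<dots> \<le> 2 ^ rounds"
  proof -
    have "real n = 2 powr log 2 n" using n_pos by simp
    also have "\<dots> \<le> 2 powr real (nat \<lceil>log 2 n\<rceil>)" by (intro powr_mono real_nat_ceiling_ge) auto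
    also have "\<dots> = 2 ^ nat \<lceil>log 2 n\<rceil>" by (simp add: powr_realpow)
    finally have "real n ^ 2 \<le> (2 ^ nat \<lceil>log 2 n\<rceil>) ^ 2" by (intro power_mono) auto
    then show ?thesis by (simp add: rounds_def power_add power_mult[symmetric] mult.commute)
  qed
  finally have "ln (1 / m y) \<le> 2 ^ rounds" .
  moreover have "2 * real rounds * L \<le> real k0" "120 * L \<le> real k0"
  proof -
    have "(120 + 2 * real rounds) * L = 120 * L + 2 * real rounds * L" by (rule distrib_right)
    moreover have "0 \<le> 2 * real rounds * L" "0 \<le> 120 * L" using L_ge by auto
    ultimately show "2 * real rounds * L \<le> real k0" "120 * L \<le> real k0" using k0 by linarith+
  qed
  ultimately have "\<bar>(P ^^ (3 * k0)) f y\<bar> \<le> 1 / 8"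
    using contraction_from_good_state[OF y _ _ _ f] by blast
  then show ?thesis by (simp add: burn_def k0_def)
qed

lemma burn_le:
  assumes n: "2 \<le> n" shows "real burn \<le> 600 * (L * ln n)"
proof -
  define l where "l = ln (real n)"
  have l: "2 / 3 \<le> l" unfolding l_def using ln2_ge_two_thirds n by (intro order_trans[OF ln2_ge_two_thirds]) auto
  have "log 2 n \<le> 3 / 2 * l"
  proof -
    have "l * 1 \<le> l * (3 / 2 * ln 2)" using ln2_ge_two_thirds l by (intro mult_left_mono) auto
    then show ?thesis by (simp add: log_def l_def[symmetric] field_simps)
  qed
  then have "real (nat \<lceil>log 2 n\<rceil>) \<le> 3 * l" using l n by (simp add: nat_ceiling_le_eq) linarith
  then have "real rounds \<le> 9 * l" using l by (simp add: rounds_def)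
  then have "(120 + 2 * real rounds) * L + 1 \<le> (120 + 2 * (9 * l)) * L + 1 * L"
    using L_ge by (intro add_mono mult_right_mono) auto
  also have "\<dots> = (121 + 18 * l) * L" by (simp add: algebra_simps)
  also have "\<dots> \<le> (200 * l) * L" using l L_ge by (intro mult_right_mono) auto
  finally have "(120 + 2 * real rounds) * L + 1 \<le> 200 * (L * l)" by (simp add: mult_ac)
  moreover have "real (nat \<lceil>(120 + 2 * real rounds) * L\<rceil>) \<le> (120 + 2 * real rounds) * L + 1"
    using L_ge by (simp add: of_nat_ceiling)
  ultimately show ?thesis by (simp add: burn_def l_def)
qed

lemma mixing_time_le:
  assumes "\<And>f S. S \<in> X \<Longrightarrow> (\<And>T. T \<in> X \<Longrightarrow> \<bar>f T\<bar> \<le> 1) \<Longrightarrow> (\<Sum>T\<in>X. m T * f T) = 0 \<Longrightarrow> \<bar>(P ^^ t) f S\<bar> \<le> 1 / 4"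
  shows "mixing_time X m (glauber n X m) \<le> enat t"
  unfolding mixing_time_def
proof (rule SUP_least)
  fix S assume S: "S \<in> X"
  have "tv_dist X (chain_after (glauber n X m) t S) m \<le> 1 / 4"
    by (rule tv_dist_le[OF S]) (rule assms[OF S])
  then show "(INF t\<in>{t. tv_dist X (chain_after (glauber n X m) t S) m \<le> 1 / 4}. enat t) \<le> enat t"
    by (intro INF_lower) simp
qed

lemma Pk_add_const: "S \<in> X \<Longrightarrow> (P ^^ k) (\<lambda>U. c + g U) S = c + (P ^^ k) g S"
  using Pk_diff[of k "\<lambda>U. c + g U" g] Pk_const[of S k c] by (simp add: fun_eq_iff)

lemma sum_subset_X_le:
  assumes "B \<subseteq> X" "\<And>S. S \<in> B \<Longrightarrow> m S \<le> c" "0 \<le> c"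
  shows "(\<Sum>S\<in>B. m S) \<le> 2 ^ n * c"
proof -
  have "card B \<le> card (Pow V)" using assms(1) by (intro card_mono) (auto simp: X_def)
  then have "card B \<le> 2 ^ n" by (simp add: card_Pow)
  then have "real (card B) * c \<le> 2 ^ n * c" using assms(3) by (intro mult_right_mono) (metis of_nat_le_iff of_nat_numeral of_nat_power, simp)
  moreover have "(\<Sum>S\<in>B. m S) \<le> card B * c" using assms(2) by (rule sum_bounded_above)
  ultimately show ?thesis by simp
qed

text \<open>With \<open>1 + M \<le> 4 ^ n\<close> the empty set has mass at least
  \<open>1 / 2 ^ (n + 2 * n^2)\<close>, whereas the states below the threshold have at most
  \<open>2 ^ n / 2 ^ (4 * n^2)\<close> together. Hence after about \<open>n * ln (16 * n)\<close>
  steps a light state has probability at most \<open>1/16 + 1/16\<close> from every start, and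
  \<open>burn\<close> further steps suffice.\<close>

lemma mixing_moderate:
  assumes n: "2 \<le> n" and M: "1 + M \<le> 4 ^ n"
    and anti: "\<And>S T i. T \<subseteq> S \<Longrightarrow> i \<in> V - S \<Longrightarrow> 0 < m S \<Longrightarrow> m (insert i S) * m T \<le> m (insert i T) * m S"
  shows "ereal_of_enat (mixing_time X m (glauber n X m)) \<le> ereal (1000 * (L * ln n))"
proof -
  define t0 where "t0 = nat \<lceil>real n * ln (16 * real n)\<rceil>"
  define B where "B = {S\<in>X. m S < 1 / 2 ^ (4 * n\<^sup>2)}"
  have BX: "B \<subseteq> X" by (auto simp: B_def)
  have m0: "1 \<le> m {} * 2 ^ (n + 2 * n\<^sup>2)"
  proof -
    have grow: "m S \<le> m {} * (1 + M) ^ card S" if "S \<subseteq> V" for S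
    proof -
      have "finite S" using that finite_subset by blast
      then show ?thesis using that
      proof (induction S rule: finite_induct)
        case (insert i S)
        have "m (insert i S) \<le> M * m S" using insert by (intro ratio_le) auto
        also have "\<dots> \<le> (1 + M) * m S" using nonneg by (intro mult_right_mono) auto
        also have "\<dots> \<le> (1 + M) * (m {} * (1 + M) ^ card S)" using insert M_nonneg by (intro mult_left_mono) auto
        finally show ?case using insert by (simp add: mult_ac)
      qed simp
    qed
    have "1 = (\<Sum>S\<in>Pow V. m S)" by (rule total_1[symmetric])
    also have "\<dots> \<le> (\<Sum>S\<in>Pow V. m {} * (4 ^ n) ^ n)"
    proof (rule sum_mono)
      fix S assume S: "S \<in> Pow V"
      then have "card S \<le> n" using card_mono[of V S] by simp
      then have "(1 + M) ^ card S \<le> (1 + M) ^ n" using M_nonneg by (intro power_increasing) auto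
      also have "\<dots> \<le> (4 ^ n) ^ n" using M M_nonneg by (intro power_mono) auto
      finally have "m {} * (1 + M) ^ card S \<le> m {} * (4 ^ n) ^ n" using nonneg by (intro mult_left_mono)
      then show "m S \<le> m {} * (4 ^ n) ^ n" using grow[of S] S by simp
    qed
    also have "\<dots> = m {} * (2 ^ n * (4 ^ n) ^ n)" by (simp add: card_Pow)
    also have "(2::real) ^ n * (4 ^ n) ^ n = 2 ^ (n + 2 * n\<^sup>2)"
    proof -
      have "(4::real) ^ k = 2 ^ (2 * k)" for k by (simp add: power_mult)
      then have "((4::real) ^ n) ^ n = 2 ^ (2 * n\<^sup>2)" by (simp only: power_mult[symmetric] power2_eq_square mult.assoc)
      then show ?thesis by (simp add: power_add)
    qed
    finally show ?thesis .
  qed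
  have "(\<Sum>S\<in>B. m S) / m {} \<le> 1 / 16"
  proof -
    have "(\<Sum>S\<in>B. m S) \<le> 2 ^ n * (1 / 2 ^ (4 * n\<^sup>2))"
      by (rule sum_subset_X_le[OF BX]) (auto simp: B_def)
    then have "(\<Sum>S\<in>B. m S) * 2 ^ (4 * n\<^sup>2) \<le> 2 ^ n" by (simp add: field_simps)
    \<comment> \<open>The summand 4 stands for the factor 16. For \<open>n = 2\<close> both sides
      are equal.\<close>
    moreover have "n + (n + 2 * n\<^sup>2) + 4 \<le> 4 * n\<^sup>2"
    proof -
      have "n + 2 \<le> n * n" using mult_le_mono1[OF n, of n] n by linarith
      then show ?thesis by (simp add: power2_eq_square)
    qed
    then have "(2::real) ^ (n + (n + 2 * n\<^sup>2) + 4) \<le> 2 ^ (4 * n\<^sup>2)" by (rule power_increasing) simp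
    then have "(2::real) ^ n * 2 ^ (n + 2 * n\<^sup>2) * 2 ^ 4 \<le> 2 ^ (4 * n\<^sup>2)" unfolding power_add .
    then have "(2::real) ^ n * 2 ^ (n + 2 * n\<^sup>2) * 16 \<le> 2 ^ (4 * n\<^sup>2)" by simp
    then have "(\<Sum>S\<in>B. m S) * ((2::real) ^ n * 2 ^ (n + 2 * n\<^sup>2) * 16) \<le> (\<Sum>S\<in>B. m S) * 2 ^ (4 * n\<^sup>2)"
      using nonneg by (intro mult_left_mono sum_nonneg) auto
    ultimately have "(\<Sum>S\<in>B. m S) * ((2::real) ^ n * 2 ^ (n + 2 * n\<^sup>2) * 16) \<le> 2 ^ n" by linarith
    moreover have "(\<Sum>S\<in>B. m S) * ((2::real) ^ n * 2 ^ (n + 2 * n\<^sup>2) * 16)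
      = 2 ^ n * ((\<Sum>S\<in>B. m S) * 2 ^ (n + 2 * n\<^sup>2) * 16)" by (simp only: mult_ac)
    ultimately have "2 ^ n * ((\<Sum>S\<in>B. m S) * 2 ^ (n + 2 * n\<^sup>2) * 16) \<le> 2 ^ n * 1"
      by (simp only: mult_1_right)
    then have "(\<Sum>S\<in>B. m S) * 2 ^ (n + 2 * n\<^sup>2) * 16 \<le> 1" by (rule mult_left_le_imp_le) simp
    also note m0
    finally have "(\<Sum>S\<in>B. m S) * 16 * 2 ^ (n + 2 * n\<^sup>2) \<le> m {} * 2 ^ (n + 2 * n\<^sup>2)"
      by (simp only: mult.assoc mult.commute[of 16])
    then have "(\<Sum>S\<in>B. m S) * 16 \<le> m {}" by (rule mult_right_le_imp_le) simp
    then show ?thesis using empty_pos by (simp add: field_simps)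
  qed
  moreover have "n * (1 - 1 / real n) ^ t0 \<le> 1 / 16"
  proof -
    have "(1 - 1 / real n) ^ t0 \<le> exp (- 1 / real n) ^ t0"
      using exp_ge_add_one_self[of "- 1 / real n"] n by (intro power_mono) auto
    also have "\<dots> = exp (- (real t0 / real n))" by (simp add: exp_of_nat_mult[symmetric])
    also have "\<dots> \<le> exp (- ln (16 * real n))"
    proof -
      have "real n * ln (16 * real n) \<le> real t0" unfolding t0_def by (rule real_nat_ceiling_ge)
      then have "ln (16 * real n) \<le> real t0 / real n" using n by (simp add: field_simps)
      then show ?thesis by simp
    qed
    also have "\<dots> = 1 / (16 * real n)" using n by (simp add: exp_minus field_simps)
    finally have "n * (1 - 1 / real n) ^ t0 \<le> n * (1 / (16 * real n))" by (intro mult_left_mono) auto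
    then show ?thesis using n by simp
  qed
  ultimately have small: "(P ^^ t0) (\<lambda>U. if U \<in> B then 1 else 0) S \<le> 1 / 8" if "S \<in> X" for S
    using Pk_indicator_le[OF anti BX that, of t0] by linarith
  have "mixing_time X m (glauber n X m) \<le> enat (t0 + burn)"
  proof (rule mixing_time_le)
    fix f S assume S: "S \<in> X" and f: "\<And>T. T \<in> X \<Longrightarrow> \<bar>f T\<bar> \<le> 1" "(\<Sum>T\<in>X. m T * f T) = 0"
    have "\<bar>(P ^^ burn) f U\<bar> \<le> 1 / 8 + (if U \<in> B then 1 else 0)" if U: "U \<in> X" for U
    proof (cases "U \<in> B")
      case True
      then show ?thesis using Pk_bounded[where f=f and k=burn, OF f(1) U] by simp
    next
      case False
      then show ?thesis using contraction_good[where f=f, OF U _ f] U by (simp add: B_def)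
    qed
    then have "\<bar>(P ^^ t0) ((P ^^ burn) f) S\<bar> \<le> (P ^^ t0) (\<lambda>U. 1 / 8 + (if U \<in> B then 1 else 0)) S"
      by (rule Pk_abs_le[OF _ S])
    also have "\<dots> \<le> 1 / 4" unfolding Pk_add_const[OF S] using small[OF S] by simp
    finally show "\<bar>(P ^^ (t0 + burn)) f S\<bar> \<le> 1 / 4" by (simp add: funpow_add)
  qed
  then have "ereal_of_enat (mixing_time X m (glauber n X m)) \<le> ereal_of_enat (enat (t0 + burn))"
    by (simp only: ereal_of_enat_le_iff)
  also have "\<dots> = ereal (real (t0 + burn))" by simp
  also have "real (t0 + burn) \<le> 1000 * (L * ln n)"
  proof -
    have l: "2 / 3 \<le> ln (real n)" using ln2_ge_two_thirds n by (intro order_trans[OF ln2_ge_two_thirds]) auto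
    have nL: "real n \<le> L" unfolding L_def using M_nonneg mult_right_mono[of 1 "1 + M" "real n"] by simp
    have "ln (16 * real n) = 4 * ln 2 + ln (real n)"
      using n ln_realpow[of 2 4] by (simp add: ln_mult)
    also have "\<dots> \<le> 5 * ln (real n)" using n by simp
    finally have a: "real n * ln (16 * real n) \<le> L * (5 * ln (real n))"
      using nL l L_ge n by (intro mult_mono) auto
    have "0 \<le> real n * ln (16 * real n)" using n by simp
    then have "real t0 \<le> real n * ln (16 * real n) + 1" unfolding t0_def by (simp add: of_nat_ceiling)
    moreover have "1 \<le> 2 * (L * ln (real n))" using mult_mono[OF L_ge l] L_ge by simp
    ultimately have "real t0 \<le> 7 * (L * ln n)" using a by simp
    moreover have "0 \<le> L * ln n" using l L_ge by simp
    ultimately show ?thesis using burn_le[OF n] by simp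
  qed
  finally show ?thesis by simp
qed

text \<open>Each of the at most \<open>2 ^ n\<close> light states has resistance bound
  \<open>32 * L / 4 ^ n\<close>, so the expected exit time is at most \<open>32 * L\<close>, and
  after \<open>256 * L\<close> steps the chain is still inside with probability at most 1/8.\<close>

lemma mixing_large:
  assumes n: "2 \<le> n" and M: "4 ^ n \<le> 1 + M"
    and up: "\<And>S. S \<in> X \<Longrightarrow> m S < 1 / 2 ^ (4 * n\<^sup>2) \<Longrightarrow> \<exists>S'\<in>X. adjacent_up (4 ^ n) S S'"
  shows "ereal_of_enat (mixing_time X m (glauber n X m)) \<le> ereal (1000 * (L * ln n))"
proof -
  define B where "B = {S\<in>X. m S < 1 / 2 ^ (4 * n\<^sup>2)}"
  define J where "J = nat \<lceil>256 * L\<rceil>"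
  have BX: "B \<subseteq> X" by (auto simp: B_def)
  have J: "256 * L \<le> real J" unfolding J_def by (rule real_nat_ceiling_ge)
  have J1: "1 \<le> J" using J L_ge by linarith
  have k4: "(4::real) \<le> 4 ^ n" using n power_increasing[of 1 n "4::real"] by simp
  have "mixing_time X m (glauber n X m) \<le> enat (burn + J)"
  proof (rule mixing_time_le)
    fix f S assume S: "S \<in> X" and f: "\<And>T. T \<in> X \<Longrightarrow> \<bar>f T\<bar> \<le> 1" "(\<Sum>T\<in>X. m T * f T) = 0"
    have "\<bar>(P ^^ (burn + J)) f S\<bar> \<le> 1 / 8 + card B * (32 * L / 4 ^ n) / J"
    proof (rule exit_bound[where f=f, OF BX _ _ f(1) _ _ S J1])
      show "0 \<le> 32 * L / 4 ^ n" using L_ge by simp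
      show "m T * (u T)\<^sup>2 \<le> 32 * L / 4 ^ n * (ip u u - ip u (P u))"
        if "T \<in> B" "\<And>z. z \<in> X - B \<Longrightarrow> u z = 0" for T u
        unfolding ip_edge_form using that BX up
        by (intro resistance_bound[OF BX k4 M]) (auto simp: B_def)
      show "\<bar>(P ^^ (burn + j)) f y\<bar> \<le> 1 / 8" if y: "y \<in> X - B" for y j
      proof -
        have "\<bar>(P ^^ burn) ((P ^^ j) f) y\<bar> \<le> 1 / 8"
          using y Pk_bounded[where f=f, OF f(1)] f(2) by (intro contraction_good) (auto simp: B_def mean_Pk)
        then show ?thesis by (simp add: funpow_add)
      qed
    qed auto
    also have "card B * (32 * L / 4 ^ n) / J \<le> 1 / 8"
    proof -
      have "card B \<le> card (Pow V)" using BX by (intro card_mono) (auto simp: X_def)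
      then have "card B \<le> 2 ^ n" by (simp add: card_Pow)
      then have "real (card B) \<le> 2 ^ n" by (metis of_nat_le_iff of_nat_numeral of_nat_power)
      also have "(2::real) ^ n \<le> 4 ^ n" by (intro power_mono) auto
      finally have "real (card B) / 4 ^ n \<le> 1" by simp
      then have "real (card B) / 4 ^ n * (32 * L) \<le> 1 * (32 * L)" using L_ge by (intro mult_right_mono) auto
      then have "card B * (32 * L / 4 ^ n) \<le> 32 * L" by simp
      also have "\<dots> \<le> 1 / 8 * J" using J by simp
      finally show ?thesis using J1 by (subst pos_divide_le_eq) simp_all
    qed
    finally show "\<bar>(P ^^ (burn + J)) f S\<bar> \<le> 1 / 4" by simp
  qed
  then have "ereal_of_enat (mixing_time X m (glauber n X m)) \<le> ereal_of_enat (enat (burn + J))"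
    by (simp only: ereal_of_enat_le_iff)
  also have "\<dots> = ereal (real (burn + J))" by simp
  also have "real (burn + J) \<le> 1000 * (L * ln n)"
  proof -
    have l: "2 / 3 \<le> ln (real n)" using ln2_ge_two_thirds n by (intro order_trans[OF ln2_ge_two_thirds]) auto
    have "real J \<le> 256 * L + 1" unfolding J_def using L_ge by (simp add: of_nat_ceiling)
    also have "\<dots> \<le> 257 * L" using L_ge by simp
    also have "\<dots> \<le> 257 * (3 / 2 * (L * ln n))"
      using mult_left_mono[OF l, of L] L_ge by simp
    finally have "real J \<le> 386 * (L * ln n)" using l L_ge by simp
    then show ?thesis using burn_le[OF n] l L_ge by simp
  qed
  finally show ?thesis by simp
qed

end

section \<open>Determinantal point processes\<close>

lemma ppow_nonneg: "0 \<le> ppow \<alpha> x"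
  by (simp add: ppow_def)

lemma ppow_pos_iff: "0 < ppow \<alpha> x \<longleftrightarrow> 0 < x"
  by (simp add: ppow_def)

lemma ppow_mono: "0 \<le> \<alpha> \<Longrightarrow> x \<le> y \<Longrightarrow> ppow \<alpha> x \<le> ppow \<alpha> y"
  by (auto simp: ppow_def powr_mono2)

lemma psd_of_pos_semidef_mat:
  assumes "pos_semidef_mat n L"
  shows "psd {..<n} (\<lambda>i j. L $$ (i, j))"
  unfolding psd_def
proof (intro conjI ballI allI)
  have L: "L \<in> carrier_mat n n" "transpose_mat L = L"
    and form: "\<And>v. v \<in> carrier_vec n \<Longrightarrow> 0 \<le> scalar_prod v (L *\<^sub>v v)"
    using assms by (auto simp: pos_semidef_mat_def)
  show "L $$ (a, b) = L $$ (b, a)" if "a \<in> {..<n}" "b \<in> {..<n}" for a b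
  proof -
    have "transpose_mat L $$ (a, b) = L $$ (b, a)" using that L(1) by (intro index_transpose_mat) auto
    then show ?thesis using L(2) by simp
  qed
  fix v :: "nat \<Rightarrow> real"
  have "scalar_prod (vec n v) (L *\<^sub>v vec n v) = (\<Sum>a = 0..<n. v a * (\<Sum>b = 0..<n. L $$ (a, b) * v b))"
    using L(1) by (simp add: scalar_prod_def)
  also have "\<dots> = (\<Sum>a<n. \<Sum>b<n. L $$ (a, b) * v a * v b)"
    by (simp add: atLeast0LessThan sum_distrib_left mult_ac)
  finally show "0 \<le> (\<Sum>a<n. \<Sum>b<n. L $$ (a, b) * v a * v b)" using form[of "vec n v"] by simp
qed

locale dpp_setting =
  fixes n :: nat and A :: "nat \<Rightarrow> nat \<Rightarrow> real" and \<alpha> :: real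
  assumes n1: "1 \<le> n" and A: "psd {..<n} A" and \<alpha>: "0 \<le> \<alpha>" "\<alpha> \<le> 1"
begin

definition Z :: real where "Z = (\<Sum>T\<in>Pow {..<n}. ppow \<alpha> (minor n A T))"

definition \<mu> :: "nat set \<Rightarrow> real" where
  "\<mu> S = (if S \<subseteq> {..<n} then ppow \<alpha> (minor n A S) / Z else 0)"

definition M :: real where "M = Max ((\<lambda>i. A i i powr \<alpha>) ` {..<n})"

lemma Z_pos: "0 < Z"
proof -
  have "ppow \<alpha> (minor n A {}) \<le> Z" unfolding Z_def by (rule member_le_sum) (auto simp: ppow_nonneg)
  then show ?thesis by (simp add: ppow_def)
qed

lemma mu_pos_iff: "0 < \<mu> S \<longleftrightarrow> S \<subseteq> {..<n} \<and> 0 < minor n A S"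
  using Z_pos by (simp add: \<mu>_def ppow_pos_iff zero_less_divide_iff)

lemma mu_nonneg: "0 \<le> \<mu> S"
  using Z_pos by (simp add: \<mu>_def ppow_nonneg less_imp_le)

lemma mu_complement:
  assumes S: "S \<subseteq> {..<n}" and pos: "0 < \<mu> S"
  obtains K where "psd ({..<n} - S) K" "\<And>i. i \<in> {..<n} - S \<Longrightarrow> \<mu> (insert i S) = \<mu> S * ppow \<alpha> (K i i)"
    "\<And>i j. i \<in> {..<n} - S \<Longrightarrow> j \<in> {..<n} - S \<Longrightarrow> i \<noteq> j \<Longrightarrow>
       \<mu> (insert i (insert j S)) = \<mu> S * ppow \<alpha> (K i i * K j j - (K i j)\<^sup>2)"
proof -
  have p: "0 < minor n A S" using pos by (simp add: mu_pos_iff)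
  obtain K where K: "psd ({..<n} - S) K"
    "\<And>i. i \<in> {..<n} - S \<Longrightarrow> minor n A (insert i S) = minor n A S * K i i"
    "\<And>i j. i \<in> {..<n} - S \<Longrightarrow> j \<in> {..<n} - S \<Longrightarrow> i \<noteq> j \<Longrightarrow>
       minor n A (insert i (insert j S)) = minor n A S * (K i i * K j j - (K i j)\<^sup>2)"
    by (rule schur_complement[OF A S p]) blast
  show ?thesis
    by (rule that[OF K(1)]) (use S in \<open>simp_all add: \<mu>_def K(2,3) ppow_mult[OF p]\<close>)
qed

text \<open>A 2 by 2 minor of the Schur complement is at most the product of its diagonal entries,
  and \<open>ppow\<close> is monotone and multiplicative on non-negative numbers.\<close>

lemma mu_pair:
  assumes S: "S \<subseteq> {..<n}" and ij: "i \<in> {..<n} - S" "j \<in> {..<n} - S" "i \<noteq> j" and pos: "0 < \<mu> S"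
  shows "\<mu> (insert i (insert j S)) * \<mu> S \<le> \<mu> (insert i S) * \<mu> (insert j S)"
proof -
  obtain K where K: "psd ({..<n} - S) K" "\<And>i. i \<in> {..<n} - S \<Longrightarrow> \<mu> (insert i S) = \<mu> S * ppow \<alpha> (K i i)"
    "\<And>i j. i \<in> {..<n} - S \<Longrightarrow> j \<in> {..<n} - S \<Longrightarrow> i \<noteq> j \<Longrightarrow>
       \<mu> (insert i (insert j S)) = \<mu> S * ppow \<alpha> (K i i * K j j - (K i j)\<^sup>2)"
    by (rule mu_complement[OF S pos]) blast
  have d: "0 \<le> K i i" "0 \<le> K j j" using psd_diag[OF K(1)] ij by auto
  have "ppow \<alpha> (K i i * K j j - (K i j)\<^sup>2) \<le> ppow \<alpha> (K i i * K j j)"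
    by (rule ppow_mono[OF \<alpha>(1)]) simp
  also have "\<dots> = ppow \<alpha> (K i i) * ppow \<alpha> (K j j)"
  proof (cases "K i i = 0")
    case False
    then show ?thesis using d by (intro ppow_mult) simp
  qed (simp add: ppow_def)
  finally have "\<mu> S * \<mu> S * ppow \<alpha> (K i i * K j j - (K i j)\<^sup>2) \<le> \<mu> S * \<mu> S * (ppow \<alpha> (K i i) * ppow \<alpha> (K j j))"
    using mu_nonneg by (intro mult_left_mono) auto
  then show ?thesis using K(2,3) ij by (simp add: mult_ac)
qed

lemma mu_down: "0 < \<mu> S \<Longrightarrow> T \<subseteq> S \<Longrightarrow> 0 < \<mu> T"
  using minor_subset_pos[OF A, of S T] by (auto simp: mu_pos_iff)

text \<open>The elements of \<open>S - T\<close> are added one at a time; each addition is an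
  instance of \<open>mu_pair\<close>, after which a positive mass cancels.\<close>

lemma mu_ratio_antimono:
  assumes TS: "T \<subseteq> S" and i: "i \<in> {..<n} - S" and pos: "0 < \<mu> S"
  shows "\<mu> (insert i S) * \<mu> T \<le> \<mu> (insert i T) * \<mu> S"
proof -
  have SV: "S \<subseteq> {..<n}" using pos by (simp add: mu_pos_iff)
  have "\<mu> (insert i (T \<union> D)) * \<mu> T \<le> \<mu> (insert i T) * \<mu> (T \<union> D)" if "finite D" "T \<union> D \<subseteq> S" for D
    using that
  proof (induction D rule: finite_induct)
    case (insert k D)
    define U where "U = T \<union> D"
    have IH: "\<mu> (insert i U) * \<mu> T \<le> \<mu> (insert i T) * \<mu> U" using insert by (simp add: U_def)
    have e: "T \<union> insert k D = insert k U" by (simp add: U_def)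
    show ?case
    proof (cases "k \<in> U")
      case True
      then have "insert k U = U" by auto
      then show ?thesis unfolding e using IH by simp
    next
      case False
      have US: "insert k U \<subseteq> S" using insert.prems by (simp add: U_def)
      have pU: "0 < \<mu> U" by (rule mu_down[OF pos]) (use US in blast)
      have UV: "U \<subseteq> {..<n}" and ik: "i \<in> {..<n} - U" "k \<in> {..<n} - U" "i \<noteq> k" using US SV i False by auto
      have "(\<mu> (insert i (insert k U)) * \<mu> T) * \<mu> U = (\<mu> (insert i (insert k U)) * \<mu> U) * \<mu> T" by simp
      also have "\<dots> \<le> (\<mu> (insert i U) * \<mu> (insert k U)) * \<mu> T"
        using mu_pair[OF UV ik pU] mu_nonneg by (rule mult_right_mono)
      also have "\<dots> = (\<mu> (insert i U) * \<mu> T) * \<mu> (insert k U)" by simp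
      also have "\<dots> \<le> (\<mu> (insert i T) * \<mu> U) * \<mu> (insert k U)" using IH mu_nonneg by (rule mult_right_mono)
      also have "\<dots> = (\<mu> (insert i T) * \<mu> (insert k U)) * \<mu> U" by simp
      finally show ?thesis unfolding e using pU by (rule mult_right_le_imp_le)
    qed
  qed simp
  moreover have "T \<union> (S - T) = S" using TS by auto
  moreover have "finite (S - T)" using SV finite_subset by blast
  ultimately show ?thesis by (metis order_refl)
qed

lemma mu_empty: "\<mu> {} = 1 / Z" by (simp add: \<mu>_def ppow_def)

text \<open>As ratios decrease with the set, the ratio for \<open>i\<close> is largest at the empty
  set, where it is \<open>ppow \<alpha> (A i i)\<close>.\<close>

lemma mu_ratio_le:
  assumes i: "i \<in> {..<n} - S"
  shows "\<mu> (insert i S) \<le> M * \<mu> S"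
proof (cases "0 < \<mu> S")
  case False
  then have "\<mu> S = 0" using mu_nonneg[of S] by simp
  moreover have "\<mu> (insert i S) = 0" using mu_down[of "insert i S" S] False mu_nonneg[of "insert i S"] by force
  ultimately show ?thesis by simp
next
  case True
  have "\<mu> {i} = ppow \<alpha> (A i i) * \<mu> {}" using i by (simp add: mu_empty \<mu>_def minor_singleton ppow_def[of \<alpha> 1])
  also have "\<dots> \<le> M * \<mu> {}"
  proof (rule mult_right_mono[OF _ mu_nonneg])
    have "A i i powr \<alpha> \<le> M" unfolding M_def using i by (intro Max_ge) auto
    moreover from this have "0 \<le> M" by (rule order_trans[OF powr_ge_zero])
    ultimately show "ppow \<alpha> (A i i) \<le> M" by (simp add: ppow_def)
  qed
  finally have *: "\<mu> {i} \<le> M * \<mu> {}" .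
  have "\<mu> (insert i S) * \<mu> {} \<le> \<mu> {i} * \<mu> S"
    using mu_ratio_antimono[of "{}" S i] i True by simp
  also have "\<dots> \<le> M * \<mu> {} * \<mu> S" using True by (intro mult_right_mono[OF *]) auto
  finally have "\<mu> (insert i S) * \<mu> {} \<le> (M * \<mu> S) * \<mu> {}" by (simp only: mult_ac)
  moreover have "0 < \<mu> {}" using Z_pos by (simp add: mu_empty)
  ultimately show ?thesis by simp
qed

lemma M_nonneg: "0 \<le> M"
proof -
  have "A 0 0 powr \<alpha> \<le> M" unfolding M_def using n1 by (intro Max_ge) auto
  then show ?thesis using powr_ge_zero[of "A 0 0" \<alpha>] by linarith
qed

sublocale glauber_family n \<mu> M
proof
  show "finite {..<n}" by simp
  show "0 \<le> \<mu> S" for S by (rule mu_nonneg)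
  show "\<mu> S = 0" if "\<not> S \<subseteq> {..<n}" for S using that by (simp add: \<mu>_def)
  show "0 < \<mu> {}" using Z_pos by (simp add: mu_empty)
  show "0 < \<mu> T" if "0 < \<mu> S" "T \<subseteq> S" for S T by (rule mu_down[OF that])
  show "0 \<le> (\<Sum>i\<in>{..<n}-S. \<Sum>j\<in>{..<n}-S. (\<mu> (insert i S) * \<mu> (insert j S)
             - (if i = j then 0 else \<mu> S * \<mu> (insert i (insert j S)))) * u i * u j)"
    if S: "S \<subseteq> {..<n}" and pos: "0 < \<mu> S" for S u
  proof -
    obtain K where K: "psd ({..<n} - S) K" "\<And>i. i \<in> {..<n} - S \<Longrightarrow> \<mu> (insert i S) = \<mu> S * ppow \<alpha> (K i i)"
      "\<And>i j. i \<in> {..<n} - S \<Longrightarrow> j \<in> {..<n} - S \<Longrightarrow> i \<noteq> j \<Longrightarrow>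
         \<mu> (insert i (insert j S)) = \<mu> S * ppow \<alpha> (K i i * K j j - (K i j)\<^sup>2)"
      by (rule mu_complement[OF S pos]) blast
    have "0 \<le> (\<mu> S)\<^sup>2 * (\<Sum>i\<in>{..<n}-S. \<Sum>j\<in>{..<n}-S. (ppow \<alpha> (K i i) * ppow \<alpha> (K j j)
      - ppow \<alpha> (K i i * K j j - (K i j)\<^sup>2)) * u i * u j)"
      by (intro mult_nonneg_nonneg psd_ppow[OF _ K(1) \<alpha>]) auto
    also have "\<dots> = (\<Sum>i\<in>{..<n}-S. \<Sum>j\<in>{..<n}-S. (\<mu> (insert i S) * \<mu> (insert j S)
             - (if i = j then 0 else \<mu> S * \<mu> (insert i (insert j S)))) * u i * u j)"
      unfolding sum_distrib_left
    proof (intro sum.cong refl)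
      fix i j assume ij: "i \<in> {..<n}-S" "j \<in> {..<n}-S"
      show "(\<mu> S)\<^sup>2 * ((ppow \<alpha> (K i i) * ppow \<alpha> (K j j) - ppow \<alpha> (K i i * K j j - (K i j)\<^sup>2)) * u i * u j)
        = (\<mu> (insert i S) * \<mu> (insert j S) - (if i = j then 0 else \<mu> S * \<mu> (insert i (insert j S)))) * u i * u j"
      proof (cases "i = j")
        case True
        have "ppow \<alpha> (K j j * K j j - (K j j)\<^sup>2) = 0" by (simp add: ppow_def power2_eq_square)
        then show ?thesis using K(2)[OF ij(2)] True by (simp add: power2_eq_square)
      next
        case False
        then show ?thesis using K(2)[OF ij(1)] K(2)[OF ij(2)] K(3)[OF ij False]
          by (simp add: power2_eq_square algebra_simps)
      qed
    qed
    finally show ?thesis .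
  qed
  show "1 \<le> n" by (rule n1)
  show "(\<Sum>S\<in>Pow {..<n}. \<mu> S) = 1"
  proof -
    have "(\<Sum>S\<in>Pow {..<n}. \<mu> S) = (\<Sum>S\<in>Pow {..<n}. ppow \<alpha> (minor n A S)) / Z"
      unfolding sum_divide_distrib by (intro sum.cong refl) (simp add: \<mu>_def)
    then show ?thesis using Z_pos by (simp add: Z_def[symmetric])
  qed
  show "0 \<le> M" by (rule M_nonneg)
  show "\<mu> (insert i S) \<le> M * \<mu> S" if "i \<in> {..<n} - S" for S i by (rule mu_ratio_le[OF that])
qed

text \<open>If no neighbour gains a factor \<open>4 ^ n\<close> in mass, none gains
  \<open>l = 4 ^ (n / \<alpha>)\<close> in the minor, and then no minor exceeds that of
  \<open>S\<close> by more than \<open>fact n * l ^ n\<close>. Raised to the power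
  \<open>\<alpha>\<close> this is at most \<open>2 ^ (n^2 + 2 * n^2)\<close>; summing over the
  \<open>2 ^ n\<close> sets gives \<open>1 \<le> 2 ^ (4 * n^2) * \<mu> S\<close>.\<close>

lemma improving_move:
  assumes n: "2 \<le> n" and big: "4 ^ n \<le> 1 + M" and S: "S \<in> X" and small: "\<mu> S < 1 / 2 ^ (4 * n\<^sup>2)"
  shows "\<exists>S'\<in>X. adjacent_up (4 ^ n) S S'"
proof (rule ccontr)
  assume no: "\<not> ?thesis"
  \<comment> \<open>For \<open>\<alpha> = 0\<close> one has \<open>M \<le> 1\<close>, which
    contradicts \<open>4 ^ n \<le> 1 + M\<close>.\<close>
  have \<alpha>0: "0 < \<alpha>"
  proof (rule ccontr)
    assume "\<not> 0 < \<alpha>"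
    then have "\<alpha> = 0" using \<alpha> by simp
    have "M \<le> 1" unfolding M_def
    proof (rule Max.boundedI)
      show "(\<lambda>i. A i i powr \<alpha>) ` {..<n} \<noteq> {}" using V_nonempty by simp
      show "a \<le> 1" if "a \<in> (\<lambda>i. A i i powr \<alpha>) ` {..<n}" for a
        using that \<open>\<alpha> = 0\<close> by (auto simp: powr_def)
    qed simp
    moreover have "(4::real) ^ 1 \<le> 4 ^ n" using n by (intro power_increasing) auto
    ultimately show False using big by simp
  qed
  define l where "l = (4 ^ n :: real) powr (1 / \<alpha>)"
  have l\<alpha>: "l powr \<alpha> = 4 ^ n" unfolding l_def using \<alpha>0 by (simp add: powr_powr)
  have l1: "1 \<le> l" unfolding l_def using \<alpha>0 by (intro ge_one_powr_ge_zero) auto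
  have SV: "S \<subseteq> {..<n}" and pS: "0 < minor n A S" using S by (auto simp: X_def mu_pos_iff)
  have le: "minor n A S' \<le> l * minor n A S"
    if S': "S' \<subseteq> {..<n}" "(\<exists>j\<in>V-S. S' = insert j S) \<or> (\<exists>i\<in>S. S' = S - {i}) \<or> (\<exists>i\<in>S. \<exists>j\<in>V-S. S' = insert j (S - {i}))" for S'
  proof (rule ccontr)
    assume "\<not> ?thesis"
    then have gt: "l * minor n A S < minor n A S'" by simp
    have pl: "0 < l * minor n A S" using l1 pS by simp
    have "4 ^ n * ppow \<alpha> (minor n A S) = ppow \<alpha> (l * minor n A S)"
      using ppow_mult[of l \<alpha> "minor n A S"] l1 l\<alpha> by (simp add: ppow_def)
    also have "\<dots> \<le> ppow \<alpha> (minor n A S')" using gt by (intro ppow_mono \<alpha>) simp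
    finally have "4 ^ n * \<mu> S \<le> \<mu> S'" using SV S'(1) Z_pos by (simp add: \<mu>_def divide_right_mono)
    then have "adjacent_up (4 ^ n) S S'" using S'(2) by (simp add: adjacent_up_def)
    moreover have "S' \<in> X" using S'(1) gt pl by (simp add: X_def mu_pos_iff)
    ultimately show False using no by blast
  qed
  have glob: "minor n A T \<le> fact n * l ^ n * minor n A S" if "T \<subseteq> {..<n}" for T
    by (rule minor_local_max[OF A SV pS l1 _ _ _ that]; rule le) (use SV in blast)+
  have fact_le: "(fact n :: real) \<le> (2 ^ n) ^ n"
  proof -
    have "(fact n :: real) \<le> of_nat (n ^ n)" by (rule fact_le_power)
    then have "(fact n :: real) \<le> real n ^ n" by simp
    also have "\<dots> \<le> (2 ^ n) ^ n" using of_nat_less_two_power[of n] by (intro power_mono) (auto intro: less_imp_le)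
    finally show ?thesis .
  qed
  have "1 = (\<Sum>T\<in>Pow V. \<mu> T)" by (rule total_1[symmetric])
  also have "\<dots> \<le> (\<Sum>T\<in>Pow V. (2 ^ n) ^ n * (4 ^ n) ^ n * \<mu> S)"
  proof (rule sum_mono)
    fix T assume T: "T \<in> Pow V"
    have f1: "1 \<le> (fact n :: real)" by (rule fact_ge_1)
    have "ppow \<alpha> (minor n A T) \<le> ppow \<alpha> (fact n * (l ^ n * minor n A S))"
      using glob[of T] T by (intro ppow_mono \<alpha>) (simp add: mult.assoc)
    also have "\<dots> = ppow \<alpha> (fact n) * (ppow \<alpha> (l ^ n) * ppow \<alpha> (minor n A S))"
      using l1 by (simp add: ppow_mult)
    also have "ppow \<alpha> (l ^ n) = (4 ^ n) ^ n"
    proof -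
      have "ppow \<alpha> (l ^ k) = ppow \<alpha> l ^ k" for k
        using l1 by (induction k) (simp_all add: ppow_mult ppow_def[of \<alpha> 1])
      then show ?thesis using l1 l\<alpha> by (simp add: ppow_def)
    qed
    also have "ppow \<alpha> (fact n) \<le> (2 ^ n) ^ n"
    proof -
      have "(fact n :: real) powr \<alpha> \<le> fact n powr 1" using f1 \<alpha> by (intro powr_mono) auto
      then show ?thesis using fact_le by (simp add: ppow_def)
    qed
    finally have "ppow \<alpha> (minor n A T) \<le> (2 ^ n) ^ n * ((4 ^ n) ^ n * ppow \<alpha> (minor n A S))"
      using ppow_nonneg by (simp add: mult_right_mono)
    then show "\<mu> T \<le> (2 ^ n) ^ n * (4 ^ n) ^ n * \<mu> S"
      using T SV Z_pos by (simp add: \<mu>_def divide_right_mono mult.assoc)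
  qed
  also have "\<dots> = 2 ^ n * ((2 ^ n) ^ n * (4 ^ n) ^ n) * \<mu> S" by (simp add: card_Pow)
  also have "(2::real) ^ n * ((2 ^ n) ^ n * (4 ^ n) ^ n) = 2 ^ (n + (n\<^sup>2 + 2 * n\<^sup>2))"
  proof -
    have "(4::real) ^ k = 2 ^ (2 * k)" for k by (simp add: power_mult)
    then have "((4::real) ^ n) ^ n = 2 ^ (2 * n\<^sup>2)" by (simp only: power_mult[symmetric] power2_eq_square mult.assoc)
    moreover have "((2::real) ^ n) ^ n = 2 ^ (n\<^sup>2)" by (simp only: power_mult[symmetric] power2_eq_square)
    ultimately show ?thesis by (simp only: power_add)
  qed
  also have "2 ^ (n + (n\<^sup>2 + 2 * n\<^sup>2)) * \<mu> S \<le> 2 ^ (4 * n\<^sup>2) * \<mu> S"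
  proof (rule mult_right_mono[OF power_increasing])
    have "n \<le> n\<^sup>2" by (simp add: power2_eq_square)
    then show "n + (n\<^sup>2 + 2 * n\<^sup>2) \<le> 4 * n\<^sup>2" by simp
  qed (auto simp: mu_nonneg)
  finally show False using small by (simp add: field_simps)
qed

lemma mixing_time_bound:
  assumes "2 \<le> n"
  shows "ereal_of_enat (mixing_time X \<mu> (glauber n X \<mu>)) \<le> ereal (1000 * (L * ln n))"
proof (cases "1 + M \<le> 4 ^ n")
  case True
  then show ?thesis using assms mu_ratio_antimono by (intro mixing_moderate) auto
next
  case False
  then show ?thesis using assms improving_move by (intro mixing_large) auto
qed

end

theorem theorem5p12:
  shows "\<exists>C > 0. \<forall>(n :: nat) (L :: real mat) (\<alpha> :: real).
    1 \<le> n \<and> pos_semidef_mat n L \<and> 0 \<le> \<alpha> \<and> \<alpha> \<le> 1 \<longrightarrow>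
    (let X = dpp_support n L;
         \<mu> = dpp n L \<alpha>;
         P = glauber n X \<mu>;
         M = Max ((\<lambda>i. (L $$ (i, i)) powr \<alpha>) ` {..<n})
     in strongly_log_concave n X (generating_poly X \<mu>) \<and>
        (\<exists>\<rho>\<^sub>0 \<ge> 1 / ((1 + M) * real n). MLSI X \<mu> P \<rho>\<^sub>0) \<and>
        (2 \<le> n \<longrightarrow>
           ereal_of_enat (mixing_time X \<mu> P) \<le> ereal (C * ((1 + M) * real n * ln (real n)))))"
\<comment> \<open>In units of \<open>(1 + M) * n * ln n\<close>, \<open>burn\<close> takes at most
  600, and the waiting or exit time at most 7 or 386.\<close>
proof (intro exI[of _ 1000] conjI allI impI)
  fix n :: nat and L :: "real mat" and \<alpha> :: real
  assume as: "1 \<le> n \<and> pos_semidef_mat n L \<and> 0 \<le> \<alpha> \<and> \<alpha> \<le> 1"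
  interpret D: dpp_setting n "\<lambda>i j. L $$ (i, j)" \<alpha>
    by standard (use as psd_of_pos_semidef_mat in auto)
  have L: "L \<in> carrier_mat n n" using as by (simp add: pos_semidef_mat_def)
  have pm: "principal_minor L S = minor n (\<lambda>i j. L $$ (i, j)) S" if "S \<subseteq> {..<n}" for S
    by (rule principal_minor_eq_minor[OF L that])
  have supp: "dpp_support n L = {S. S \<subseteq> {..<n} \<and> 0 < minor n (\<lambda>i j. L $$ (i, j)) S}"
    unfolding dpp_support_def using pm by auto
  have X: "dpp_support n L = D.X"
    unfolding supp D.X_def by (simp add: D.mu_pos_iff)
  \<comment> \<open>One side sums over the support, the other over all subsets; \<open>ppow\<close>
    is 0 on the difference, also for \<open>\<alpha> = 0\<close>.\<close>
  have Z: "(\<Sum>T\<in>dpp_support n L. principal_minor L T powr \<alpha>) = D.Z"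
    unfolding D.Z_def supp
    by (rule sum.mono_neutral_cong_left) (auto simp: ppow_def pm)
  have mu: "dpp n L \<alpha> = D.\<mu>"
  proof
    fix S
    show "dpp n L \<alpha> S = D.\<mu> S"
      unfolding dpp_def Z D.\<mu>_def using pm[of S] by (auto simp: supp ppow_def)
  qed
  have M: "Max ((\<lambda>i. (L $$ (i, i)) powr \<alpha>) ` {..<n}) = D.M" by (simp add: D.M_def)
  have "strongly_log_concave n D.X (generating_poly D.X D.\<mu>)"
    unfolding D.X_def by (rule strongly_log_concave_weighted_family) (rule D.weighted_family_axioms)
  moreover have "\<exists>\<rho>\<^sub>0 \<ge> 1 / ((1 + D.M) * real n). MLSI D.X D.\<mu> (glauber n D.X D.\<mu>) \<rho>\<^sub>0"
    using D.MLSI_glauber unfolding D.L_def by blast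
  moreover have "ereal_of_enat (mixing_time D.X D.\<mu> (glauber n D.X D.\<mu>)) \<le> ereal (1000 * ((1 + D.M) * real n * ln (real n)))"
    if "2 \<le> n" using D.mixing_time_bound[OF that] unfolding D.L_def .
  ultimately show "let X = dpp_support n L;
         \<mu> = dpp n L \<alpha>;
         P = glauber n X \<mu>;
         M = Max ((\<lambda>i. (L $$ (i, i)) powr \<alpha>) ` {..<n})
     in strongly_log_concave n X (generating_poly X \<mu>) \<and>
        (\<exists>\<rho>\<^sub>0 \<ge> 1 / ((1 + M) * real n). MLSI X \<mu> P \<rho>\<^sub>0) \<and>
        (2 \<le> n \<longrightarrow>
           ereal_of_enat (mixing_time X \<mu> P) \<le> ereal (1000 * ((1 + M) * real n * ln (real n))))"
    unfolding Let_def X mu M by blast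
qed simp

end
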